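(* Let $d\in\mathbb{N}$, let $O\subset\mathbb{R}^{d}$ be a non-empty open set, and let $\delta,\omega\in \mathrm{Meas}^+_{\mathrm{cmp}}(O)$. Then: (h) $\omega$ is a $\mathrm{har}(O)$-balayage of $\delta$ if and only if there exists a compact subset $S\subset O$ such that $\omega$ is a balayage of $\delta$ with respect to the class $\mathsf{K}(O\setminus S)\cup\bigl(-\mathsf{K}(O\setminus S)\bigr)$. (s) $\omega$ is a $\mathrm{sbh}(O)$-balayage of $\delta$ if and only if there exists a compact subset $S\subset O$ such that $\omega$ is a balayage of $\delta$ with respect to the class $\mathsf{K}(O)\cup\bigl(-\mathsf{K}(O\setminus S)\bigr)$.
   Context: $\mathrm{Meas}^+_{\mathrm{cmp}}(O)$ is the set of positive Borel (Radon) measures on $O$ whose support is a compact subset of $O$. $\mathrm{har}(O)$ is the class of harmonic functions on $O$, and $\mathrm{sbh}(O)$ is the class of subharmonic functions on $O$ (values in $\mathbb{R}\cup\{-\infty\}$; the function identically $-\infty$ on a connected component is allowed). For $d=1$, harmonic means locally affine and subharmonic means locally convex. Balayage: for a class $H$ of functions on $O$, $\omega$ is an $H$-balayage of $\delta$ (a balayage of $\delta$ with respect to $H$), written $\delta\preceq_H\omega$, if $\int h\,d\delta\le\int h\,d\omega$ for every $h\in H$. Integrals are taken in the extended real line; for the functions below they are well defined, since each $\mathsf{k}_x$ is bounded above on compact sets. For $s\in\mathbb{R}$ and $t>0$ put $k_s(t)=\ln t$ if $s=0$ and $k_s(t)=-\operatorname{sgn}(s)\,t^{-s}$ if $s\neq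 0$. For $x,y\in\mathbb{R}^d$ put $K_{d-2}(y,x)=k_{d-2}(|y-x|)$ if $y\ne x$; $K_{d-2}(x,x)=-\infty$ if $d\ge 2$; and $K_{d-2}(x,x)=0$ if $d=1$. Let $\mathsf{k}_x(y)=K_{d-2}(y,x)$ for $y\in\mathbb{R}^d$. For $X\subset\mathbb{R}^d$ let $\mathsf{K}(X)=\{\mathsf{k}_x: x\in X\}$ and $-\mathsf{K}(X)=\{-\mathsf{k}_x: x\in X\}$ (functions restricted to $O$). *)

theory Defs
  imports "HOL-Analysis.Analysis"
begin

text \<open>A general \<open>'a::euclidean_space\<close> plays the role of \<open>\<real>\<^sup>d\<close>, with \<open>d = DIM('a) \<ge> 1\<close>.\<close>

definition measure_support :: "'a::topological_space measure \<Rightarrow> 'a set" where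
  "measure_support M =
     {x \<in> space M. \<forall>U. open U \<longrightarrow> x \<in> U \<longrightarrow> emeasure M (U \<inter> space M) > 0}"

text \<open>The measures live on \<open>\<Omega>\<close> itself, so integrands only matter on \<open>\<Omega>\<close> and the support is
  automatically a subset of \<open>\<Omega>\<close>. On an open subset of a Euclidean space, a Borel measure that
  is finite on compact sets is Radon.\<close>

definition Meas_cmp :: "'a::euclidean_space set \<Rightarrow> 'a measure set" where
  "Meas_cmp \<Omega> =
     {M. sets M = sets (restrict_space borel \<Omega>) \<and>
         (\<forall>C. compact C \<longrightarrow> C \<subseteq> \<Omega> \<longrightarrow> emeasure M C < \<infinity>) \<and>
         compact (measure_support M)}"

text \<open>Extended integral, as the integral of the positive part minus that of the negative part
  (\<open>e2ennreal\<close> sends negative values to \<open>0\<close>). The case \<open>\<infinity> - \<infinity>\<close> does not occur below.\<close>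

definition ereal_integral :: "'a measure \<Rightarrow> ('a \<Rightarrow> ereal) \<Rightarrow> ereal" where
  "ereal_integral M f =
     enn2ereal (\<integral>\<^sup>+x. e2ennreal (f x) \<partial>M) - enn2ereal (\<integral>\<^sup>+x. e2ennreal (- f x) \<partial>M)"

definition balayage :: "('a \<Rightarrow> ereal) set \<Rightarrow> 'a measure \<Rightarrow> 'a measure \<Rightarrow> bool" where
  "balayage H \<delta> \<omega> \<longleftrightarrow> (\<forall>h\<in>H. ereal_integral \<delta> h \<le> ereal_integral \<omega> h)"

text \<open>In dimension at least 2, harmonic means twice continuously differentiable
  (with gradient \<open>g\<close> and Hessian \<open>H\<close>) and the trace of the Hessian vanishes.\<close>

definition harmonic_on :: "('a::euclidean_space \<Rightarrow> real) \<Rightarrow> 'a set \<Rightarrow> bool" where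
  "harmonic_on h \<Omega> \<longleftrightarrow>
     (if DIM('a) = 1
      then \<forall>x\<in>\<Omega>. \<exists>e>0. ball x e \<subseteq> \<Omega> \<and> (\<exists>a b. \<forall>y\<in>ball x e. h y = a \<bullet> y + b)
      else \<exists>(g :: 'a \<Rightarrow> 'a) (H :: 'a \<Rightarrow> 'a \<Rightarrow>\<^sub>L 'a).
             (\<forall>x\<in>\<Omega>. (h has_derivative (\<lambda>v. g x \<bullet> v)) (at x)) \<and>
             (\<forall>x\<in>\<Omega>. (g has_derivative blinfun_apply (H x)) (at x)) \<and>
             continuous_on \<Omega> H \<and>
             (\<forall>x\<in>\<Omega>. (\<Sum>b\<in>Basis. blinfun_apply (H x) b \<bullet> b) = 0))"

definition har :: "'a::euclidean_space set \<Rightarrow> ('a \<Rightarrow> ereal) set" where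
  "har \<Omega> = {\<lambda>x. ereal (h x) | h. harmonic_on h \<Omega>}"

text \<open>The normalized surface measure on \<open>sphere x r\<close>, obtained as the radial projection of the
  uniform distribution on the unit ball (\<open>sgn z = z /\<^sub>R norm z\<close>, and the centre is a null set).\<close>

definition sphere_measure :: "'a::euclidean_space \<Rightarrow> real \<Rightarrow> 'a measure" where
  "sphere_measure x r = distr (uniform_measure lborel (ball 0 1)) borel (\<lambda>z. x + r *\<^sub>R sgn z)"

text \<open>In dimension 1, extended convexity on \<open>ball x e\<close> forces \<open>u\<close> to be either real-valued and
  convex or identically \<open>-\<infinity>\<close> there, since \<open>u < \<infinity>\<close>. In higher dimensions: upper semicontinuity
  and the sub-mean value inequality over spheres.\<close>

definition subharmonic_on :: "('a::euclidean_space \<Rightarrow> ereal) \<Rightarrow> 'a set \<Rightarrow> bool" where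
  "subharmonic_on u \<Omega> \<longleftrightarrow>
     (\<forall>x\<in>\<Omega>. u x < \<infinity>) \<and>
     (if DIM('a) = 1
      then \<forall>x\<in>\<Omega>. \<exists>e>0. ball x e \<subseteq> \<Omega> \<and>
             (\<forall>y\<in>ball x e. \<forall>z\<in>ball x e. \<forall>t::real. 0 < t \<longrightarrow> t < 1 \<longrightarrow>
                u ((1 - t) *\<^sub>R y + t *\<^sub>R z) \<le> ereal (1 - t) * u y + ereal t * u z)
      else (\<forall>a. openin (top_of_set \<Omega>) {x\<in>\<Omega>. u x < a}) \<and>
           (\<forall>x r. 0 < r \<longrightarrow> cball x r \<subseteq> \<Omega> \<longrightarrow> u x \<le> ereal_integral (sphere_measure x r) u))"

definition sbh :: "'a::euclidean_space set \<Rightarrow> ('a \<Rightarrow> ereal) set" where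
  "sbh \<Omega> = {u. subharmonic_on u \<Omega>}"

definition kfun :: "real \<Rightarrow> real \<Rightarrow> real" where
  "kfun s t = (if s = 0 then ln t else - sgn s * t powr (- s))"

definition kernel :: "'a::euclidean_space \<Rightarrow> 'a \<Rightarrow> ereal" where
  "kernel y x =
     (if y \<noteq> x then ereal (kfun (real DIM('a) - 2) (norm (y - x)))
      else if DIM('a) \<ge> 2 then - \<infinity> else 0)"

definition Kclass :: "'a::euclidean_space set \<Rightarrow> ('a \<Rightarrow> ereal) set" where
  "Kclass X = {\<lambda>y. kernel y x | x. x \<in> X}"

definition neg_Kclass :: "'a::euclidean_space set \<Rightarrow> ('a \<Rightarrow> ereal) set" where
  "neg_Kclass X = {\<lambda>y. - kernel y x | x. x \<in> X}"

end

theory Submission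
  imports Defs "HOL-Complex_Analysis.Complex_Analysis"
begin

text \<open>Write \<open>k\<close> for the radial kernel, so that \<open>k\<^sub>x(y) = k(|y - x|)\<close>, and \<open>L\<close> for the Laplacian of a test
function \<open>f\<close>. Everything rests on Green's representation formula
\<open>c f(y) = \<integral> k(|x - y|) L(x) dx\<close> for compactly supported \<open>C\<^sup>2\<close> functions (\<open>greens_representation\<close>).
By Fubini's theorem it turns an integral of \<open>f\<close> against a measure into an integral of \<open>L\<close> against the
potential of that measure. Hence inequalities between the potentials of \<open>\<delta>\<close> and \<open>\<omega>\<close>,
required only where \<open>L\<close> has the matching sign, give \<open>\<integral> f d\<delta> \<le> \<integral> f d\<omega>\<close>
(\<open>integral_le_of_potentials_le\<close>).

From kernels to harmonic functions: multiply a harmonic function by a cut-off that is \<open>1\<close> near \<open>S\<close> and near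
both supports. The Laplacian of the product lives in \<open>\<Omega> - S\<close>, where the potentials agree.
From kernels to subharmonic functions: truncate \<open>u\<close> from below, mollify radially and cut off.
The submean inequality survives the mollification, so the Laplacian is nonnegative near \<open>S\<close>; elsewhere in \<open>\<Omega>\<close>
the potentials agree, so it drops out. Upper semicontinuity together with the submean inequality
makes the mollifications converge pointwise, and monotone convergence removes the truncation.

From harmonic functions to kernels: the kernel \<open>k\<^sub>x\<close> has its pole in \<open>\<Omega>\<close>, so it is not itself a test function.
If \<open>S\<close> is large, a point \<open>x\<close> of \<open>\<Omega> - S\<close> is either very close to some \<open>z\<close> outside \<open>\<Omega>\<close>, compared with the distance
of \<open>z\<close> from the supports, or very far from the origin. In the first case \<open>k(|y - z + t (z - x)|)\<close> and in the
second \<open>k(|t y - x|)\<close> is expanded in powers of \<open>t\<close>; both give \<open>k\<^sub>x(y)\<close> at \<open>t = 1\<close>. For fixed small \<open>t\<close> these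
functions have the mean value property in \<open>y\<close>, hence so has every Taylor coefficient, and a function with the mean
value property is harmonic (\<open>locally_mean_value_imp_harmonic\<close>). The coefficients are therefore test functions
on \<open>\<Omega>\<close>, and their series converges uniformly on the supports.
For subharmonic test functions the kernels of \<open>\<Omega>\<close> are test functions themselves, and harmonic functions are
subharmonic.

Spherical means enter in the form in which they are defined, as averages over directions of points of the unit ball.
Green's formula comes from a polar coordinate formula for this average and from the fact that the directional derivative of
a compactly supported Lipschitz function has integral zero. The truncated kernel \<open>k(max |x - y| e)\<close> yields
\<open>c\<close> times the mean of \<open>f\<close> over the sphere of radius \<open>e\<close> (\<open>newton_sph_mean\<close>). Comparing two radii gives the
mean value inequality, and \<open>e \<longlonglongrightarrow> 0\<close> gives the representation formula. All dimensions, including one, are treated at once;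
dimension one is separate only where the definitions of harmonic and subharmonic functions are unfolded.\<close>

section \<open>Polar coordinates and spherical means\<close>

lemma nn_integral_lborel_scale:
  fixes f :: "'a::euclidean_space \<Rightarrow> ennreal"
  assumes [measurable]: "f \<in> borel_measurable borel" and c: "c > 0"
  shows "(\<integral>\<^sup>+x. f x \<partial>lborel) = (\<integral>\<^sup>+x. ennreal (c ^ DIM('a)) * f (c *\<^sub>R x) \<partial>lborel)"
proof -
  have "(\<integral>\<^sup>+x. f x \<partial>lborel)
      = (\<integral>\<^sup>+x. f x \<partial>density (distr lborel borel (\<lambda>x::'a. 0 + c *\<^sub>R x)) (\<lambda>_. \<bar>c\<bar>^DIM('a)))"
    using lborel_affine[of c "0::'a"] c by simp
  also have "\<dots> = (\<integral>\<^sup>+x. ennreal (c ^ DIM('a)) * f (c *\<^sub>R x) \<partial>lborel)"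
    using c by (simp add: nn_integral_density nn_integral_distr)
  finally show ?thesis .
qed

lemma integral_lborel_plus:
  fixes f :: "'a::euclidean_space \<Rightarrow> 'b::{banach, second_countable_topology}"
  assumes [measurable]: "f \<in> borel_measurable borel"
  shows "(\<integral>x. f (a + x) \<partial>lborel) = (\<integral>x. f x \<partial>lborel)"
proof -
  have "(\<integral>x. f x \<partial>lborel) = (\<integral>x. f x \<partial>distr lborel borel ((+) a))"
    by (simp add: lborel_distr_plus)
  then show ?thesis by (simp add: integral_distr)
qed

lemma integrable_lborel_plus:
  fixes f :: "'a::euclidean_space \<Rightarrow> 'b::{banach, second_countable_topology}"
  assumes f: "integrable lborel f"
  shows "integrable lborel (\<lambda>x. f (a + x))"
proof -
  have "integrable (distr lborel borel ((+) a)) f"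
    using f by (simp add: lborel_distr_plus)
  then show ?thesis by (rule integrable_distr[rotated]) simp
qed

lemma lborel_uminus:
  "distr lborel borel (uminus :: 'a::euclidean_space \<Rightarrow> 'a) = lborel"
proof -
  have "(lborel :: 'a measure) = density (distr lborel borel (\<lambda>x. 0 + (-1) *\<^sub>R x)) (\<lambda>_. ennreal (\<bar>-1\<bar>^DIM('a)))"
    by (rule lborel_affine) simp
  then show ?thesis by (simp add: density_1)
qed

lemma nn_integral_tail_power:
  assumes "0 < a"
  shows "(\<integral>\<^sup>+s. ennreal (real (Suc n) / s ^ (n + 2)) * indicator {a<..} s \<partial>lborel)
       = ennreal (1 / a ^ Suc n)"
proof -
  have "(\<integral>\<^sup>+s. ennreal (real (Suc n) / s ^ (n + 2)) * indicator {a<..} s \<partial>lborel)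
     = (\<integral>\<^sup>+s. ennreal (real (Suc n) / s ^ (n + 2)) * indicator {a..} s \<partial>lborel)"
    by (rule nn_integral_cong_AE, rule AE_mp[OF AE_lborel_singleton[of a]])
       (auto split: split_indicator)
  also have "\<dots> = 0 - (- (1 / a ^ Suc n))"
  proof (rule nn_integral_FTC_atLeast)
    fix x assume "a \<le> x"
    then have "x \<noteq> 0" using assms by auto
    show "((\<lambda>s. - (1 / s ^ Suc n)) has_real_derivative real (Suc n) / x ^ (n + 2)) (at x)"
      using \<open>x \<noteq> 0\<close> unfolding divide_inverse mult_1_left
      by (intro DERIV_cong[OF DERIV_minus[OF DERIV_inverse_fun[OF DERIV_pow[of "Suc n" x]]]])
         (simp_all add: field_simps)
  next
    show "((\<lambda>s::real. - (1 / s ^ Suc n)) \<longlongrightarrow> 0) at_top"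
      by real_asymp
  qed (use assms in auto)
  finally show ?thesis by simp
qed

text \<open>A Tonelli argument without any surface measure: substituting \<open>r = s |z|\<close> and then \<open>y = s z\<close> turns the
iterated integral into \<open>\<integral> f(y) |y|\<^sup>d \<integral>\<^bsub>s > |y|\<^esub> d s\<^bsup>-d-1\<^esup> ds dy\<close>, whose inner integral is \<open>|y|\<^bsup>-d\<^esup>\<close>.\<close>

lemma polar_ball:
  fixes f :: "'a::euclidean_space \<Rightarrow> ennreal"
  assumes [measurable]: "f \<in> borel_measurable borel"
  shows "(\<integral>\<^sup>+x. f x \<partial>lborel)
    = (\<integral>\<^sup>+z. indicator (ball 0 1) z *
         (\<integral>\<^sup>+r. ennreal (DIM('a) * r ^ (DIM('a) - 1)) * indicator {0<..} r * f (r *\<^sub>R sgn z) \<partial>lborel) \<partial>lborel)"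
proof -
  define n where "n = DIM('a) - 1"
  have [measurable]: "Measurable.pred borel (\<lambda>z::'a. z \<in> ball 0 1)"
    by (simp add: pred_def)
  have [measurable]: "(\<lambda>x. f (fst x *\<^sub>R snd x)) \<in> borel_measurable (lborel \<Otimes>\<^sub>M lborel)"
    by (rule measurable_compose[OF _ assms]) measurable
  have d: "DIM('a) = Suc n" using DIM_positive[where 'a='a] by (simp add: n_def)
  have "(\<integral>\<^sup>+z. indicator (ball 0 1) z *
         (\<integral>\<^sup>+r. ennreal (DIM('a) * r ^ (DIM('a) - 1)) * indicator {0<..} r * f (r *\<^sub>R sgn z) \<partial>lborel) \<partial>lborel)
      = (\<integral>\<^sup>+z. (\<integral>\<^sup>+s. indicator (ball 0 1) z *
          (ennreal (Suc n * norm z ^ Suc n * s ^ n) * indicator {0<..} s * f (s *\<^sub>R z)) \<partial>lborel) \<partial>lborel)"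
  proof (rule nn_integral_cong_AE, rule AE_mp[OF AE_lborel_singleton[of 0]], intro AE_I2 impI)
    fix z :: 'a assume z: "z \<noteq> 0"
    have "(\<integral>\<^sup>+r. ennreal (DIM('a) * r ^ (DIM('a) - 1)) * indicator {0<..} r * f (r *\<^sub>R sgn z) \<partial>lborel)
       = ennreal \<bar>norm z\<bar> * (\<integral>\<^sup>+s. ennreal (DIM('a) * (0 + norm z * s) ^ (DIM('a) - 1)) *
            indicator {0<..} (0 + norm z * s) * f ((0 + norm z * s) *\<^sub>R sgn z) \<partial>lborel)"
      by (rule nn_integral_real_affine) (use z in auto)
    also have "\<dots> = (\<integral>\<^sup>+s. ennreal \<bar>norm z\<bar> * (ennreal (DIM('a) * (0 + norm z * s) ^ (DIM('a) - 1)) *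
            indicator {0<..} (0 + norm z * s) * f ((0 + norm z * s) *\<^sub>R sgn z)) \<partial>lborel)"
      by (rule nn_integral_cmult[symmetric]) simp
    also have "\<dots> = (\<integral>\<^sup>+s. ennreal (Suc n * norm z ^ Suc n * s ^ n) * indicator {0<..} s * f (s *\<^sub>R z) \<partial>lborel)"
    proof (rule nn_integral_cong)
      fix s :: real
      have "(norm z * s) *\<^sub>R sgn z = s *\<^sub>R z"
        using z by (simp add: sgn_div_norm mult.commute)
      moreover have "ennreal \<bar>norm z\<bar> * ennreal (DIM('a) * (norm z * s) ^ (DIM('a) - 1))
          = ennreal (Suc n * norm z ^ Suc n * s ^ n)" if "s > 0"
        using that by (simp add: d power_mult_distrib algebra_simps flip: ennreal_mult)
      ultimately show "ennreal \<bar>norm z\<bar> * (ennreal (DIM('a) * (0 + norm z * s) ^ (DIM('a) - 1)) *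
            indicator {0<..} (0 + norm z * s) * f ((0 + norm z * s) *\<^sub>R sgn z))
        = ennreal (Suc n * norm z ^ Suc n * s ^ n) * indicator {0<..} s * f (s *\<^sub>R z)"
        using z by (cases "s > 0") (simp_all add: zero_less_mult_iff flip: mult.assoc)
    qed
    finally show "indicator (ball 0 1) z *
         (\<integral>\<^sup>+r. ennreal (DIM('a) * r ^ (DIM('a) - 1)) * indicator {0<..} r * f (r *\<^sub>R sgn z) \<partial>lborel)
       = (\<integral>\<^sup>+s. indicator (ball 0 1) z *
          (ennreal (Suc n * norm z ^ Suc n * s ^ n) * indicator {0<..} s * f (s *\<^sub>R z)) \<partial>lborel)"
      by (simp add: nn_integral_cmult)
  qed
  also have "\<dots> = (\<integral>\<^sup>+s. (\<integral>\<^sup>+z. indicator (ball 0 1) z *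
          (ennreal (Suc n * norm z ^ Suc n * s ^ n) * indicator {0<..} s * f (s *\<^sub>R z)) \<partial>lborel) \<partial>lborel)"
    by (rule lborel_pair.Fubini') measurable
  \<comment> \<open>The scaling \<open>y = s z\<close> for fixed \<open>s\<close>.\<close>
  also have "\<dots> = (\<integral>\<^sup>+s. (\<integral>\<^sup>+y. f y * ennreal (norm y ^ Suc n) *
          (ennreal (real (Suc n) / s ^ (n + 2)) * indicator {norm y<..} s) \<partial>lborel) \<partial>lborel)"
  proof (rule nn_integral_cong)
    fix s :: real
    show "(\<integral>\<^sup>+z. indicator (ball 0 1) z *
          (ennreal (Suc n * norm z ^ Suc n * s ^ n) * indicator {0<..} s * f (s *\<^sub>R z)) \<partial>lborel)
        = (\<integral>\<^sup>+y. f y * ennreal (norm y ^ Suc n) *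
          (ennreal (real (Suc n) / s ^ (n + 2)) * indicator {norm y<..} s) \<partial>lborel)"
    proof (cases "s > 0")
      case False
      then have "\<not> norm y < s" for y :: 'a
        by (metis norm_ge_zero order.strict_trans1)
      with False show ?thesis by simp
    next
      case True
      have "(\<integral>\<^sup>+y. f y * ennreal (norm y ^ Suc n) *
          (ennreal (real (Suc n) / s ^ (n + 2)) * indicator {norm y<..} s) \<partial>lborel)
        = (\<integral>\<^sup>+z. ennreal (s ^ DIM('a)) * (f (s *\<^sub>R z) * ennreal (norm (s *\<^sub>R z) ^ Suc n) *
          (ennreal (real (Suc n) / s ^ (n + 2)) * indicator {norm (s *\<^sub>R z)<..} s)) \<partial>lborel)"
        by (rule nn_integral_lborel_scale[OF _ True])
           (simp add: indicator_def of_bool_def[abs_def] del: of_bool_eq_iff, measurable)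
      also have "\<dots> = (\<integral>\<^sup>+z. indicator (ball 0 1) z *
          (ennreal (Suc n * norm z ^ Suc n * s ^ n) * indicator {0<..} s * f (s *\<^sub>R z)) \<partial>lborel)"
      proof (rule nn_integral_cong)
        fix z :: 'a
        have e1: "(norm (s *\<^sub>R z) < s) = (norm z < 1)" using True by simp
        have "s ^ DIM('a) * (norm (s *\<^sub>R z) ^ Suc n * (real (Suc n) / s ^ (n + 2)))
            = Suc n * norm z ^ Suc n * s ^ n"
          using True by (simp add: d power_mult_distrib field_simps)
        then have "ennreal (s ^ DIM('a)) * (ennreal (norm (s *\<^sub>R z) ^ Suc n) * ennreal (real (Suc n) / s ^ (n + 2)))
            = ennreal (Suc n * norm z ^ Suc n * s ^ n)"
          using True
          by (subst ennreal_mult[symmetric], simp, simp, subst ennreal_mult[symmetric]) simp_all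
        then show "ennreal (s ^ DIM('a)) * (f (s *\<^sub>R z) * ennreal (norm (s *\<^sub>R z) ^ Suc n) *
          (ennreal (real (Suc n) / s ^ (n + 2)) * indicator {norm (s *\<^sub>R z)<..} s))
          = indicator (ball 0 1) z *
          (ennreal (Suc n * norm z ^ Suc n * s ^ n) * indicator {0<..} s * f (s *\<^sub>R z))"
          using True e1 by (cases "norm z < 1") (simp_all add: ac_simps)
      qed
      finally show ?thesis by simp
    qed
  qed
  also have "\<dots> = (\<integral>\<^sup>+y. (\<integral>\<^sup>+s. f y * ennreal (norm y ^ Suc n) *
          (ennreal (real (Suc n) / s ^ (n + 2)) * indicator {norm y<..} s) \<partial>lborel) \<partial>lborel)"
    by (rule lborel_pair.Fubini') (simp add: indicator_def of_bool_def[abs_def] del: of_bool_eq_iff, measurable)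
  also have "\<dots> = (\<integral>\<^sup>+y. f y \<partial>lborel)"
  proof (rule nn_integral_cong_AE, rule AE_mp[OF AE_lborel_singleton[of 0]], intro AE_I2 impI)
    fix y :: 'a assume y: "y \<noteq> 0"
    have "(\<integral>\<^sup>+s. f y * ennreal (norm y ^ Suc n) *
          (ennreal (real (Suc n) / s ^ (n + 2)) * indicator {norm y<..} s) \<partial>lborel)
       = f y * ennreal (norm y ^ Suc n) * (\<integral>\<^sup>+s.
          (ennreal (real (Suc n) / s ^ (n + 2)) * indicator {norm y<..} s) \<partial>lborel)"
      by (rule nn_integral_cmult) simp
    also have "\<dots> = f y * (ennreal (norm y ^ Suc n) * ennreal (1 / norm y ^ Suc n))"
      by (subst nn_integral_tail_power) (use y in \<open>simp_all add: mult.assoc\<close>)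
    also have "\<dots> = f y" using y by (simp flip: ennreal_mult)
    finally show "(\<integral>\<^sup>+s. f y * ennreal (norm y ^ Suc n) *
          (ennreal (real (Suc n) / s ^ (n + 2)) * indicator {norm y<..} s) \<partial>lborel) = f y" .
  qed
  finally show ?thesis ..
qed

definition unif_ball :: "'a::euclidean_space measure" where
  "unif_ball = uniform_measure lborel (ball 0 1)"

text \<open>The mean over a sphere, in the form that \<open>sphere_measure\<close> prescribes: the direction \<open>sgn z\<close> of a point \<open>z\<close>
chosen uniformly in the unit ball is uniform on the unit sphere.\<close>

definition sph_mean :: "('a::euclidean_space \<Rightarrow> real) \<Rightarrow> 'a \<Rightarrow> real \<Rightarrow> real" where
  "sph_mean f x r = (\<integral>z. f (x + r *\<^sub>R sgn z) \<partial>unif_ball)"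

lemma sets_unif_ball [simp, measurable_cong]: "sets (unif_ball :: 'a::euclidean_space measure) = sets borel"
  by (simp add: unif_ball_def)

lemma space_unif_ball [simp]: "space (unif_ball :: 'a::euclidean_space measure) = UNIV"
  by (simp add: unif_ball_def)

lemma emeasure_unit_ball_nonzero: "emeasure lborel (ball (0::'a::euclidean_space) 1) \<noteq> 0"
  using unit_ball_vol_pos[of "DIM('a)"] by (simp add: emeasure_ball del: unit_ball_vol_pos)

lemma emeasure_unif_ball_UNIV: "emeasure (unif_ball :: 'a::euclidean_space measure) UNIV = 1"
  using emeasure_unit_ball_nonzero[where 'a='a]
  by (simp add: unif_ball_def emeasure_uniform_measure emeasure_ball ennreal_divide_self)

interpretation unif_ball: finite_measure "unif_ball :: 'a::euclidean_space measure"
  by standard (simp add: emeasure_unif_ball_UNIV)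

lemma measure_unif_ball_UNIV [simp]: "measure (unif_ball :: 'a::euclidean_space measure) UNIV = 1"
  by (simp add: measure_def emeasure_unif_ball_UNIV)

lemma AE_unif_ball_nonzero: "AE z in (unif_ball :: 'a::euclidean_space measure). z \<noteq> 0"
  unfolding unif_ball_def
  by (rule AE_uniform_measureI, simp, rule AE_mp[OF AE_lborel_singleton[of 0]]) auto

lemma nn_integral_unif_ball:
  fixes f :: "'a::euclidean_space \<Rightarrow> ennreal"
  assumes [measurable]: "f \<in> borel_measurable borel"
  shows "ennreal (unit_ball_vol DIM('a)) * (\<integral>\<^sup>+z. f z \<partial>unif_ball) = (\<integral>\<^sup>+z. indicator (ball 0 1) z * f z \<partial>lborel)"
proof -
  define V where "V = unit_ball_vol DIM('a)"
  have V: "V > 0" by (simp add: V_def)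
  have "(\<integral>\<^sup>+z. f z \<partial>unif_ball) = (\<integral>\<^sup>+z. indicator (ball 0 1) z * f z \<partial>lborel) / ennreal V"
    unfolding unif_ball_def
    by (subst nn_integral_uniform_measure) (simp_all add: emeasure_ball V_def mult.commute)
  then show ?thesis
    using V unfolding V_def[symmetric]
    by (metis ennreal_mult_divide_eq ennreal_neq_top ennreal_times_divide mult.commute
        ennreal_eq_0_iff linorder_not_le)
qed

definition polar_density :: "'a::euclidean_space itself \<Rightarrow> real \<Rightarrow> real" where
  "polar_density _ r = unit_ball_vol DIM('a) * DIM('a) * r ^ (DIM('a) - 1) * indicator {0<..} r"

lemma polar_density_nonneg: "0 \<le> polar_density TYPE('a::euclidean_space) r"
  by (auto simp: polar_density_def indicator_def intro!: mult_nonneg_nonneg)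

lemma borel_measurable_polar_density [measurable]:
  "polar_density TYPE('a::euclidean_space) \<in> borel_measurable borel"
  unfolding polar_density_def[abs_def] by measurable

lemma borel_measurable_sgn_euclidean [measurable]:
  "(sgn :: 'a::euclidean_space \<Rightarrow> 'a) \<in> borel_measurable borel"
  unfolding sgn_div_norm by measurable

text \<open>The measure form of polar coordinates; it makes integrability and Fubini's theorem for signed functions available
through the product measure.\<close>

lemma polar_measure:
  "(lborel :: 'a::euclidean_space measure) =
     distr (density (unif_ball \<Otimes>\<^sub>M lborel) (\<lambda>x. ennreal (polar_density TYPE('a) (snd x))))
       borel (\<lambda>x. snd x *\<^sub>R sgn (fst x))" (is "_ = ?N")
proof (rule measure_eqI)
  show "sets lborel = sets ?N" by simp
  fix A :: "'a set" assume "A \<in> sets lborel"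
  then have [measurable]: "A \<in> sets borel" by simp
  have "emeasure ?N A = (\<integral>\<^sup>+x. indicator A x \<partial>?N)" by simp
  also have "\<dots> = (\<integral>\<^sup>+z. (\<integral>\<^sup>+r. ennreal (polar_density TYPE('a) r) * indicator A (r *\<^sub>R sgn z) \<partial>lborel) \<partial>(unif_ball::'a measure))"
    by (subst nn_integral_distr, measurable)
       (simp add: nn_integral_density lborel.nn_integral_fst[symmetric])
  also have "\<dots> = (\<integral>\<^sup>+z. ennreal (unit_ball_vol DIM('a)) * (\<integral>\<^sup>+r. ennreal (DIM('a) * r ^ (DIM('a) - 1)) * indicator {0<..} r
        * indicator A (r *\<^sub>R sgn z) \<partial>lborel) \<partial>unif_ball)"
    by (intro nn_integral_cong, subst nn_integral_cmult[symmetric], simp,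
        intro nn_integral_cong)
       (auto split: split_indicator simp flip: ennreal_mult simp: mult.assoc polar_density_def)
  also have "\<dots> = (\<integral>\<^sup>+x. indicator A x \<partial>lborel)"
    by (subst nn_integral_cmult, measurable)
       (subst nn_integral_unif_ball, measurable, subst polar_ball, simp_all)
  finally show "emeasure lborel A = emeasure ?N A" by simp
qed

lemma polar_integrable:
  fixes f :: "'a::euclidean_space \<Rightarrow> real"
  assumes [measurable]: "f \<in> borel_measurable borel"
  shows "integrable lborel f \<longleftrightarrow> integrable (unif_ball \<Otimes>\<^sub>M lborel)
     (\<lambda>x. polar_density TYPE('a) (snd x) * f (snd x *\<^sub>R sgn (fst x)))"
  by (subst polar_measure, subst integrable_distr_eq, measurable)
     (subst integrable_density, auto simp: polar_density_nonneg)

lemma polar_integral: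
  fixes f :: "'a::euclidean_space \<Rightarrow> real"
  assumes f: "integrable lborel f"
  shows "(\<integral>x. f x \<partial>lborel) = 
   (\<integral>z. (\<integral>r. polar_density TYPE('a) r * f (r *\<^sub>R sgn z) \<partial>lborel) \<partial>(unif_ball::'a measure))"
proof -
  have [measurable]: "f \<in> borel_measurable borel" using f by simp
  interpret pair_sigma_finite "unif_ball :: 'a measure" "lborel :: real measure" ..
  have "(\<integral>x. f x \<partial>lborel) = (\<integral>x. polar_density TYPE('a) (snd x) * f (snd x *\<^sub>R sgn (fst x)) \<partial>(unif_ball \<Otimes>\<^sub>M lborel))"
    by (subst polar_measure, subst integral_distr, measurable)
       (subst integral_density, auto simp: polar_density_nonneg)
  also have "\<dots> = (\<integral>z. (\<integral>r. polar_density TYPE('a) r * f (r *\<^sub>R sgn z) \<partial>lborel) \<partial>(unif_ball::'a measure))"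
    using f by (subst integral_fst'[symmetric]) (simp_all add: polar_integrable)
  finally show ?thesis .
qed

lemma integrable_indicator_cball:
  "integrable lborel (indicator (cball (a::'a::euclidean_space) R) :: 'a \<Rightarrow> real)"
  using emeasure_lborel_cball_finite[of a R] by (intro integrable_real_indicator) simp_all

text \<open>Lebesgue measure is translation invariant, so every difference quotient of \<open>G\<close> has integral zero; the Lipschitz bound
dominates the quotients, and the limit is \<open>G'\<close>. The derivative is taken almost everywhere, because the truncated
kernel below has a kink on a sphere.\<close>

lemma integral_directional_derivative_zero:
  fixes G G' :: "'a::euclidean_space \<Rightarrow> real" and b :: 'a
  assumes [measurable]: "G \<in> borel_measurable borel" "G' \<in> borel_measurable borel"
    and supp: "\<And>x. R \<le> norm x \<Longrightarrow> G x = 0" and bd: "\<And>x. \<bar>G x\<bar> \<le> B"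
    and lip: "\<And>x t. \<bar>t\<bar> \<le> 1 \<Longrightarrow> \<bar>G (x + t *\<^sub>R b) - G x\<bar> \<le> M * \<bar>t\<bar>"
    and der: "AE x in lborel. ((\<lambda>t. G (x + t *\<^sub>R b)) has_real_derivative G' x) (at 0)"
  shows "integrable lborel G'" "(\<integral>x. G' x \<partial>lborel) = 0"
proof -
  define s where "s n = 1 / (real n + 1)" for n :: nat
  have s: "0 < s n" "s n \<le> 1" for n by (auto simp: s_def)
  have s0: "s \<longlonglongrightarrow> 0" unfolding s_def by real_asymp
  define F where "F n x = (G (x + s n *\<^sub>R b) - G x) / s n" for n x
  have [measurable]: "F n \<in> borel_measurable borel" for n unfolding F_def by measurable
  define w where "w x = M * indicator (cball (0::'a) (R + norm b)) x" for x
  have M: "0 \<le> M" using lip[of 1 0] by simp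
  have w: "integrable lborel w"
    unfolding w_def by (intro integrable_mult_right integrable_indicator_cball)
  have Fw: "norm (F n x) \<le> w x" for n x
  proof (cases "norm x \<le> R + norm b")
    case True
    have "\<bar>G (x + s n *\<^sub>R b) - G x\<bar> \<le> M * s n" using lip[of "s n" x] s[of n] by simp
    then show ?thesis using True s[of n] by (simp add: F_def w_def field_simps)
  next
    case False
    have "norm x \<le> norm (x + s n *\<^sub>R b) + norm (s n *\<^sub>R b)"
      by (metis add_diff_cancel norm_triangle_ineq4)
    moreover have "norm (s n *\<^sub>R b) \<le> norm b" using s[of n] by (simp add: mult_left_le_one_le)
    ultimately have "R \<le> norm (x + s n *\<^sub>R b)" using False by simp
    moreover have "R \<le> norm x" using False norm_ge_zero[of b] by linarith
    ultimately show ?thesis using M by (simp add: F_def w_def supp)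
  qed
  have lim: "AE x in lborel. (\<lambda>n. F n x) \<longlonglongrightarrow> G' x"
    using der
  proof eventually_elim
    case (elim x)
    then have "((\<lambda>t. (G (x + t *\<^sub>R b) - G x) / t) \<longlongrightarrow> G' x) (at 0)"
      by (simp add: DERIV_def)
    moreover have "filterlim s (at 0) sequentially"
      using s0 s(1) by (auto simp: filterlim_at intro!: always_eventually) (metis less_irrefl)
    ultimately show ?case unfolding F_def by (rule filterlim_compose)
  qed
  show "integrable lborel G'"
    by (rule integrable_dominated_convergence[OF _ _ w lim]) (use Fw in auto)
  have GB: "norm (G x) \<le> norm (B * indicator (cball (0::'a) R) x)" for x
    using bd[of x] supp[of x] by (cases "norm x \<le> R") auto
  have iG: "integrable lborel G"
    by (rule Bochner_Integration.integrable_bound[of _ "\<lambda>x. B * indicator (cball (0::'a) R) x"])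
       (use GB in \<open>auto intro!: integrable_mult_right integrable_indicator_cball\<close>)
  have "(\<integral>x. F n x \<partial>lborel) = 0" for n
  proof -
    have "(\<integral>x. G (s n *\<^sub>R b + x) \<partial>lborel) = (\<integral>x. G x \<partial>lborel)"
      by (rule integral_lborel_plus) simp
    then show ?thesis
      unfolding F_def using iG integrable_lborel_plus[OF iG, of "s n *\<^sub>R b"]
      by (simp add: add.commute)
  qed
  moreover have "(\<lambda>n. \<integral>x. F n x \<partial>lborel) \<longlonglongrightarrow> (\<integral>x. G' x \<partial>lborel)"
    by (rule integral_dominated_convergence[OF _ _ w lim]) (use Fw in auto)
  ultimately show "(\<integral>x. G' x \<partial>lborel) = 0"
    by (simp add: LIMSEQ_const_iff)
qed

section \<open>Green's first identity for the truncated kernel\<close>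

text \<open>The gradient and the Hessian are explicit parameters. Continuity of the Hessian is stated for each direction, which in finite dimension
is continuity in operator norm.\<close>

definition C2_on :: "'a::euclidean_space set \<Rightarrow> ('a \<Rightarrow> real) \<Rightarrow> ('a \<Rightarrow> 'a) \<Rightarrow> ('a \<Rightarrow> 'a \<Rightarrow> 'a) \<Rightarrow> bool" where
  "C2_on U f g h \<longleftrightarrow>
     (\<forall>x\<in>U. (f has_derivative (\<lambda>v. g x \<bullet> v)) (at x)) \<and>
     (\<forall>x\<in>U. (g has_derivative h x) (at x)) \<and>
     (\<forall>v. continuous_on U (\<lambda>x. h x v))"

definition laplace :: "('a::euclidean_space \<Rightarrow> 'a \<Rightarrow> 'a) \<Rightarrow> 'a \<Rightarrow> real" where
  "laplace h x = (\<Sum>b\<in>Basis. h x b \<bullet> b)"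

text \<open>The constant for which \<open>k'(t) = kernel_slope / t\<^bsup>d-1\<^esup>\<close> in every dimension, see \<open>radial_kernel_deriv\<close>.\<close>

definition kernel_slope :: "'a::euclidean_space itself \<Rightarrow> real" where
  "kernel_slope _ = (if DIM('a) = 2 then 1 else \<bar>real DIM('a) - 2\<bar>)"

lemma kernel_slope_pos: "0 < kernel_slope TYPE('a::euclidean_space)"
  by (auto simp: kernel_slope_def)

definition radial_kernel :: "'a::euclidean_space itself \<Rightarrow> real \<Rightarrow> real" where
  "radial_kernel _ = kfun (real DIM('a) - 2)"

lemma radial_kernel_deriv:
  assumes "0 < t"
  shows "(radial_kernel TYPE('a::euclidean_space) has_real_derivative kernel_slope TYPE('a) / t ^ (DIM('a) - 1)) (at t)"
proof (cases "DIM('a) = 2")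
  case True
  then show ?thesis using assms
    by (auto simp: radial_kernel_def kfun_def[abs_def] kernel_slope_def intro!: derivative_eq_intros)
next
  case False
  define s where "s = real DIM('a) - 2"
  have s: "s \<noteq> 0" using False unfolding s_def by linarith
  have "radial_kernel TYPE('a) = (\<lambda>t. - sgn s * t powr (- s))"
    using s by (auto simp: radial_kernel_def kfun_def[abs_def] s_def)
  moreover have "((\<lambda>t. - sgn s * t powr (- s)) has_real_derivative \<bar>s\<bar> * t powr (- s - 1)) (at t)"
    using assms by (auto intro!: derivative_eq_intros simp: sgn_if)
  moreover have "t powr (- s - 1) = 1 / t ^ (DIM('a) - 1)"
  proof -
    have "- s - 1 = - real (DIM('a) - 1)" using DIM_positive[where 'a='a] by (simp add: s_def of_nat_diff)
    then show ?thesis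
      using assms by (simp only: powr_minus powr_realpow divide_inverse mult_1_left)
  qed
  ultimately show ?thesis using False by (simp add: kernel_slope_def s_def)
qed

lemma radial_kernel_mono: "0 < s \<Longrightarrow> s \<le> t \<Longrightarrow> radial_kernel TYPE('a::euclidean_space) s \<le> radial_kernel TYPE('a) t"
  by (rule DERIV_nonneg_imp_nondecreasing)
     (auto intro!: exI radial_kernel_deriv divide_nonneg_nonneg less_imp_le[OF kernel_slope_pos])

lemma radial_kernel_strict_mono: "0 < s \<Longrightarrow> s < t \<Longrightarrow> radial_kernel TYPE('a::euclidean_space) s < radial_kernel TYPE('a) t"
  by (rule DERIV_pos_imp_increasing)
     (auto intro!: exI radial_kernel_deriv divide_pos_pos kernel_slope_pos)

lemma radial_kernel_lipschitz:
  assumes "0 < e" "e \<le> s" "e \<le> t"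
  shows "\<bar>radial_kernel TYPE('a::euclidean_space) s - radial_kernel TYPE('a) t\<bar> \<le> kernel_slope TYPE('a) / e ^ (DIM('a) - 1) * \<bar>s - t\<bar>"
proof -
  have "norm (radial_kernel TYPE('a) s - radial_kernel TYPE('a) t) \<le> kernel_slope TYPE('a) / e ^ (DIM('a) - 1) * norm (s - t)"
  proof (rule field_differentiable_bound)
    show "convex {e..}" by simp
    show "(radial_kernel TYPE('a) has_field_derivative kernel_slope TYPE('a) / z ^ (DIM('a) - 1)) (at z within {e..})"
      if "z \<in> {e..}" for z
      using radial_kernel_deriv[of z] that assms by (auto intro: DERIV_subset)
    show "norm (kernel_slope TYPE('a) / z ^ (DIM('a) - 1)) \<le> kernel_slope TYPE('a) / e ^ (DIM('a) - 1)"
      if "z \<in> {e..}" for z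
      using kernel_slope_pos[where 'a='a] that assms
      by (auto simp: abs_div_pos intro!: divide_left_mono power_mono mult_pos_pos)
  qed (use assms in auto)
  then show ?thesis by simp
qed

lemma borel_measurable_radial_kernel [measurable]: "radial_kernel TYPE('a::euclidean_space) \<in> borel_measurable borel"
  unfolding radial_kernel_def kfun_def[abs_def] by measurable

lemma C2_on_continuous:
  assumes "C2_on U f g h"
  shows "continuous_on U f" "continuous_on U g" "continuous_on U (\<lambda>x. h x v)" "continuous_on U (laplace h)"
proof -
  show "continuous_on U f" "continuous_on U g"
    using assms unfolding C2_on_def
    by (auto intro!: continuous_at_imp_continuous_on has_derivative_continuous)
  show *: "continuous_on U (\<lambda>x. h x v)" for v
    using assms unfolding C2_on_def by blast
  show "continuous_on U (laplace h)"
    unfolding laplace_def[abs_def] by (intro continuous_on_sum continuous_on_inner * continuous_on_const)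
qed

lemma C2_on_subset: "C2_on U f g h \<Longrightarrow> V \<subseteq> U \<Longrightarrow> C2_on V f g h"
  unfolding C2_on_def by (blast intro: continuous_on_subset)

text \<open>A vanishing function has vanishing derivatives on the open complement of its support.\<close>

lemma C2_on_zero_outside:
  assumes C: "C2_on UNIV f g h" and supp: "\<And>x. x \<notin> K \<Longrightarrow> f x = 0" and K: "closed K" and x: "x \<notin> K"
  shows "g x = 0" "h x = (\<lambda>v. 0)"
proof -
  have op: "open (- K)" using K by auto
  have g0: "g y = 0" if "y \<notin> K" for y
  proof -
    have "((\<lambda>x. 0) has_derivative (\<lambda>v. g y \<bullet> v)) (at y)"
      by (rule has_derivative_transform_within_open[of f _ _ _ "- K"])
         (use C that op supp in \<open>auto simp: C2_on_def\<close>)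
    then have "(\<lambda>v. g y \<bullet> v) = (\<lambda>v. 0)"
      by (rule has_derivative_unique) simp
    then have "g y \<bullet> g y = 0" by metis
    then show ?thesis by simp
  qed
  then show "g x = 0" using x by blast
  have "((\<lambda>x. 0) has_derivative h x) (at x)"
    by (rule has_derivative_transform_within_open[of g _ _ _ "- K"])
       (use C x op g0 in \<open>auto simp: C2_on_def\<close>)
  then show "h x = (\<lambda>v. 0)"
    by (rule has_derivative_unique) simp
qed

lemma continuous_compact_support_bounded:
  fixes f :: "'a::euclidean_space \<Rightarrow> 'b::real_normed_vector"
  assumes "continuous_on UNIV f" and supp: "\<And>x. R < norm x \<Longrightarrow> f x = 0"
  obtains B where "B > 0" "\<And>x. norm (f x) \<le> B"
proof -
  have "compact (f ` cball 0 R)"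
    by (rule compact_continuous_image) (use assms(1) continuous_on_subset in auto)
  then obtain B where B: "B > 0" "\<And>x. x \<in> cball 0 R \<Longrightarrow> norm (f x) \<le> B"
    by (auto simp: bounded_pos dest!: compact_imp_bounded)
  then have "norm (f x) \<le> B" for x
    by (cases "norm x \<le> R") (auto simp: supp)
  with B(1) show ?thesis by (rule that)
qed

lemma integrable_continuous_compact_support:
  fixes f :: "'a::euclidean_space \<Rightarrow> real"
  assumes c: "continuous_on UNIV f" and supp: "\<And>x. R < norm x \<Longrightarrow> f x = 0"
  shows "integrable lborel f"
proof -
  have [measurable]: "f \<in> borel_measurable borel" using c by (rule borel_measurable_continuous_onI)
  obtain B where "B > 0" and B: "\<And>x. norm (f x) \<le> B" 
    using continuous_compact_support_bounded[OF c supp] by blast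
  show ?thesis
    by (rule Bochner_Integration.integrable_bound[of _ "\<lambda>x. B * indicator (cball (0::'a) R) x"])
       (use supp B in \<open>auto split: split_indicator intro!: AE_I2 order_trans[OF _ abs_ge_self]
          integrable_mult_right integrable_indicator_cball\<close>)
qed

lemma AE_not_sphere: "AE x in lborel. norm (x - (y::'a::euclidean_space)) \<noteq> r"
proof -
  have "sphere y r \<in> null_sets lborel"
    using negligible_sphere[of y r] by (auto simp: null_sets_completion_iff negligible_iff_null_sets)
  then have "AE x in lborel. x \<notin> sphere y r" by (rule AE_not_in)
  then show ?thesis by eventually_elim (auto simp: dist_norm norm_minus_commute)
qed

lemma has_derivative_imp_DERIV_line:
  assumes "(f has_derivative f') (at (x + t *\<^sub>R b))"
  shows "((\<lambda>t. f (x + t *\<^sub>R b)) has_derivative (\<lambda>s. f' (s *\<^sub>R b))) (at t)"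
proof -
  have "((\<lambda>t. x + t *\<^sub>R b) has_derivative (\<lambda>s. s *\<^sub>R b)) (at t)"
    by (auto intro!: derivative_eq_intros)
  from has_derivative_compose[OF this assms] show ?thesis by simp
qed

lemma C2_on_line:
  assumes C: "C2_on U f g h" and x: "x + t *\<^sub>R b \<in> U"
  shows "((\<lambda>t. f (x + t *\<^sub>R b)) has_real_derivative g (x + t *\<^sub>R b) \<bullet> b) (at t)"
    and "((\<lambda>t. g (x + t *\<^sub>R b) \<bullet> c) has_real_derivative h (x + t *\<^sub>R b) b \<bullet> c) (at t)"
proof -
  have f: "(f has_derivative (\<lambda>v. g (x + t *\<^sub>R b) \<bullet> v)) (at (x + t *\<^sub>R b))"
    and g: "(g has_derivative h (x + t *\<^sub>R b)) (at (x + t *\<^sub>R b))"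
    using C x by (auto simp: C2_on_def)
  show "((\<lambda>t. f (x + t *\<^sub>R b)) has_real_derivative g (x + t *\<^sub>R b) \<bullet> b) (at t)"
    using has_derivative_imp_DERIV_line[OF f] by (simp add: has_field_derivative_def mult.commute[of _ "_ \<bullet> _"] mult_commute_abs)
  have lin: "linear (h (x + t *\<^sub>R b))" using g has_derivative_linear by blast
  have "((\<lambda>t. g (x + t *\<^sub>R b) \<bullet> c) has_derivative (\<lambda>s. h (x + t *\<^sub>R b) (s *\<^sub>R b) \<bullet> c)) (at t)"
    by (rule has_derivative_inner_left, rule has_derivative_imp_DERIV_line[OF g])
  then show "((\<lambda>t. g (x + t *\<^sub>R b) \<bullet> c) has_real_derivative h (x + t *\<^sub>R b) b \<bullet> c) (at t)"
    by (simp add: has_field_derivative_def linear_cmul[OF lin] mult_commute_abs)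
qed

text \<open>Inside the ball the truncated kernel is constant; outside, the chain rule applies. On the sphere itself there is a kink.\<close>

lemma truncated_kernel_deriv:
  fixes x y b :: "'a::euclidean_space"
  assumes e: "0 < e" and ne: "norm (x - y) \<noteq> e"
  shows "((\<lambda>t. radial_kernel TYPE('a) (max (norm (x + t *\<^sub>R b - y)) e)) has_real_derivative
     (kernel_slope TYPE('a) / norm (x - y) ^ DIM('a) * indicator {e<..} (norm (x - y))) * ((x - y) \<bullet> b)) (at 0)"
proof (cases "norm (x - y) < e")
  case True
  have cont: "isCont (\<lambda>t. norm (x + t *\<^sub>R b - y)) 0" by (intro continuous_intros)
  have "eventually (\<lambda>t. norm (x + t *\<^sub>R b - y) < e) (at 0)"
    using order_tendstoD(2)[OF cont[unfolded isCont_def], of e] True by simp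
  then have "eventually (\<lambda>t. norm (x + t *\<^sub>R b - y) < e) (nhds 0)"
    using True by (simp add: eventually_nhds_conv_at)
  then have "eventually (\<lambda>t. radial_kernel TYPE('a) e = radial_kernel TYPE('a) (max (norm (x + t *\<^sub>R b - y)) e)) (nhds 0)"
    by eventually_elim simp
  then have "((\<lambda>t. radial_kernel TYPE('a) (max (norm (x + t *\<^sub>R b - y)) e)) has_real_derivative 0) (at 0)"
    using DERIV_cong_ev[of 0 0 "\<lambda>_. radial_kernel TYPE('a) e" _ 0 0] by simp
  then show ?thesis using True by simp
next
  case False
  then have gt: "norm (x - y) > e" using ne by simp
  then have xy: "x - y \<noteq> 0" using e by auto
  have cont: "isCont (\<lambda>t. norm (x + t *\<^sub>R b - y)) 0" by (intro continuous_intros)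
  have "eventually (\<lambda>t. norm (x + t *\<^sub>R b - y) > e) (at 0)"
    using order_tendstoD(1)[OF cont[unfolded isCont_def], of e] gt by simp
  then have "eventually (\<lambda>t. norm (x + t *\<^sub>R b - y) > e) (nhds 0)"
    using gt by (simp add: eventually_nhds_conv_at)
  then have ev: "eventually (\<lambda>t. radial_kernel TYPE('a) (norm (x + t *\<^sub>R b - y)) = radial_kernel TYPE('a) (max (norm (x + t *\<^sub>R b - y)) e)) (nhds 0)"
    by eventually_elim (simp add: max_def)
  have "((\<lambda>t. norm (x + t *\<^sub>R b - y)) has_derivative (\<lambda>s. sgn (x + 0 *\<^sub>R b - y) \<bullet> (s *\<^sub>R b))) (at 0)"
    by (rule has_derivative_compose[of "\<lambda>t. x + t *\<^sub>R b - y" _ _ _ norm, THEN has_derivative_eq_rhs])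
       (use xy in \<open>auto intro!: derivative_eq_intros has_derivative_norm simp: inner_commute\<close>)
  then have "((\<lambda>t. norm (x + t *\<^sub>R b - y)) has_real_derivative sgn (x - y) \<bullet> b) (at 0)"
    by (simp add: has_field_derivative_def mult_commute_abs)
  then have "((\<lambda>t. radial_kernel TYPE('a) (norm (x + t *\<^sub>R b - y))) has_real_derivative
      (kernel_slope TYPE('a) / norm (x - y) ^ (DIM('a) - 1)) * (sgn (x - y) \<bullet> b)) (at 0)"
    by (intro DERIV_chain2[of "radial_kernel TYPE('a)"]) (use radial_kernel_deriv[of "norm (x - y)"] xy in simp_all)
  moreover have "(kernel_slope TYPE('a) / norm (x - y) ^ (DIM('a) - 1)) * (sgn (x - y) \<bullet> b)
     = kernel_slope TYPE('a) / norm (x - y) ^ DIM('a) * ((x - y) \<bullet> b)"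
  proof -
    have "sgn (x - y) \<bullet> b = ((x - y) \<bullet> b) / norm (x - y)"
      by (simp only: sgn_div_norm inner_scaleR_left divide_inverse mult.commute)
    then show ?thesis
      using xy DIM_positive[where 'a='a] by (cases "DIM('a)") auto
  qed
  ultimately show ?thesis
    using gt ev DERIV_cong_ev[of 0 0 "\<lambda>t. radial_kernel TYPE('a) (norm (x + t *\<^sub>R b - y))"] by simp
qed

text \<open>The field \<open>\<Phi> g\<close> is Lipschitz with compact support, so the integrals of its \<open>d\<close> directional derivatives vanish;
their sum is \<open>\<Phi> L + grad \<Phi> \<bullet> g\<close>.\<close>

lemma greens_first_identity:
  fixes f :: "'a::euclidean_space \<Rightarrow> real" and y :: 'a
  assumes C: "C2_on UNIV f g h" and supp: "\<And>x. R < norm x \<Longrightarrow> f x = 0" and e: "0 < e"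
  defines "\<Phi> \<equiv> \<lambda>x. radial_kernel TYPE('a) (max (norm (x - y)) e)"
    and "\<Psi> \<equiv> \<lambda>x. kernel_slope TYPE('a) / norm (x - y) ^ DIM('a) * indicator {e<..} (norm (x - y))"
  shows "integrable lborel (\<lambda>x. \<Phi> x * laplace h x)"
    and "integrable lborel (\<lambda>x. \<Psi> x * ((x - y) \<bullet> g x))"
    and "(\<integral>x. \<Phi> x * laplace h x \<partial>lborel) = - (\<integral>x. \<Psi> x * ((x - y) \<bullet> g x) \<partial>lborel)"
proof -
  have g0: "g x = 0" and h0: "h x = (\<lambda>v. 0)" if "R < norm x" for x
    using C2_on_zero_outside[OF C, of "cball 0 R" x] supp that by auto
  note cont = C2_on_continuous[OF C]
  have [measurable]: "f \<in> borel_measurable borel" "g \<in> borel_measurable borel"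
    "laplace h \<in> borel_measurable borel" "(\<lambda>x. h x v) \<in> borel_measurable borel" for v
    using cont by (auto intro: borel_measurable_continuous_onI)
  have lapl0: "laplace h x = 0" if "R < norm x" for x by (simp add: laplace_def h0 that)
  obtain Bg where Bg: "Bg > 0" "\<And>x. norm (g x) \<le> Bg"
    using continuous_compact_support_bounded[OF cont(2) g0] by blast
  have \<Phi>c: "continuous_on UNIV \<Phi>"
  proof -
    have "isCont (radial_kernel TYPE('a)) t" if "t \<ge> e" for t
      using radial_kernel_deriv[of t] that e DERIV_isCont by fastforce
    then have "continuous_on {e..} (radial_kernel TYPE('a))"
      by (auto intro!: continuous_at_imp_continuous_on)
    then show ?thesis unfolding \<Phi>_def
      by (rule continuous_on_compose2) (auto intro!: continuous_intros)
  qed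
  have [measurable]: "\<Phi> \<in> borel_measurable borel" using \<Phi>c by (rule borel_measurable_continuous_onI)
  have [measurable]: "\<Psi> \<in> borel_measurable borel" unfolding \<Psi>_def by measurable
  show i1: "integrable lborel (\<lambda>x. \<Phi> x * laplace h x)"
    by (rule integrable_continuous_compact_support[of _ R])
       (use cont \<Phi>c lapl0 in \<open>auto intro!: continuous_intros\<close>)
  have main: "integrable lborel (\<lambda>x. \<Psi> x * ((x - y) \<bullet> b) * (g x \<bullet> b) + \<Phi> x * (h x b \<bullet> b)) \<and>
      (\<integral>x. \<Psi> x * ((x - y) \<bullet> b) * (g x \<bullet> b) + \<Phi> x * (h x b \<bullet> b) \<partial>lborel) = 0"
    if b: "b \<in> Basis" for b
  proof -
    have nb: "norm b = 1" using b by simp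
    obtain Bh where Bh: "Bh > 0" "\<And>x. norm (h x b) \<le> Bh"
      using continuous_compact_support_bounded[OF cont(3), of R b] h0 by auto
    have "compact (\<Phi> ` cball 0 (R + 1))"
      by (rule compact_continuous_image) (use \<Phi>c continuous_on_subset in auto)
    then obtain B\<Phi> where B\<Phi>: "B\<Phi> > 0" "\<And>x. norm x \<le> R + 1 \<Longrightarrow> \<bar>\<Phi> x\<bar> \<le> B\<Phi>"
      by (fastforce simp: bounded_pos dest!: compact_imp_bounded)
    define L where "L = kernel_slope TYPE('a) / e ^ (DIM('a) - 1)"
    have L: "L \<ge> 0" using kernel_slope_pos[where 'a='a] e by (simp add: L_def)
    have Lip\<Phi>: "\<bar>\<Phi> (x + t *\<^sub>R b) - \<Phi> x\<bar> \<le> L * \<bar>t\<bar>" for x t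
    proof -
      have "\<bar>\<Phi> (x + t *\<^sub>R b) - \<Phi> x\<bar> \<le> L * \<bar>max (norm (x + t *\<^sub>R b - y)) e - max (norm (x - y)) e\<bar>"
        unfolding \<Phi>_def L_def by (rule radial_kernel_lipschitz) (use e in auto)
      also have "\<bar>max (norm (x + t *\<^sub>R b - y)) e - max (norm (x - y)) e\<bar> \<le> \<bar>norm (x + t *\<^sub>R b - y) - norm (x - y)\<bar>"
        by linarith
      also have "\<dots> \<le> norm ((x + t *\<^sub>R b - y) - (x - y))" by (rule norm_triangle_ineq3)
      also have "\<dots> = \<bar>t\<bar>" using nb by simp
      finally show ?thesis using L by (simp add: mult_left_mono)
    qed
    have Lipg: "\<bar>g (x + t *\<^sub>R b) \<bullet> b - g x \<bullet> b\<bar> \<le> Bh * \<bar>t\<bar>" for x t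
    proof -
      have "norm ((\<lambda>t. g (x + t *\<^sub>R b) \<bullet> b) t - (\<lambda>t. g (x + t *\<^sub>R b) \<bullet> b) 0) \<le> Bh * norm (t - 0)"
      proof (rule field_differentiable_bound[of UNIV])
        show "((\<lambda>t. g (x + t *\<^sub>R b) \<bullet> b) has_field_derivative h (x + z *\<^sub>R b) b \<bullet> b) (at z within UNIV)" for z
          using C2_on_line(2)[OF C] by simp
        show "norm (h (x + z *\<^sub>R b) b \<bullet> b) \<le> Bh" for z
          using Cauchy_Schwarz_ineq2[of "h (x + z *\<^sub>R b) b" b] Bh(2)[of "x + z *\<^sub>R b"] nb by simp
      qed auto
      then show ?thesis by simp
    qed
    define G where "G x = \<Phi> x * (g x \<bullet> b)" for x
    define G' where "G' x = \<Psi> x * ((x - y) \<bullet> b) * (g x \<bullet> b) + \<Phi> x * (h x b \<bullet> b)" for x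
    have gb: "\<bar>g x \<bullet> b\<bar> \<le> Bg" for x
      using Cauchy_Schwarz_ineq2[of "g x" b] Bg(2)[of x] nb by simp
    have *: "integrable lborel G'" "(\<integral>x. G' x \<partial>lborel) = 0"
    proof (rule_tac [!] integral_directional_derivative_zero[where G=G and b=b and R="R+1" and M="L * Bg + B\<Phi> * Bh" and B="B\<Phi> * Bg"])
      show "G \<in> borel_measurable borel" "G \<in> borel_measurable borel"
        unfolding G_def by measurable
      show "G' \<in> borel_measurable borel" "G' \<in> borel_measurable borel"
        unfolding G'_def by measurable
      show "G x = 0" "G x = 0" if "R + 1 \<le> norm x" for x using that by (simp_all add: G_def g0)
      show bd: "\<bar>G x\<bar> \<le> B\<Phi> * Bg" "\<bar>G x\<bar> \<le> B\<Phi> * Bg" for x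
        using B\<Phi>(1) Bg(1) gb[of x] B\<Phi>(2)[of x] g0[of x]
        by (cases "R < norm x"; auto simp: G_def abs_mult intro!: mult_mono)+
      show "\<bar>G (x + t *\<^sub>R b) - G x\<bar> \<le> (L * Bg + B\<Phi> * Bh) * \<bar>t\<bar>" if "\<bar>t\<bar> \<le> 1" for x t
      proof (cases "norm x \<le> R + 1")
        case False
        have "norm x \<le> norm (x + t *\<^sub>R b) + norm (t *\<^sub>R b)"
          by (metis add_diff_cancel norm_triangle_ineq4)
        then have "R < norm (x + t *\<^sub>R b)" using that False nb by simp
        then show ?thesis using False L Bg(1) B\<Phi>(1) Bh(1) by (simp add: G_def g0)
      next
        case True
        have "G (x + t *\<^sub>R b) - G x = (\<Phi> (x + t *\<^sub>R b) - \<Phi> x) * (g (x + t *\<^sub>R b) \<bullet> b) + \<Phi> x * (g (x + t *\<^sub>R b) \<bullet> b - g x \<bullet> b)"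
          by (simp add: G_def algebra_simps)
        also have "\<bar>\<dots>\<bar> \<le> (L * \<bar>t\<bar>) * Bg + B\<Phi> * (Bh * \<bar>t\<bar>)"
          using B\<Phi> L Lip\<Phi>[of x t] gb Lipg[of x t] True
          by (intro order_trans[OF abs_triangle_ineq] add_mono) (auto simp: abs_mult intro!: mult_mono)
        finally show ?thesis by (simp add: algebra_simps)
      qed
      then show "\<bar>G (x + t *\<^sub>R b) - G x\<bar> \<le> (L * Bg + B\<Phi> * Bh) * \<bar>t\<bar>" if "\<bar>t\<bar> \<le> 1" for x t using that .
      show "AE x in lborel. ((\<lambda>t. G (x + t *\<^sub>R b)) has_real_derivative G' x) (at 0)"
        using AE_not_sphere[of y e]
      proof eventually_elim
        case (elim x)
        have "((\<lambda>t. g (x + t *\<^sub>R b) \<bullet> b) has_real_derivative h x b \<bullet> b) (at 0)"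
          using C2_on_line(2)[OF C, of x 0 b b] by simp
        from DERIV_mult[OF truncated_kernel_deriv[OF e elim, of b] this]
        show ?case unfolding G_def G'_def \<Phi>_def \<Psi>_def by (simp add: mult.commute add.commute)
      qed
      then show "AE x in lborel. ((\<lambda>t. G (x + t *\<^sub>R b)) has_real_derivative G' x) (at 0)" .
    qed
    then show ?thesis unfolding G'_def by blast
  qed
  \<comment> \<open>Summing over the basis assembles the inner product and the Laplacian.\<close>
  have sum_eq: "(\<Sum>b\<in>Basis. \<Psi> x * ((x - y) \<bullet> b) * (g x \<bullet> b) + \<Phi> x * (h x b \<bullet> b))
     = \<Psi> x * ((x - y) \<bullet> g x) + \<Phi> x * laplace h x" for x
    by (subst euclidean_inner[of "x - y" "g x"])
       (simp add: sum.distrib sum_distrib_left laplace_def mult.assoc)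
  have s1: "integrable lborel (\<lambda>x. \<Psi> x * ((x - y) \<bullet> g x) + \<Phi> x * laplace h x)"
    using main unfolding sum_eq[symmetric] by (intro Bochner_Integration.integrable_sum) auto
  have s2: "(\<integral>x. \<Psi> x * ((x - y) \<bullet> g x) + \<Phi> x * laplace h x \<partial>lborel) = 0"
    using main unfolding sum_eq[symmetric] by (subst Bochner_Integration.integral_sum) auto
  show i2: "integrable lborel (\<lambda>x. \<Psi> x * ((x - y) \<bullet> g x))"
    using Bochner_Integration.integrable_diff[OF s1 i1] by simp
  show "(\<integral>x. \<Phi> x * laplace h x \<partial>lborel) = - (\<integral>x. \<Psi> x * ((x - y) \<bullet> g x) \<partial>lborel)"
    using s2 i1 i2 by simp
qed

section \<open>Newton's formula and convolution with smooth kernels\<close>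

text \<open>The surface area of the unit sphere times \<open>kernel_slope\<close>.\<close>

definition newton_const :: "'a::euclidean_space itself \<Rightarrow> real" where
  "newton_const _ = unit_ball_vol DIM('a) * DIM('a) * kernel_slope TYPE('a)"

lemma newton_const_pos: "0 < newton_const TYPE('a::euclidean_space)"
  using kernel_slope_pos[where 'a='a] unit_ball_vol_pos[of "DIM('a)"] by (simp add: newton_const_def)

text \<open>The factor \<open>r\<^bsup>d-1\<^esup>\<close> of the polar density cancels the decay of the kernel's gradient, which leaves
\<open>\<integral>\<^bsub>r > e\<^esub> (d/dr) f(y + r w) dr\<close>; the upper limit contributes nothing.\<close>

lemma polar_inner_integral:
  fixes f :: "'a::euclidean_space \<Rightarrow> real" and y w :: 'a
  assumes C: "C2_on UNIV f g h" and supp: "\<And>x. R < norm x \<Longrightarrow> f x = 0" and e: "0 < e" and w: "norm w = 1"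
  shows "(\<integral>r. polar_density TYPE('a) r * (kernel_slope TYPE('a) / norm (r *\<^sub>R w) ^ DIM('a) * indicator {e<..} (norm (r *\<^sub>R w))
            * ((r *\<^sub>R w) \<bullet> g (y + r *\<^sub>R w))) \<partial>lborel)
       = - newton_const TYPE('a) * f (y + e *\<^sub>R w)"
proof -
  define T where "T = max e (\<bar>R\<bar> + norm y) + 1"
  have T: "e \<le> T" by (simp add: T_def)
  have big: "R < norm (y + r *\<^sub>R w)" if "T \<le> r" for r
  proof -
    have "r - norm y \<le> norm (y + r *\<^sub>R w)"
      using norm_triangle_ineq4[of "y + r *\<^sub>R w" y] w that e T by simp
    then show ?thesis using that by (simp add: T_def)
  qed
  have g0: "g x = 0" if "R < norm x" for x
    using C2_on_zero_outside[OF C, of "cball 0 R" x] supp that by auto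
  have gc: "isCont g x" for x
    using C2_on_continuous(2)[OF C] by (simp add: continuous_on_eq_continuous_at)
  have ftc: "(\<integral>r. (g (y + r *\<^sub>R w) \<bullet> w) * indicator {e..T} r \<partial>lborel) = f (y + T *\<^sub>R w) - f (y + e *\<^sub>R w)"
  proof (rule integral_FTC_Icc_real[OF T])
    show "((\<lambda>r. f (y + r *\<^sub>R w)) has_real_derivative g (y + r *\<^sub>R w) \<bullet> w) (at r)" for r
      using C2_on_line(1)[OF C] by simp
    have "isCont (\<lambda>r. g (y + r *\<^sub>R w)) r" for r
      by (rule isCont_o2[OF _ gc]) (intro continuous_intros)
    then show "isCont (\<lambda>r. g (y + r *\<^sub>R w) \<bullet> w) r" for r
      by (intro continuous_intros)
  qed
  have "(\<integral>r. polar_density TYPE('a) r * (kernel_slope TYPE('a) / norm (r *\<^sub>R w) ^ DIM('a) * indicator {e<..} (norm (r *\<^sub>R w))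
            * ((r *\<^sub>R w) \<bullet> g (y + r *\<^sub>R w))) \<partial>lborel)
     = (\<integral>r. newton_const TYPE('a) * ((g (y + r *\<^sub>R w) \<bullet> w) * indicator {e..T} r) \<partial>lborel)"
  proof (rule integral_cong_AE)
    have [measurable]: "g \<in> borel_measurable borel"
      using C2_on_continuous(2)[OF C] by (rule borel_measurable_continuous_onI)
    show "(\<lambda>r. polar_density TYPE('a) r * (kernel_slope TYPE('a) / norm (r *\<^sub>R w) ^ DIM('a) * indicator {e<..} (norm (r *\<^sub>R w))
            * ((r *\<^sub>R w) \<bullet> g (y + r *\<^sub>R w)))) \<in> borel_measurable lborel"
      by measurable
    show "(\<lambda>r. newton_const TYPE('a) * ((g (y + r *\<^sub>R w) \<bullet> w) * indicator {e..T} r)) \<in> borel_measurable lborel"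
      by measurable
    show "AE r in lborel. polar_density TYPE('a) r * (kernel_slope TYPE('a) / norm (r *\<^sub>R w) ^ DIM('a) * indicator {e<..} (norm (r *\<^sub>R w))
            * ((r *\<^sub>R w) \<bullet> g (y + r *\<^sub>R w))) = newton_const TYPE('a) * ((g (y + r *\<^sub>R w) \<bullet> w) * indicator {e..T} r)"
      using AE_lborel_singleton[of e]
    proof eventually_elim
      case (elim r)
      consider "r \<le> 0" | "0 < r" "r < e" | "e < r" "r \<le> T" | "T < r" using elim by fastforce
      then show ?case
      proof cases
        case 1 then show ?thesis using e by (simp add: polar_density_def)
      next
        case 2 then show ?thesis using w by simp
      next
        case 3
        have "r * r ^ (DIM('a) - 1) = r ^ DIM('a)"
          using DIM_positive[where 'a='a] by (cases "DIM('a)") auto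
        then have "polar_density TYPE('a) r * (kernel_slope TYPE('a) / r ^ DIM('a) * (r * (w \<bullet> g (y + r *\<^sub>R w))))
          = newton_const TYPE('a) * (w \<bullet> g (y + r *\<^sub>R w))"
          using 3 e by (simp add: polar_density_def newton_const_def field_simps)
        then show ?thesis using 3 e w by (simp add: inner_commute)
      next
        case 4
        then show ?thesis using g0[OF big, of r] by simp
      qed
    qed
  qed
  also have "\<dots> = newton_const TYPE('a) * (\<integral>r. ((g (y + r *\<^sub>R w) \<bullet> w) * indicator {e..T} r) \<partial>lborel)"
    by simp
  finally show ?thesis unfolding ftc using supp[OF big, of T] by simp
qed

text \<open>Newton's theorem read from the side of the test function: the kernel truncated at radius \<open>e\<close> is the potential of
the uniform distribution on the sphere of radius \<open>e\<close>, so it reproduces the spherical mean of \<open>f\<close>.\<close>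

theorem newton_sph_mean:
  fixes f :: "'a::euclidean_space \<Rightarrow> real" and y :: 'a
  assumes C: "C2_on UNIV f g h" and supp: "\<And>x. R < norm x \<Longrightarrow> f x = 0" and e: "0 < e"
  shows "(\<integral>x. radial_kernel TYPE('a) (max (norm (x - y)) e) * laplace h x \<partial>lborel)
       = newton_const TYPE('a) * sph_mean f y e"
proof -
  define \<Psi> where "\<Psi> = (\<lambda>x::'a. kernel_slope TYPE('a) / norm x ^ DIM('a) * indicator {e<..} (norm x))"
  note G = greens_first_identity[where y=y, OF C supp e]
  define F where "F x = \<Psi> x * (x \<bullet> g (y + x))" for x
  have F: "integrable lborel F"
    using integrable_lborel_plus[where a=y, OF G(2)] by (simp add: F_def[abs_def] \<Psi>_def)
  have "(\<integral>x. radial_kernel TYPE('a) (max (norm (x - y)) e) * laplace h x \<partial>lborel)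
      = - (\<integral>x. \<Psi> (x - y) * ((x - y) \<bullet> g x) \<partial>lborel)"
    using G(3) by (simp add: \<Psi>_def)
  also have "(\<integral>x. \<Psi> (x - y) * ((x - y) \<bullet> g x) \<partial>lborel) = (\<integral>x. \<Psi> ((y + x) - y) * (((y + x) - y) \<bullet> g (y + x)) \<partial>lborel)"
    by (rule integral_lborel_plus[symmetric]) (use G(2) in \<open>simp add: \<Psi>_def\<close>)
  also have "\<dots> = (\<integral>x. F x \<partial>lborel)" by (simp add: F_def)
  also have "\<dots> = (\<integral>z. (\<integral>r. polar_density TYPE('a) r * F (r *\<^sub>R sgn z) \<partial>lborel) \<partial>(unif_ball::'a measure))"
    by (rule polar_integral[OF F])
  also have "\<dots> = (\<integral>z. - newton_const TYPE('a) * f (y + e *\<^sub>R sgn z) \<partial>(unif_ball::'a measure))"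
  proof (rule integral_cong_AE)
    have [measurable]: "F \<in> borel_measurable borel" using F by simp
    have [measurable]: "f \<in> borel_measurable borel"
      using C2_on_continuous(1)[OF C] by (rule borel_measurable_continuous_onI)
    show "(\<lambda>z. \<integral>r. polar_density TYPE('a) r * F (r *\<^sub>R sgn z) \<partial>lborel) \<in> borel_measurable (unif_ball::'a measure)"
      by measurable
    show "(\<lambda>z. - newton_const TYPE('a) * f (y + e *\<^sub>R sgn z)) \<in> borel_measurable (unif_ball::'a measure)"
      by measurable
    show "AE z in unif_ball. (\<integral>r. polar_density TYPE('a) r * F (r *\<^sub>R sgn z) \<partial>lborel) = - newton_const TYPE('a) * f (y + e *\<^sub>R sgn z)"
      using AE_unif_ball_nonzero[where 'a='a]
    proof eventually_elim
      case (elim z)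
      then have w: "norm (sgn z) = 1" by (simp add: norm_sgn)
      show ?case unfolding F_def \<Psi>_def by (rule polar_inner_integral[OF C supp e w])
    qed
  qed
  finally show ?thesis by (simp add: sph_mean_def)
qed

lemma DERIV_max0_power:
  "((\<lambda>s::real. max 0 s ^ Suc (Suc n)) has_real_derivative real (Suc (Suc n)) * max 0 s ^ Suc n) (at s)"
proof -
  consider "s < 0" | "s > 0" | "s = 0" by linarith
  then show ?thesis
  proof cases
    case 1
    have "((\<lambda>s::real. 0) has_real_derivative 0) (at s)" by simp
    then have "((\<lambda>s::real. max 0 s ^ Suc (Suc n)) has_real_derivative 0) (at s)"
      by (rule has_field_derivative_transform_within[where d="-s"]) (use 1 in \<open>auto simp: dist_real_def\<close>)
    then show ?thesis using 1 by simp
  next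
    case 2
    have "((\<lambda>s::real. s ^ Suc (Suc n)) has_real_derivative real (Suc (Suc n)) * s ^ Suc n) (at s)"
      using DERIV_pow[of "Suc (Suc n)" s] by simp
    then have "((\<lambda>s::real. max 0 s ^ Suc (Suc n)) has_real_derivative real (Suc (Suc n)) * s ^ Suc n) (at s)"
      by (rule has_field_derivative_transform_within[where d="s"]) (use 2 in \<open>auto simp: dist_real_def\<close>)
    then show ?thesis using 2 by simp
  next
    case 3
    have "((\<lambda>h::real. \<bar>h\<bar> ^ Suc n) \<longlongrightarrow> 0) (at 0)"
      by (auto intro!: tendsto_eq_intros)
    then have "((\<lambda>h::real. max 0 h ^ Suc (Suc n) / h) \<longlongrightarrow> 0) (at 0)"
    proof (rule Lim_null_comparison[rotated], intro always_eventually allI)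
      show "norm (max 0 h ^ Suc (Suc n) / h) \<le> \<bar>h\<bar> ^ Suc n" for h :: real
      proof (cases "h > 0")
        case False
        then have "max 0 h = 0" by simp
        then have "norm (max 0 h ^ Suc (Suc n) / h) = 0" by (simp only: power_Suc mult_zero_left div_0 norm_zero)
        also have "0 \<le> \<bar>h\<bar> ^ Suc n" by (rule zero_le_power) simp
        finally show ?thesis .
      qed simp
    qed
    then show ?thesis using 3 by (simp add: DERIV_def)
  qed
qed

text \<open>A radial polynomial bump. The third power is the lowest that is \<open>C\<^sup>2\<close> across the boundary of the support.\<close>

definition bump :: "real \<Rightarrow> 'a::euclidean_space \<Rightarrow> real" where
  "bump c x = max 0 (1 - c * (norm x)\<^sup>2) ^ 3"
definition bump' :: "real \<Rightarrow> 'a::euclidean_space \<Rightarrow> 'a" where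
  "bump' c x = (- 6 * c * max 0 (1 - c * (norm x)\<^sup>2) ^ 2) *\<^sub>R x"
definition bump'' :: "real \<Rightarrow> 'a::euclidean_space \<Rightarrow> 'a \<Rightarrow> 'a" where
  "bump'' c x v = (- 6 * c * max 0 (1 - c * (norm x)\<^sup>2) ^ 2) *\<^sub>R v
     + (24 * c\<^sup>2 * max 0 (1 - c * (norm x)\<^sup>2) * (x \<bullet> v)) *\<^sub>R x"

lemma C2_on_bump: "C2_on UNIV (bump c :: 'a::euclidean_space \<Rightarrow> real) (bump' c) (bump'' c)"
  unfolding C2_on_def
proof (intro conjI ballI allI)
  fix x :: 'a
  have q: "((\<lambda>x::'a. 1 - c * (norm x)\<^sup>2) has_derivative (\<lambda>v. - 2 * c * (x \<bullet> v))) (at x)"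
    unfolding power2_norm_eq_inner
    by (auto intro!: derivative_eq_intros simp: inner_commute)
  have d3: "((\<lambda>s::real. max 0 s ^ 3) has_derivative (*) (3 * max 0 s ^ 2)) (at s)" for s
    using DERIV_max0_power[of 1 s] by (simp add: has_field_derivative_def numeral_3_eq_3 numeral_2_eq_2)
  have d2: "((\<lambda>s::real. max 0 s ^ 2) has_derivative (*) (2 * max 0 s)) (at s)" for s
    using DERIV_max0_power[of 0 s] by (simp add: has_field_derivative_def numeral_2_eq_2)
  show "(bump c has_derivative (\<bullet>) (bump' c x)) (at x)"
    unfolding bump_def[abs_def] bump'_def
    by (rule has_derivative_compose[OF q d3, THEN has_derivative_eq_rhs]) (auto simp: fun_eq_iff)
  define m where "m = (\<lambda>x::'a. max 0 (1 - c * (norm x)\<^sup>2) ^ 2)"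
  have m: "(m has_derivative (\<lambda>v. 2 * max 0 (1 - c * (norm x)\<^sup>2) * (- 2 * c * (x \<bullet> v)))) (at x)"
    unfolding m_def by (rule has_derivative_compose[OF q d2])
  have eq: "bump' c = (\<lambda>x::'a. (- 6 * c * m x) *\<^sub>R x)" by (simp add: bump'_def m_def fun_eq_iff)
  have "(bump' c has_derivative (\<lambda>v. (- 6 * c * m x) *\<^sub>R v
      + (- 6 * c * (2 * max 0 (1 - c * (norm x)\<^sup>2) * (- 2 * c * (x \<bullet> v)))) *\<^sub>R x)) (at x)"
    unfolding eq by (intro has_derivative_scaleR has_derivative_mult_right m has_derivative_ident)
  then show "(bump' c has_derivative bump'' c x) (at x)"
    by (rule has_derivative_eq_rhs) (simp add: bump''_def m_def fun_eq_iff power2_eq_square mult_ac)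
next
  fix v :: 'a
  show "continuous_on UNIV (\<lambda>x. bump'' c x v)"
    unfolding bump''_def by (intro continuous_intros)
qed

lemma bump_nonneg: "0 \<le> bump c x" by (simp add: bump_def)

lemma bump_zero: "0 < e \<Longrightarrow> e \<le> norm x \<Longrightarrow> bump (1 / e\<^sup>2) x = 0"
  by (simp add: bump_def max_def field_simps power_mono)

lemma bump_uminus: "bump c (- x) = bump c x" by (simp add: bump_def)

lemma bump_pos: "0 < e \<Longrightarrow> norm x < e \<Longrightarrow> 0 < bump (1 / e\<^sup>2) x"
  by (simp add: bump_def max_def field_simps power_strict_mono abs_square_less_1 zero_less_power)

lemma continuous_on_bump: "continuous_on UNIV (bump c)"
  unfolding bump_def[abs_def] by (intro continuous_intros)

lemma borel_measurable_bump [measurable]: "bump c \<in> borel_measurable borel"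
  by (rule borel_measurable_continuous_onI[OF continuous_on_bump])

definition conv :: "('a::euclidean_space \<Rightarrow> real) \<Rightarrow> ('a \<Rightarrow> 'b::euclidean_space) \<Rightarrow> 'a \<Rightarrow> 'b" where
  "conv v \<psi> x = (\<integral>y. v y *\<^sub>R \<psi> (x - y) \<partial>lborel)"

lemma norm_integral_le:
  fixes f :: "'a \<Rightarrow> 'b::{banach, second_countable_topology}"
  assumes "integrable M f" "integrable M w" "\<And>x. norm (f x) \<le> w x"
  shows "norm (\<integral>x. f x \<partial>M) \<le> (\<integral>x. w x \<partial>M)"
  by (rule order_trans[OF integral_norm_bound integral_mono]) (use assms in auto)

lemma integrable_conv:
  fixes \<psi> :: "'a::euclidean_space \<Rightarrow> 'b::euclidean_space"
  assumes v: "integrable lborel v" and [measurable]: "\<psi> \<in> borel_measurable borel"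
    and B: "\<And>x. norm (\<psi> x) \<le> B"
  shows "integrable lborel (\<lambda>y. v y *\<^sub>R \<psi> (x - y))"
proof (rule Bochner_Integration.integrable_bound)
  show "integrable lborel (\<lambda>y. B * v y)" using v by simp
  have [measurable]: "v \<in> borel_measurable borel" using v by simp
  show "(\<lambda>y. v y *\<^sub>R \<psi> (x - y)) \<in> borel_measurable lborel" by measurable
  have "0 \<le> B" using B[of 0] norm_ge_zero order_trans by blast
  then show "AE y in lborel. norm (v y *\<^sub>R \<psi> (x - y)) \<le> norm (B * v y)"
    using B by (intro AE_I2) (simp add: abs_mult mult.commute[of B] mult_left_mono)
qed

text \<open>Two points at distance below \<open>1\<close> lie both in the ball of radius \<open>R + 1\<close> or both outside the support.\<close>

lemma uniform_continuity_compact_support: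
  fixes f :: "'a::euclidean_space \<Rightarrow> 'b::real_normed_vector"
  assumes c: "continuous_on UNIV f" and supp: "\<And>x. R < norm x \<Longrightarrow> f x = 0" and e: "0 < e"
  obtains d where "0 < d" "\<And>x y. norm (x - y) < d \<Longrightarrow> norm (f x - f y) < e"
proof -
  have "uniformly_continuous_on (cball 0 (R + 1)) f"
    by (rule compact_uniformly_continuous) (use c continuous_on_subset in auto)
  then obtain d where d: "d > 0" "\<And>x y. x \<in> cball 0 (R+1) \<Longrightarrow> y \<in> cball 0 (R+1) \<Longrightarrow> dist y x < d \<Longrightarrow> dist (f y) (f x) < e"
    unfolding uniformly_continuous_on_def using e by metis
  show ?thesis
  proof (rule that[of "min d 1"])
    fix x y :: 'a assume xy: "norm (x - y) < min d 1"
    then have "norm x < norm y + 1" "norm y < norm x + 1"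
      using norm_triangle_ineq2[of x y] norm_triangle_ineq3[of x y] by auto
    then consider "norm x \<le> R + 1" "norm y \<le> R + 1" | "R < norm x" "R < norm y" by linarith
    then show "norm (f x - f y) < e"
    proof cases
      case 1 then show ?thesis using d(2)[of y x] xy by (simp add: dist_norm)
    next
      case 2 then show ?thesis using supp e by simp
    qed
  qed (use d in auto)
qed

lemma continuous_on_conv:
  fixes \<psi> :: "'a::euclidean_space \<Rightarrow> 'b::euclidean_space"
  assumes v: "integrable lborel v" and c: "continuous_on UNIV \<psi>" and supp: "\<And>x. R < norm x \<Longrightarrow> \<psi> x = 0"
  shows "continuous_on UNIV (conv v \<psi>)"
proof -
  have [measurable]: "\<psi> \<in> borel_measurable borel" using c by (rule borel_measurable_continuous_onI)
  obtain B where B: "\<And>x. norm (\<psi> x) \<le> B" using continuous_compact_support_bounded[OF c supp] by blast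
  have int: "integrable lborel (\<lambda>y. v y *\<^sub>R \<psi> (x - y))" for x
    by (rule integrable_conv[OF v _ B]) simp
  define N where "N = (\<integral>y. \<bar>v y\<bar> \<partial>lborel)"
  have N: "N \<ge> 0" by (simp add: N_def)
  show ?thesis
    unfolding continuous_on_iff
  proof (intro ballI allI impI)
    fix x :: 'a and e :: real assume e: "0 < e"
    define e' where "e' = e / (N + 1)"
    have e': "0 < e'" using e N by (simp add: e'_def)
    obtain d where d: "0 < d" "\<And>x y. norm (x - y) < d \<Longrightarrow> norm (\<psi> x - \<psi> y) < e'"
      using uniform_continuity_compact_support[OF c supp e'] by blast
    have "dist (conv v \<psi> x') (conv v \<psi> x) < e" if "dist x' x < d" for x'
    proof -
      have "conv v \<psi> x' - conv v \<psi> x = (\<integral>y. v y *\<^sub>R (\<psi> (x' - y) - \<psi> (x - y)) \<partial>lborel)"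
        unfolding conv_def using int by (simp add: scaleR_diff_right)
      also have "norm \<dots> \<le> (\<integral>y. \<bar>v y\<bar> * e' \<partial>lborel)"
      proof (rule norm_integral_le)
        show "integrable lborel (\<lambda>y. v y *\<^sub>R (\<psi> (x' - y) - \<psi> (x - y)))"
          using int by (simp add: scaleR_diff_right)
        show "integrable lborel (\<lambda>y. \<bar>v y\<bar> * e')" using v by simp
        show "norm (v y *\<^sub>R (\<psi> (x' - y) - \<psi> (x - y))) \<le> \<bar>v y\<bar> * e'" for y
          using d(2)[of "x' - y" "x - y"] that by (simp add: dist_norm mult_left_mono)
      qed
      also have "\<dots> = N * e'" by (simp add: N_def)
      also have "\<dots> < e" using e N by (simp add: e'_def field_simps)
      finally show ?thesis by (simp add: dist_norm)
    qed
    then show "\<exists>d>0. \<forall>x'\<in>UNIV. dist x' x < d \<longrightarrow> dist (conv v \<psi> x') (conv v \<psi> x) < e"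
      using d(1) by blast
  qed
qed

text \<open>The derivative of \<open>\<psi>\<close> is uniformly continuous, so its linearisation error at increment \<open>w\<close> is at most
\<open>\<epsilon> |w|\<close> uniformly in the base point, and integration against \<open>v\<close> preserves this.\<close>

lemma has_derivative_conv:
  fixes \<psi> :: "'a::euclidean_space \<Rightarrow> 'b::euclidean_space"
  assumes v: "integrable lborel v" and der: "\<And>x. (\<psi> has_derivative \<psi>' x) (at x)"
    and c': "\<And>w. continuous_on UNIV (\<lambda>x. \<psi>' x w)"
    and supp: "\<And>x. R < norm x \<Longrightarrow> \<psi> x = 0" and supp': "\<And>x w. R < norm x \<Longrightarrow> \<psi>' x w = 0"
  shows "(conv v \<psi> has_derivative (\<lambda>w. conv v (\<lambda>x. \<psi>' x w) x)) (at x)"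
proof -
  have c: "continuous_on UNIV \<psi>"
    using der by (meson has_derivative_continuous continuous_at_imp_continuous_on)
  have lin: "linear (\<psi>' x)" for x using der has_derivative_linear by blast
  have [measurable]: "\<psi> \<in> borel_measurable borel" "(\<lambda>x. \<psi>' x w) \<in> borel_measurable borel" for w
    using c c' by (auto intro: borel_measurable_continuous_onI)
  obtain B where B: "\<And>x. norm (\<psi> x) \<le> B" using continuous_compact_support_bounded[OF c supp] by blast
  have "\<exists>B. \<forall>x. norm (\<psi>' x w) \<le> B" for w
    using continuous_compact_support_bounded[OF c' supp'] by metis
  then obtain B' where B': "\<And>w x. norm (\<psi>' x w) \<le> B' w" by metis
  have int: "integrable lborel (\<lambda>y. v y *\<^sub>R \<psi> (x - y))" for x
    by (rule integrable_conv[OF v _ B]) simp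
  have int': "integrable lborel (\<lambda>y. v y *\<^sub>R \<psi>' (x - y) w)" for x w
    by (rule integrable_conv[where \<psi>="\<lambda>x. \<psi>' x w", OF v _ B']) simp
  define N where "N = (\<integral>y. \<bar>v y\<bar> \<partial>lborel)"
  have N: "N \<ge> 0" by (simp add: N_def)
  have linc: "linear (\<lambda>w. conv v (\<lambda>x. \<psi>' x w) x)"
  proof (rule linearI)
    show "conv v (\<lambda>x. \<psi>' x (b1 + b2)) x = conv v (\<lambda>x. \<psi>' x b1) x + conv v (\<lambda>x. \<psi>' x b2) x" for b1 b2
      by (simp add: conv_def linear_add[OF lin] scaleR_add_right int')
    show "conv v (\<lambda>x. \<psi>' x (r *\<^sub>R b)) x = r *\<^sub>R conv v (\<lambda>x. \<psi>' x b) x" for r b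
      unfolding conv_def linear_cmul[OF lin]
      by (subst integral_scaleR_right[symmetric]) (simp add: mult.commute)
  qed
  show ?thesis
    unfolding has_derivative_at_alt
  proof (intro conjI allI impI)
    show "bounded_linear (\<lambda>w. conv v (\<lambda>x. \<psi>' x w) x)" using linc by (simp add: linear_conv_bounded_linear)
    fix e :: real assume e: "0 < e"
    \<comment> \<open>The factor \<open>DIM('a)\<close> pays for passing from basis directions to the operator norm.\<close>
    define e' where "e' = e / ((N + 1) * DIM('a))"
    have e': "0 < e'" using e N by (simp add: e'_def)
    have "\<exists>d>0. \<forall>x y. norm (x - y) < d \<longrightarrow> norm (\<psi>' x b - \<psi>' y b) < e'" for b
      using uniform_continuity_compact_support[OF c' supp' e'] by metis
    then obtain D where D: "\<And>b. D b > 0" "\<And>b x y. norm (x - y) < D b \<Longrightarrow> norm (\<psi>' x b - \<psi>' y b) < e'" by metis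
    define d where "d = Min (D ` Basis)"
    have d: "d > 0" "\<And>b. b \<in> Basis \<Longrightarrow> d \<le> D b" using D(1) by (auto simp: d_def)
    have op: "norm (\<psi>' x w - \<psi>' y w) \<le> (DIM('a) * e') * norm w" if "norm (x - y) < d" for x y w
    proof -
      have lin2: "linear (\<lambda>w. \<psi>' x w - \<psi>' y w)" by (intro linear_compose_sub lin)
      have "\<psi>' x w - \<psi>' y w = (\<lambda>w. \<psi>' x w - \<psi>' y w) (\<Sum>b\<in>Basis. (w \<bullet> b) *\<^sub>R b)"
        by (simp add: euclidean_representation)
      also have "\<dots> = (\<Sum>b\<in>Basis. (w \<bullet> b) *\<^sub>R (\<psi>' x b - \<psi>' y b))"
        unfolding linear_sum[OF lin2] by (simp add: linear_cmul[OF lin2])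
      also have "norm \<dots> \<le> (\<Sum>b\<in>(Basis::'a set). norm w * e')"
      proof (rule sum_norm_le)
        fix b :: 'a assume b: "b \<in> Basis"
        then have "norm (\<psi>' x b - \<psi>' y b) \<le> e'"
          using D(2)[of x y b] that d(2)[of b] by simp
        then show "norm ((w \<bullet> b) *\<^sub>R (\<psi>' x b - \<psi>' y b)) \<le> norm w * e'"
          using Basis_le_norm[OF b, of w] by (auto intro!: mult_mono)
      qed
      finally show ?thesis by (simp add: algebra_simps)
    qed
    have "norm (conv v \<psi> y - conv v \<psi> x - conv v (\<lambda>z. \<psi>' z (y - x)) x) \<le> e * norm (y - x)" if "norm (y - x) < d" for y
    proof -
      have rem: "norm (\<psi> (y - u) - \<psi> (x - u) - \<psi>' (x - u) (y - x)) \<le> norm (y - x) * (DIM('a) * e')" for u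
      proof -
        have "norm (\<psi> (y - u) - \<psi> (x - u) - \<psi>' (x - u) ((y - u) - (x - u))) \<le> norm ((y - u) - (x - u)) * (DIM('a) * e')"
        proof (rule differentiable_bound_linearization[where S="ball (x - u) d"])
          show "(x - u) + t *\<^sub>R ((y - u) - (x - u)) \<in> ball (x - u) d" if "t \<in> {0..1}" for t
          proof -
            have "\<bar>t\<bar> * norm (y - x) \<le> 1 * norm (y - x)" using that by (intro mult_right_mono) auto
            then show ?thesis using \<open>norm (y - x) < d\<close> by (simp add: dist_norm)
          qed
          show "(\<psi> has_derivative \<psi>' z) (at z within ball (x - u) d)" for z
            using der has_derivative_at_withinI by blast
          show "onorm ((\<lambda>z. \<psi>' z) z - \<psi>' (x - u)) \<le> DIM('a) * e'" if "z \<in> ball (x - u) d" for z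
            using that op[of z "x - u"] by (intro onorm_le) (simp add: dist_norm norm_minus_commute)
          show "x - u \<in> ball (x - u) d" using d by simp
        qed
        then show ?thesis by simp
      qed
      have "conv v \<psi> y - conv v \<psi> x - conv v (\<lambda>z. \<psi>' z (y - x)) x
         = (\<integral>u. v u *\<^sub>R (\<psi> (y - u) - \<psi> (x - u) - \<psi>' (x - u) (y - x)) \<partial>lborel)"
        unfolding conv_def using int int' by (simp add: scaleR_diff_right)
      also have "norm \<dots> \<le> (\<integral>u. \<bar>v u\<bar> * (norm (y - x) * (DIM('a) * e')) \<partial>lborel)"
      proof (rule norm_integral_le)
        show "integrable lborel (\<lambda>u. v u *\<^sub>R (\<psi> (y - u) - \<psi> (x - u) - \<psi>' (x - u) (y - x)))"
          using int int' by (simp add: scaleR_diff_right)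
        show "integrable lborel (\<lambda>u. \<bar>v u\<bar> * (norm (y - x) * (DIM('a) * e')))" using v by simp
        show "norm (v u *\<^sub>R (\<psi> (y - u) - \<psi> (x - u) - \<psi>' (x - u) (y - x))) \<le> \<bar>v u\<bar> * (norm (y - x) * (DIM('a) * e'))" for u
          using rem[of u] by (simp add: mult_left_mono)
      qed
      also have "\<dots> = (N / (N + 1)) * e * norm (y - x)" by (simp add: N_def[symmetric] e'_def)
      also have "\<dots> \<le> 1 * e * norm (y - x)"
        using N e by (intro mult_right_mono) auto
      finally show ?thesis by simp
    qed
    then show "\<exists>d>0. \<forall>y. norm (y - x) < d \<longrightarrow> norm (conv v \<psi> y - conv v \<psi> x - conv v (\<lambda>z. \<psi>' z (y - x)) x) \<le> e * norm (y - x)"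
      using d(1) by blast
  qed
qed

lemma C2_on_conv:
  fixes \<psi> :: "'a::euclidean_space \<Rightarrow> real"
  assumes v: "integrable lborel v" and C: "C2_on UNIV \<psi> g h" and supp: "\<And>x. R < norm x \<Longrightarrow> \<psi> x = 0"
  shows "C2_on UNIV (conv v \<psi>) (conv v g) (\<lambda>x w. conv v (\<lambda>x. h x w) x)"
proof -
  have g0: "g x = 0" and h0: "h x = (\<lambda>v. 0)" if "R < norm x" for x
    using C2_on_zero_outside[OF C, of "cball 0 R" x] supp that by auto
  note cont = C2_on_continuous[OF C]
  have [measurable]: "g \<in> borel_measurable borel" using cont(2) by (rule borel_measurable_continuous_onI)
  obtain B where B: "\<And>x. norm (g x) \<le> B" using continuous_compact_support_bounded[OF cont(2) g0] by blast
  have ig: "integrable lborel (\<lambda>y. v y *\<^sub>R g (x - y))" for x by (rule integrable_conv[OF v _ B]) simp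
  have eq: "conv v (\<lambda>x. g x \<bullet> w) x = conv v g x \<bullet> w" for x w
    unfolding conv_def using integral_inner_left[of w lborel "\<lambda>y. v y *\<^sub>R g (x - y)"] ig by simp
  show ?thesis
    unfolding C2_on_def
  proof (intro conjI ballI allI)
    fix x
    have "(conv v \<psi> has_derivative (\<lambda>w. conv v (\<lambda>x. g x \<bullet> w) x)) (at x)"
      by (rule has_derivative_conv[OF v _ _ supp])
         (use C cont g0 in \<open>auto simp: C2_on_def intro!: continuous_intros\<close>)
    then show "(conv v \<psi> has_derivative (\<bullet>) (conv v g x)) (at x)" by (simp add: eq)
    show "(conv v g has_derivative (\<lambda>w. conv v (\<lambda>x. h x w) x)) (at x)"
      by (rule has_derivative_conv[OF v _ _ g0])
         (use C cont h0 in \<open>auto simp: C2_on_def\<close>)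
  next
    fix w
    show "continuous_on UNIV (conv v (\<lambda>x. h x w))"
      by (rule continuous_on_conv[OF v cont(3), where R=R]) (simp add: h0)
  qed
qed

section \<open>Cut-off functions and the mean value inequality\<close>

lemma integral_lborel_reflect:
  fixes f :: "'a::euclidean_space \<Rightarrow> 'b::{banach, second_countable_topology}"
  assumes [measurable]: "f \<in> borel_measurable borel"
  shows "(\<integral>y. f (x - y) \<partial>lborel) = (\<integral>y. f y \<partial>lborel)"
proof -
  have "(\<integral>y. f y \<partial>lborel) = (\<integral>y. f (x + y) \<partial>lborel)"
    by (rule integral_lborel_plus[symmetric]) simp
  also have "\<dots> = (\<integral>y. f (x + y) \<partial>distr lborel borel uminus)"
    by (simp add: lborel_uminus)
  also have "\<dots> = (\<integral>y. f (x - y) \<partial>lborel)"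
    by (subst integral_distr) auto
  finally show ?thesis ..
qed

lemma conv_commute:
  fixes \<psi> :: "'a::euclidean_space \<Rightarrow> real"
  assumes [measurable]: "v \<in> borel_measurable borel" "\<psi> \<in> borel_measurable borel"
  shows "conv v \<psi> x = (\<integral>y. v (x - y) * \<psi> y \<partial>lborel)"
  using integral_lborel_reflect[of "\<lambda>y. v (x - y) * \<psi> y" x] by (simp add: conv_def)

lemma integral_pos_ball:
  fixes f :: "'a::euclidean_space \<Rightarrow> real"
  assumes f: "integrable lborel f" and nn: "\<And>x. 0 \<le> f x" and r: "0 < r"
    and pos: "\<And>x. x \<in> ball a r \<Longrightarrow> 0 < f x"
  shows "0 < (\<integral>x. f x \<partial>lborel)"
proof (rule ccontr)
  assume "\<not> 0 < (\<integral>x. f x \<partial>lborel)"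
  then have "(\<integral>x. f x \<partial>lborel) = 0"
    using Bochner_Integration.integral_nonneg[of lborel f] nn by fastforce
  then have "AE x in lborel. f x = 0"
    using integral_nonneg_eq_0_iff_AE[OF f] nn by simp
  then have "AE x in lborel. x \<notin> ball a r"
    by eventually_elim (use pos in fastforce)
  then have "ball a r \<in> null_sets lborel" by (subst (asm) AE_iff_null_sets[symmetric]) auto
  then show False using r unit_ball_vol_pos[of "DIM('a)"]
    by (auto simp: null_sets_def emeasure_ball)
qed

definition mollifier :: "real \<Rightarrow> 'a::euclidean_space \<Rightarrow> real" where
  "mollifier e x = bump (1 / e\<^sup>2) x / (\<integral>y. bump (1 / e\<^sup>2) y \<partial>(lborel :: 'a measure))"

lemma integrable_bump: "0 < e \<Longrightarrow> integrable lborel (bump (1 / e\<^sup>2) :: 'a::euclidean_space \<Rightarrow> real)"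
  by (rule integrable_continuous_compact_support[OF continuous_on_bump, of e]) (simp add: bump_zero)

lemma bump_mass_pos: "0 < e \<Longrightarrow> 0 < (\<integral>y. bump (1 / e\<^sup>2) y \<partial>(lborel :: 'a::euclidean_space measure))"
  by (rule integral_pos_ball[OF integrable_bump, of e e 0]) (auto simp: bump_nonneg bump_pos)

lemma mollifier_nonneg: "0 < e \<Longrightarrow> 0 \<le> mollifier e x"
  unfolding mollifier_def by (intro divide_nonneg_pos bump_nonneg bump_mass_pos)

lemma mollifier_zero: "0 < e \<Longrightarrow> e \<le> norm x \<Longrightarrow> mollifier e x = 0"
  by (simp add: mollifier_def bump_zero)

lemma continuous_on_mollifier: "continuous_on UNIV (mollifier e :: 'a::euclidean_space \<Rightarrow> real)"
  unfolding mollifier_def[abs_def] divide_inverse by (intro continuous_intros continuous_on_bump)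

lemma borel_measurable_mollifier [measurable]: "mollifier e \<in> borel_measurable borel"
  by (rule borel_measurable_continuous_onI[OF continuous_on_mollifier])

lemma integrable_mollifier: "0 < e \<Longrightarrow> integrable lborel (mollifier e :: 'a::euclidean_space \<Rightarrow> real)"
  by (rule integrable_continuous_compact_support[OF continuous_on_mollifier, of e]) (simp add: mollifier_zero)

lemma integral_mollifier: "0 < e \<Longrightarrow> (\<integral>x. mollifier e x \<partial>(lborel :: 'a::euclidean_space measure)) = 1"
  using bump_mass_pos[where 'a='a, of e] by (simp add: mollifier_def[abs_def])

lemma mollifier_uminus: "mollifier e (- x) = mollifier e x"
  by (simp add: mollifier_def bump_uminus)

lemma mollifier_cong_norm:
  fixes x y :: "'a::euclidean_space"
  shows "norm x = norm y \<Longrightarrow> mollifier e x = mollifier e y"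
  by (simp add: mollifier_def bump_def)

lemma C2_on_cmult:
  assumes "C2_on U f g h"
  shows "C2_on U (\<lambda>x. c * f x) (\<lambda>x. c *\<^sub>R g x) (\<lambda>x v. c *\<^sub>R h x v)"
  using assms unfolding C2_on_def
  by (auto intro!: derivative_eq_intros continuous_intros simp: fun_eq_iff)

lemma laplace_cmult: "laplace (\<lambda>x v. c *\<^sub>R h x v) x = c * laplace h x"
  by (simp add: laplace_def sum_distrib_left)

lemma C2_on_mollifier:
  "\<exists>g h. C2_on UNIV (mollifier e :: 'a::euclidean_space \<Rightarrow> real) g h"
  using C2_on_cmult[OF C2_on_bump[of "1 / e\<^sup>2"], of "1 / (\<integral>y. bump (1 / e\<^sup>2) y \<partial>(lborel :: 'a measure))"]
  unfolding mollifier_def[abs_def] by (auto simp: mult.commute)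

lemma C2_on_conv_mollifier:
  assumes "integrable lborel v" "0 < e"
  shows "\<exists>g h. C2_on UNIV (conv v (mollifier e)) g h"
proof -
  obtain g h where "C2_on UNIV (mollifier e :: 'a \<Rightarrow> real) g h" using C2_on_mollifier by blast
  from C2_on_conv[OF assms(1) this, of e] assms(2) show ?thesis
    by (metis mollifier_zero less_imp_le)
qed

lemma C2_on_mult:
  assumes "C2_on U f g h" "C2_on U f2 g2 h2"
  shows "C2_on U (\<lambda>x. f x * f2 x) (\<lambda>x. f x *\<^sub>R g2 x + f2 x *\<^sub>R g x)
     (\<lambda>x v. f x *\<^sub>R h2 x v + (g x \<bullet> v) *\<^sub>R g2 x + (f2 x *\<^sub>R h x v + (g2 x \<bullet> v) *\<^sub>R g x))"
  unfolding C2_on_def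
proof (intro conjI ballI allI)
  note c = C2_on_continuous[OF assms(1)] C2_on_continuous[OF assms(2)]
  show "continuous_on U (\<lambda>x. f x *\<^sub>R h2 x v + (g x \<bullet> v) *\<^sub>R g2 x + (f2 x *\<^sub>R h x v + (g2 x \<bullet> v) *\<^sub>R g x))" for v
    by (intro continuous_intros c)
  fix x assume x: "x \<in> U"
  have d: "(f has_derivative (\<lambda>v. g x \<bullet> v)) (at x)" "(f2 has_derivative (\<lambda>v. g2 x \<bullet> v)) (at x)"
    "(g has_derivative h x) (at x)" "(g2 has_derivative h2 x) (at x)"
    using assms x by (auto simp: C2_on_def)
  show "((\<lambda>x. f x * f2 x) has_derivative (\<bullet>) (f x *\<^sub>R g2 x + f2 x *\<^sub>R g x)) (at x)"
    by (rule has_derivative_mult[OF d(1) d(2), THEN has_derivative_eq_rhs])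
       (simp add: fun_eq_iff inner_add_left)
  show "((\<lambda>x. f x *\<^sub>R g2 x + f2 x *\<^sub>R g x) has_derivative
      (\<lambda>v. f x *\<^sub>R h2 x v + (g x \<bullet> v) *\<^sub>R g2 x + (f2 x *\<^sub>R h x v + (g2 x \<bullet> v) *\<^sub>R g x))) (at x)"
    by (intro has_derivative_add has_derivative_scaleR d)
qed

text \<open>Gradient and Hessian are determined by the function on an open set.\<close>

lemma C2_on_unique:
  assumes C: "C2_on W f g h" "C2_on W f2 g2 h2" and W: "open W" and eq: "\<And>x. x \<in> W \<Longrightarrow> f x = f2 x"
    and x: "x \<in> W"
  shows "g x = g2 x" "h x = h2 x"
proof -
  have gg: "g y = g2 y" if y: "y \<in> W" for y
  proof -
    have "(f has_derivative (\<lambda>v. g2 y \<bullet> v)) (at y)"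
      by (rule has_derivative_transform_within_open[of f2 _ _ _ W])
         (use C(2) W eq y in \<open>auto simp: C2_on_def\<close>)
    then have "(\<lambda>v. g2 y \<bullet> v) = (\<lambda>v. g y \<bullet> v)"
      by (rule has_derivative_unique) (use C(1) y in \<open>auto simp: C2_on_def\<close>)
    then have "(g2 y - g y) \<bullet> v = 0" for v by (metis inner_diff_left right_minus_eq)
    then have "(g2 y - g y) \<bullet> (g2 y - g y) = 0" by blast
    then show ?thesis by simp
  qed
  then show "g x = g2 x" using x by blast
  have "(g has_derivative h2 x) (at x)"
    by (rule has_derivative_transform_within_open[of g2 _ _ _ W])
       (use C(2) W gg x in \<open>auto simp: C2_on_def\<close>)
  then show "h x = h2 x"
    by (rule has_derivative_unique[rotated]) (use C(1) x in \<open>auto simp: C2_on_def\<close>)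
qed

lemma C2_on_Un_open:
  assumes "C2_on U f g h" "C2_on V f g h"
  shows "C2_on (U \<union> V) f g h \<longleftrightarrow> (\<forall>v. continuous_on (U \<union> V) (\<lambda>x. h x v))"
  using assms unfolding C2_on_def by auto

lemma C2_on_extend_zero:
  fixes f :: "'a::euclidean_space \<Rightarrow> real"
  assumes C: "C2_on U f g h" and U: "open U" and K: "closed K" "K \<subseteq> U" and z: "\<And>x. x \<notin> K \<Longrightarrow> f x = 0"
  shows "\<exists>g' h'. C2_on UNIV f g' h'"
proof -
  define G where "G x = (if x \<in> U then g x else 0)" for x
  define H where "H x v = (if x \<in> U then h x v else 0)" for x v
  have fU: "C2_on U f G H"
    unfolding C2_on_def
  proof (intro conjI ballI allI)
    fix x assume x: "x \<in> U"
    show "(f has_derivative (\<bullet>) (G x)) (at x)" using C x by (auto simp: C2_on_def G_def)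
    have "(G has_derivative h x) (at x)"
      by (rule has_derivative_transform_within_open[of g _ _ _ U]) (use C x U in \<open>auto simp: C2_on_def G_def\<close>)
    then show "(G has_derivative H x) (at x)" using x by (simp add: H_def[abs_def])
  next
    fix v
    have "continuous_on U (\<lambda>x. h x v)" using C by (auto simp: C2_on_def)
    then show "continuous_on U (\<lambda>x. H x v)" by (simp add: H_def cong: continuous_on_cong)
  qed
  have oK: "open (- K)" using K by auto
  have G0: "G x = 0" and H0: "H x = (\<lambda>v. 0)" if "x \<notin> K" for x
  proof -
    have CK: "C2_on (U - K) f G H" "C2_on (U - K) (\<lambda>x. 0) (\<lambda>x. 0) (\<lambda>x v. 0)"
      using fU by (auto intro: C2_on_subset) (simp add: C2_on_def)
    show "G x = 0" 
      using C2_on_unique(1)[OF CK] U K z that by (cases "x \<in> U") (auto simp: G_def)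
    show "H x = (\<lambda>v. 0)"
      using C2_on_unique(2)[OF CK] U K z that by (cases "x \<in> U") (auto simp: H_def fun_eq_iff)
  qed
  have fK: "C2_on (- K) f G H"
    unfolding C2_on_def
  proof (intro conjI ballI allI)
    fix x assume x: "x \<in> - K"
    have "(f has_derivative (\<lambda>v. 0)) (at x)"
      by (rule has_derivative_transform_within_open[of "\<lambda>x. 0" _ _ _ "- K"]) (use x oK z in auto)
    moreover have "(\<bullet>) (G x) = (\<lambda>v. 0)" using x G0 by auto
    ultimately show "(f has_derivative (\<bullet>) (G x)) (at x)" by simp
    have "(G has_derivative (\<lambda>v. 0)) (at x)"
      by (rule has_derivative_transform_within_open[of "\<lambda>x. 0" _ _ _ "- K"]) (use x oK G0 in auto)
    then show "(G has_derivative H x) (at x)" using x H0 by simp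
  next
    fix v
    have "continuous_on (- K) (\<lambda>x. 0::'a)" by simp
    then show "continuous_on (- K) (\<lambda>x. H x v)"
      by (rule continuous_on_cong[THEN iffD1, rotated 2]) (auto simp: H0)
  qed
  have "U \<union> - K = UNIV" using K by auto
  moreover have "continuous_on (U \<union> - K) (\<lambda>x. H x v)" for v
    using fU fK U oK by (intro continuous_on_open_Un) (auto simp: C2_on_def)
  ultimately show ?thesis using C2_on_Un_open[OF fU fK] by auto
qed

text \<open>The mollified indicator of a neighbourhood of \<open>K\<close>. With \<open>e\<close> a quarter of the distance from \<open>K\<close> to the complement
of \<open>U\<close>, the mollifier of radius \<open>e\<close> sees only the value \<open>1\<close> near \<open>K\<close> and only the value \<open>0\<close> beyond distance \<open>3 e\<close>.\<close>

lemma cutoff_exists: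
  fixes K :: "'a::euclidean_space set"
  assumes K: "compact K" and U: "open U" "K \<subseteq> U"
  obtains \<phi> g h W K' where "C2_on UNIV \<phi> g h" "open W" "K \<subseteq> W" "W \<subseteq> K'" "compact K'" "K' \<subseteq> U"
    "\<And>x. x \<in> W \<Longrightarrow> \<phi> x = 1" "\<And>x. x \<notin> K' \<Longrightarrow> \<phi> x = 0"
proof -
  obtain e0 where e0: "e0 > 0" "(\<Union>x\<in>K. ball x e0) \<subseteq> U"
    using compact_subset_open_imp_ball_epsilon_subset[OF K U] by blast
  define e where "e = e0 / 4"
  have e: "e > 0" using e0 by (simp add: e_def)
  define N where "N r = (\<Union>x\<in>K. \<Union>y\<in>cball 0 r. {x + y})" for r
  have N: "x \<in> N r \<longleftrightarrow> (\<exists>y\<in>K. norm (x - y) \<le> r)" for x r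
  proof -
    have "x \<in> N r \<longleftrightarrow> (\<exists>y\<in>K. \<exists>z. norm z \<le> r \<and> x = y + z)"
      unfolding N_def by (simp add: Bex_def)
    also have "\<dots> \<longleftrightarrow> (\<exists>y\<in>K. norm (x - y) \<le> r)"
      by (rule bex_cong[OF refl]) (auto intro: exI[of _ "x - _"])
    finally show ?thesis .
  qed
  have compN: "compact (N r)" for r unfolding N_def by (rule compact_sums'[OF K compact_cball])
  define v where "v = (indicator (N (2 * e)) :: 'a \<Rightarrow> real)"
  have [measurable]: "N (2 * e) \<in> sets borel" using compN by (simp add: compact_imp_closed)
  have [measurable]: "v \<in> borel_measurable borel" unfolding v_def by simp
  have v: "integrable lborel v"
    unfolding v_def using emeasure_compact_finite[OF compN] by (intro integrable_real_indicator) auto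
  obtain g h where C: "C2_on UNIV (conv v (mollifier e)) g h"
    using C2_on_conv_mollifier[OF v e] by blast
  define W where "W = (\<Union>x\<in>K. ball x e)"
  show ?thesis
  proof (rule that[OF C])
    show "open W" by (auto simp: W_def)
    show "K \<subseteq> W" using e by (auto simp: W_def)
    show "W \<subseteq> N (3 * e)"
    proof
      fix x assume "x \<in> W"
      then obtain y where "y \<in> K" "norm (x - y) < e" by (auto simp: W_def dist_norm norm_minus_commute)
      then show "x \<in> N (3 * e)" unfolding N using e by (intro bexI[of _ y]) auto
    qed
    show "compact (N (3 * e))" by (rule compN)
    show "N (3 * e) \<subseteq> U"
    proof
      fix x assume "x \<in> N (3 * e)"
      then obtain y where "y \<in> K" "norm (x - y) \<le> 3 * e" using N by blast
      then have "x \<in> ball y e0" using e by (simp add: e_def dist_norm norm_minus_commute)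
      then have "x \<in> (\<Union>x\<in>K. ball x e0)" using \<open>y \<in> K\<close> by blast
      then show "x \<in> U" using e0(2) by blast
    qed
  next
    fix x assume "x \<in> W"
    then obtain y where y: "y \<in> K" "norm (x - y) < e" by (auto simp: W_def dist_norm norm_minus_commute)
    have *: "v (x - u) * mollifier e u = mollifier e u" for u
    proof (cases "norm u < e")
      case True
      have "norm (x - u - y) \<le> norm (x - y) + norm u" using norm_triangle_ineq4[of "x - y" u] by (simp add: algebra_simps)
      then have "x - u \<in> N (2 * e)" unfolding N using y True by (intro bexI[of _ y]) auto
      then show ?thesis by (simp add: v_def)
    next
      case False
      then show ?thesis using e by (simp add: mollifier_zero)
    qed
    show "conv v (mollifier e) x = 1"
      by (subst conv_commute) (simp_all only: * integral_mollifier[OF e], simp_all)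
  next
    fix x assume x: "x \<notin> N (3 * e)"
    have *: "v (x - u) * mollifier e u = 0" for u
    proof (cases "norm u < e")
      case True
      have "x - u \<notin> N (2 * e)"
      proof
        assume "x - u \<in> N (2 * e)"
        then obtain y where y: "y \<in> K" "norm (x - u - y) \<le> 2 * e" using N by blast
        have "norm (x - y) \<le> norm (x - u - y) + norm u" using norm_triangle_ineq[of "x - u - y" u] by simp
        then show False using x y True unfolding N by force
      qed
      then show ?thesis by (simp add: v_def)
    next
      case False
      then show ?thesis using e by (simp add: mollifier_zero)
    qed
    show "conv v (mollifier e) x = 0"
      by (subst conv_commute) (simp_all only: *, simp_all)
  qed
qed

text \<open>Localisation: on an open set containing \<open>K\<close> neither the function nor its Laplacian changes, so identities for compactly supported
functions apply to functions that are \<open>C\<^sup>2\<close> on \<open>U\<close> only.\<close>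

lemma C2_cutoff_product:
  fixes f :: "'a::euclidean_space \<Rightarrow> real"
  assumes C: "C2_on U f g h" and K: "compact K" and U: "open U" "K \<subseteq> U"
  obtains F G H W K' where "C2_on UNIV F G H" "open W" "K \<subseteq> W" "W \<subseteq> K'" "compact K'" "K' \<subseteq> U"
    "\<And>x. x \<in> W \<Longrightarrow> F x = f x" "\<And>x. x \<notin> K' \<Longrightarrow> F x = 0"
    "\<And>x. x \<in> W \<Longrightarrow> laplace H x = laplace h x" "\<And>x. x \<notin> K' \<Longrightarrow> laplace H x = 0"
proof -
  obtain \<phi> g1 h1 W K' where \<phi>: "C2_on UNIV \<phi> g1 h1" "open W" "K \<subseteq> W" "W \<subseteq> K'" "compact K'" "K' \<subseteq> U"
    "\<And>x. x \<in> W \<Longrightarrow> \<phi> x = 1" "\<And>x. x \<notin> K' \<Longrightarrow> \<phi> x = 0"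
    using cutoff_exists[OF K U] by blast
  have "C2_on U \<phi> g1 h1" using \<phi>(1) by (rule C2_on_subset) simp
  from C2_on_extend_zero[OF C2_on_mult[OF this C] U(1), of K'] \<phi>
  obtain G H where GH: "C2_on UNIV (\<lambda>x. \<phi> x * f x) G H" by (auto simp: compact_imp_closed)
  have "C2_on W (\<lambda>x. \<phi> x * f x) G H" "C2_on W f g h"
    using GH C \<phi> by (auto intro: C2_on_subset)
  from C2_on_unique(2)[OF this \<phi>(2)] have "H x = h x" if "x \<in> W" for x
    using that \<phi> by simp
  moreover have "H x = (\<lambda>v. 0)" if "x \<notin> K'" for x
    using C2_on_zero_outside(2)[OF GH, of K'] \<phi> that by (auto simp: compact_imp_closed)
  ultimately show ?thesis using \<phi>
    by (intro that[OF GH \<phi>(2-6)]) (auto simp: laplace_def)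
qed

lemma sph_mean_cong:
  assumes "0 \<le> r" "\<And>x. x \<in> cball y r \<Longrightarrow> f x = g x"
  shows "sph_mean f y r = sph_mean g y r"
proof -
  have "y + r *\<^sub>R sgn z \<in> cball y r" for z
    using assms(1) by (auto simp: dist_norm norm_sgn)
  then show ?thesis unfolding sph_mean_def using assms(2) by simp
qed

lemma sph_mean_cmult: "sph_mean (\<lambda>x. c * f x) y r = c * sph_mean f y r"
  by (simp add: sph_mean_def)

lemma sph_mean_uminus: "sph_mean (\<lambda>x. - f x) y r = - sph_mean f y r"
  by (simp add: sph_mean_def)

lemma integrable_unif_ball_bounded:
  fixes f :: "'a::euclidean_space \<Rightarrow> real"
  assumes "f \<in> borel_measurable borel" "\<And>x. \<bar>f x\<bar> \<le> B"
  shows "integrable unif_ball f"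
  by (rule unif_ball.integrable_const_bound[of _ B]) (use assms in auto)

lemma sph_mean_approx:
  fixes f :: "'a::euclidean_space \<Rightarrow> real"
  assumes c: "continuous_on UNIV f" and supp: "\<And>x. R < norm x \<Longrightarrow> f x = 0" and e: "0 < e"
  obtains d where "0 < d" "\<And>s. 0 \<le> s \<Longrightarrow> s < d \<Longrightarrow> \<bar>sph_mean f y s - f y\<bar> \<le> e"
proof -
  obtain d where d: "0 < d" "\<And>x y. norm (x - y) < d \<Longrightarrow> norm (f x - f y) < e"
    using uniform_continuity_compact_support[OF c supp e] by blast
  obtain B where B: "\<And>x. norm (f x) \<le> B" using continuous_compact_support_bounded[OF c supp] by blast
  have [measurable]: "f \<in> borel_measurable borel" using c by (rule borel_measurable_continuous_onI)
  have "\<bar>sph_mean f y s - f y\<bar> \<le> e" if s: "0 \<le> s" "s < d" for s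
  proof -
    have int: "integrable unif_ball (\<lambda>z. f (y + s *\<^sub>R sgn z))"
      by (rule integrable_unif_ball_bounded[of _ B]) (use B in auto)
    have "sph_mean f y s - f y = (\<integral>z. f (y + s *\<^sub>R sgn z) - f y \<partial>unif_ball)"
      using int by (simp add: sph_mean_def)
    also have "norm \<dots> \<le> (\<integral>z. e \<partial>(unif_ball::'a measure))"
    proof (rule norm_integral_le)
      show "norm (f (y + s *\<^sub>R sgn z) - f y) \<le> e" for z
      proof -
        have "norm (y + s *\<^sub>R sgn z - y) < d" using s by (simp add: norm_sgn)
        then show ?thesis using d(2) less_imp_le by blast
      qed
    qed (use int in auto)
    finally show ?thesis by simp
  qed
  with d(1) show ?thesis by (rule that)
qed

text \<open>The kernels truncated at radii \<open>s < r\<close> differ by a nonnegative weight that is positive exactly on the ball of radius \<open>r\<close>.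
Hence only the Laplacian on this ball matters for the difference of the two spherical means.\<close>

lemma sph_mean_difference:
  fixes f :: "'a::euclidean_space \<Rightarrow> real"
  assumes C: "C2_on UNIV f g h" and supp: "\<And>x. R < norm x \<Longrightarrow> f x = 0" and s: "0 < s" "s < r"
    and L: "\<And>x. x \<in> ball y r \<Longrightarrow> 0 \<le> laplace h x"
  shows "sph_mean f y s \<le> sph_mean f y r"
    and "(\<And>x. x \<in> ball y r \<Longrightarrow> 0 < laplace h x) \<Longrightarrow> sph_mean f y s < sph_mean f y r"
proof -
  have r: "0 < r" using s by simp
  define w where "w x = radial_kernel TYPE('a) (max (norm (x - y)) r) - radial_kernel TYPE('a) (max (norm (x - y)) s)" for x
  have int: "integrable lborel (\<lambda>x. w x * laplace h x)"
    unfolding w_def left_diff_distrib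
    by (intro Bochner_Integration.integrable_diff greens_first_identity(1)[OF C supp] s r)
  have eq: "newton_const TYPE('a) * (sph_mean f y r - sph_mean f y s) = (\<integral>x. w x * laplace h x \<partial>lborel)"
    unfolding right_diff_distrib w_def left_diff_distrib
    by (subst (1 2) newton_sph_mean[OF C supp, symmetric])
       (use s r greens_first_identity(1)[OF C supp] in simp_all)
  have w0: "w x = 0" if "x \<notin> ball y r" for x
    using that s by (simp add: w_def dist_norm norm_minus_commute max_def)
  have w1: "0 < w x" if "x \<in> ball y r" for x
  proof -
    have "max (norm (x - y)) r = r" "0 < max (norm (x - y)) s" "max (norm (x - y)) s < r"
      using that s by (auto simp: dist_norm norm_minus_commute)
    then show ?thesis using radial_kernel_strict_mono[where 'a='a] by (simp add: w_def)
  qed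
  have nn: "0 \<le> w x * laplace h x" for x
    using w0[of x] w1[of x] L[of x] by (cases "x \<in> ball y r") auto
  show "sph_mean f y s \<le> sph_mean f y r"
    using Bochner_Integration.integral_nonneg[of lborel "\<lambda>x. w x * laplace h x"] nn newton_const_pos[where 'a='a]
    unfolding eq[symmetric] by (simp add: zero_le_mult_iff)
  assume "\<And>x. x \<in> ball y r \<Longrightarrow> 0 < laplace h x"
  then have "0 < (\<integral>x. w x * laplace h x \<partial>lborel)"
    by (intro integral_pos_ball[OF int nn r, of y]) (auto simp: w1)
  then show "sph_mean f y s < sph_mean f y r"
    using newton_const_pos[where 'a='a]
    unfolding eq[symmetric] by (simp add: zero_less_mult_iff)
qed

text \<open>The spherical means increase with the radius and tend to \<open>f y\<close> as the radius shrinks.\<close>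

lemma sph_mean_ge:
  fixes f :: "'a::euclidean_space \<Rightarrow> real"
  assumes C: "C2_on U f g h" and U: "open U" "cball y r \<subseteq> U" and r: "0 < r"
    and L: "\<And>x. x \<in> ball y r \<Longrightarrow> 0 \<le> laplace h x"
  shows "f y \<le> sph_mean f y r"
    and "(\<And>x. x \<in> ball y r \<Longrightarrow> 0 < laplace h x) \<Longrightarrow> f y < sph_mean f y r"
proof -
  obtain F G H W K' where F: "C2_on UNIV F G H" "open W" "cball y r \<subseteq> W" "W \<subseteq> K'" "compact K'" "K' \<subseteq> U"
    "\<And>x. x \<in> W \<Longrightarrow> F x = f x" "\<And>x. x \<notin> K' \<Longrightarrow> F x = 0"
    "\<And>x. x \<in> W \<Longrightarrow> laplace H x = laplace h x"
    using C2_cutoff_product[OF C compact_cball U] by metis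
  obtain R where "\<forall>x\<in>K'. norm x \<le> R"
    using F(5) compact_imp_bounded bounded_iff by blast
  then have supp: "F x = 0" if "R < norm x" for x using F(8)[of x] that by force
  have "y \<in> W" using F(3) r by auto
  then have Fy: "F y = f y" "sph_mean F y s = sph_mean f y s" if "0 \<le> s" "s \<le> r" for s
    using F(3,7) r that subset_cball[of s r y] by (auto intro!: sph_mean_cong)
  have LH: "laplace H x = laplace h x" if "x \<in> ball y r" for x
    using F(3,9) that by (meson ball_subset_cball subsetD)
  have le: "F y \<le> sph_mean F y q" if q: "0 < q" "q \<le> r" for q
  proof (rule field_le_epsilon)
    fix e :: real assume e: "0 < e"
    obtain d where d: "0 < d" "\<And>s. 0 \<le> s \<Longrightarrow> s < d \<Longrightarrow> \<bar>sph_mean F y s - F y\<bar> \<le> e"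
      using sph_mean_approx[OF C2_on_continuous(1)[OF F(1)] supp e] by blast
    define s where "s = min d q / 2"
    have s: "0 < s" "s < q" "s < d" using d q by (auto simp: s_def)
    have "sph_mean F y s \<le> sph_mean F y q"
      by (rule sph_mean_difference(1)[OF F(1) supp s(1,2)]) (use LH L q in auto)
    then show "F y \<le> sph_mean F y q + e" using d(2)[of s] s by simp
  qed
  show "f y \<le> sph_mean f y r" using le[of r] Fy[of r] r by simp
  assume pos: "\<And>x. x \<in> ball y r \<Longrightarrow> 0 < laplace h x"
  have "F y \<le> sph_mean F y (r / 2)" using le r by simp
  also have "\<dots> < sph_mean F y r"
    by (rule sph_mean_difference(2)[OF F(1) supp]) (use LH L pos r in auto)
  finally show "f y < sph_mean f y r" using Fy[of r] r by simp
qed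

lemma sph_mean_harmonic:
  fixes f :: "'a::euclidean_space \<Rightarrow> real"
  assumes C: "C2_on U f g h" and U: "open U" "cball y r \<subseteq> U" and r: "0 < r"
    and L: "\<And>x. x \<in> ball y r \<Longrightarrow> laplace h x = 0"
  shows "sph_mean f y r = f y"
proof (rule antisym)
  show "f y \<le> sph_mean f y r" by (rule sph_mean_ge(1)[OF C U r]) (simp add: L)
  have "- 1 * f y \<le> sph_mean (\<lambda>x. - 1 * f x) y r"
  proof (rule sph_mean_ge(1)[OF C2_on_cmult[OF C] U r])
    show "0 \<le> laplace (\<lambda>x v. - 1 *\<^sub>R h x v) x" if "x \<in> ball y r" for x
      unfolding laplace_cmult using L[OF that] by simp
  qed
  then show "sph_mean f y r \<le> f y" unfolding sph_mean_cmult by simp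
qed

text \<open>If the Laplacian were negative at \<open>y\<close>, it would be negative on a small ball, and the strict mean value inequality for \<open>- f\<close>
would contradict the assumption.\<close>

lemma laplace_nonneg_of_sph_mean:
  fixes f :: "'a::euclidean_space \<Rightarrow> real"
  assumes C: "C2_on U f g h" and U: "open U" "y \<in> U" and q: "0 < q"
    and M: "\<And>r. 0 < r \<Longrightarrow> r < q \<Longrightarrow> f y \<le> sph_mean f y r"
  shows "0 \<le> laplace h y"
proof (rule ccontr)
  assume neg: "\<not> 0 \<le> laplace h y"
  have "continuous_on U (laplace h)" by (rule C2_on_continuous(4)[OF C])
  then have "isCont (laplace h) y" using U by (simp add: continuous_on_eq_continuous_at)
  then have "eventually (\<lambda>x. laplace h x < 0) (nhds y)"
    using neg order_tendstoD(2)[of "laplace h" "laplace h y" "nhds y" 0]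
    by (simp add: isCont_def tendsto_at_iff_tendsto_nhds)
  then obtain d where d: "0 < d" "\<And>x. dist x y < d \<Longrightarrow> laplace h x < 0"
    unfolding eventually_nhds_metric by blast
  obtain d2 where d2: "0 < d2" "ball y d2 \<subseteq> U" using U open_contains_ball by blast
  define r where "r = min q (min d d2) / 2"
  have r: "0 < r" "r < q" "r < d" "r < d2" using q d d2 by (auto simp: r_def)
  have "- 1 * f y < sph_mean (\<lambda>x. - 1 * f x) y r"
  proof (rule sph_mean_ge(2)[OF C2_on_cmult[OF C] U(1) _ r(1)])
    show "cball y r \<subseteq> U" using d2 r cball_subset_ball_iff[of y r y d2] by auto
    show "0 \<le> laplace (\<lambda>x v. - 1 *\<^sub>R h x v) x" "0 < laplace (\<lambda>x v. - 1 *\<^sub>R h x v) x" if "x \<in> ball y r" for x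
      unfolding laplace_cmult using d(2)[of x] that r by (auto simp: dist_commute)
  qed
  then show False using M[OF r(1,2)] unfolding sph_mean_cmult by simp
qed

section \<open>Harmonic functions and the mean value property\<close>

text \<open>In polar coordinates a radial average is a weighted average of spherical means.\<close>

lemma conv_mollifier_ge:
  fixes w :: "'a::euclidean_space \<Rightarrow> real"
  assumes [measurable]: "w \<in> borel_measurable borel" and B: "\<And>x. \<bar>w x\<bar> \<le> B" and e: "0 < e"
    and M: "\<And>r. 0 < r \<Longrightarrow> r < e \<Longrightarrow> a \<le> sph_mean w x r"
  shows "a \<le> conv w (mollifier e) x"
proof -
  have moll: "integrable lborel (mollifier e :: 'a \<Rightarrow> real)" by (rule integrable_mollifier[OF e])
  define F where "F y = (w (x + y) - a) * mollifier e y" for y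
  have iw: "integrable lborel (\<lambda>y. w (x + y) * mollifier e y)"
    by (rule Bochner_Integration.integrable_bound[OF integrable_mult_right[OF moll, of B]])
       (use B mollifier_nonneg[OF e] in \<open>auto intro!: AE_I2 mult_right_mono order_trans[OF _ abs_ge_self] simp: abs_mult\<close>)
  have F: "integrable lborel F"
    unfolding F_def left_diff_distrib using iw moll by simp
  have [measurable]: "F \<in> borel_measurable borel" using F by simp
  have "conv w (mollifier e) x = (\<integral>y. w (x - y) * mollifier e y \<partial>lborel)"
    by (rule conv_commute) simp_all
  also have "\<dots> = (\<integral>y. w (x - (0 - y)) * mollifier e (0 - y) \<partial>lborel)"
    by (rule integral_lborel_reflect[symmetric]) simp
  also have "\<dots> = (\<integral>y. w (x + y) * mollifier e y \<partial>lborel)" by (simp add: mollifier_uminus)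
  finally have eq: "conv w (mollifier e) x - a = (\<integral>y. F y \<partial>lborel)"
    unfolding F_def left_diff_distrib using iw moll integral_mollifier[OF e, where 'a='a] by simp
  interpret pair_sigma_finite "unif_ball :: 'a measure" "lborel :: real measure" ..
  have int: "integrable (unif_ball \<Otimes>\<^sub>M lborel) (\<lambda>(z, r). polar_density TYPE('a) r * F (r *\<^sub>R sgn z))"
    using F polar_integrable[of F] by (simp add: split_beta')
  have "(\<integral>y. F y \<partial>lborel) = (\<integral>z. (\<integral>r. polar_density TYPE('a) r * F (r *\<^sub>R sgn z) \<partial>lborel) \<partial>unif_ball)"
    by (rule polar_integral[OF F])
  also have "\<dots> = (\<integral>r. (\<integral>z. polar_density TYPE('a) r * F (r *\<^sub>R sgn z) \<partial>unif_ball) \<partial>lborel)"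
    by (rule Fubini_integral[OF int, symmetric])
  also have "0 \<le> \<dots>"
  proof (rule Bochner_Integration.integral_nonneg)
    fix r :: real
    show "0 \<le> (\<integral>z. polar_density TYPE('a) r * F (r *\<^sub>R sgn z) \<partial>unif_ball)"
    proof (cases "0 < r")
      case True
      obtain b :: 'a where b: "b \<in> Basis" using nonempty_Basis by blast
      have *: "(\<integral>z. F (r *\<^sub>R sgn z) \<partial>unif_ball) = (\<integral>z. (w (x + r *\<^sub>R sgn z) - a) * mollifier e (r *\<^sub>R b) \<partial>unif_ball)"
      proof (rule integral_cong_AE)
        show "AE z in unif_ball. F (r *\<^sub>R sgn z) = (w (x + r *\<^sub>R sgn z) - a) * mollifier e (r *\<^sub>R b)"
          using AE_unif_ball_nonzero[where 'a='a]
        proof eventually_elim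
          case (elim z)
          then have "norm (r *\<^sub>R sgn z) = norm (r *\<^sub>R b)" using b by (simp add: norm_sgn)
          then show ?case unfolding F_def using mollifier_cong_norm by metis
        qed
      qed auto
      have iz: "integrable unif_ball (\<lambda>z. w (x + r *\<^sub>R sgn z))"
        by (rule integrable_unif_ball_bounded[of _ B]) (use B in auto)
      have "(\<integral>z. F (r *\<^sub>R sgn z) \<partial>unif_ball) = (sph_mean w x r - a) * mollifier e (r *\<^sub>R b)"
        unfolding * using iz by (simp add: sph_mean_def)
      moreover have "0 \<le> (sph_mean w x r - a) * mollifier e (r *\<^sub>R b)"
      proof (cases "r < e")
        case True
        then show ?thesis using M[OF \<open>0 < r\<close>] mollifier_nonneg[OF e, of "r *\<^sub>R b"] by simp
      next
        case False
        then show ?thesis using b e \<open>0 < r\<close> by (simp add: mollifier_zero)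
      qed
      ultimately show ?thesis using polar_density_nonneg[where 'a='a, of r] by simp
    qed (simp add: polar_density_def)
  qed
  finally show ?thesis using eq by simp
qed

text \<open>Spherical means commute with convolution, by Fubini's theorem.\<close>

lemma sph_mean_conv:
  fixes w :: "'a::euclidean_space \<Rightarrow> real"
  assumes [measurable]: "w \<in> borel_measurable borel" and B: "\<And>x. \<bar>w x\<bar> \<le> B"
    and \<psi>: "integrable lborel \<psi>"
  shows "sph_mean (conv w \<psi>) x r = (\<integral>y. sph_mean w (x - y) r * \<psi> y \<partial>lborel)"
proof -
  have [measurable]: "\<psi> \<in> borel_measurable borel" using \<psi> by simp
  interpret pair_sigma_finite "unif_ball :: 'a measure" "lborel :: 'a measure" ..
  have c: "conv w \<psi> u = (\<integral>y. w (u - y) * \<psi> y \<partial>lborel)" for u by (rule conv_commute) simp_all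
  have i1: "integrable (unif_ball \<Otimes>\<^sub>M lborel) (\<lambda>p :: 'a \<times> 'a. B * \<psi> (snd p))"
  proof (intro integrable_mult_right integrableI_bounded)
    have "(\<integral>\<^sup>+p. ennreal (norm (\<psi> (snd p))) \<partial>(unif_ball \<Otimes>\<^sub>M lborel :: ('a \<times> 'a) measure))
        = (\<integral>\<^sup>+y. ennreal (norm (\<psi> y)) \<partial>lborel)"
      by (subst lborel.nn_integral_fst[symmetric]) (simp_all add: emeasure_unif_ball_UNIV)
    also have "\<dots> < \<infinity>" using \<psi> by (simp add: integrable_iff_bounded)
    finally show "(\<integral>\<^sup>+p. ennreal (norm (\<psi> (snd p))) \<partial>(unif_ball \<Otimes>\<^sub>M lborel :: ('a \<times> 'a) measure)) < \<infinity>" .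
  qed simp
  have int: "integrable (unif_ball \<Otimes>\<^sub>M lborel) (\<lambda>(z, y). w (x + r *\<^sub>R sgn z - y) * \<psi> y)"
    by (rule Bochner_Integration.integrable_bound[OF i1])
       (auto intro!: AE_I2 mult_right_mono order_trans[OF B abs_ge_self] simp: abs_mult split_beta')
  have "sph_mean (conv w \<psi>) x r = (\<integral>z. (\<integral>y. w (x + r *\<^sub>R sgn z - y) * \<psi> y \<partial>lborel) \<partial>unif_ball)"
    by (simp add: sph_mean_def c)
  also have "\<dots> = (\<integral>y. (\<integral>z. w (x + r *\<^sub>R sgn z - y) * \<psi> y \<partial>unif_ball) \<partial>lborel)"
    by (rule Fubini_integral[OF int, symmetric])
  also have "\<dots> = (\<integral>y. sph_mean w (x - y) r * \<psi> y \<partial>lborel)"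
    by (simp add: sph_mean_def algebra_simps)
  finally show ?thesis .
qed

lemma borel_measurable_sph_mean [measurable]:
  assumes [measurable]: "w \<in> borel_measurable borel"
  shows "(\<lambda>x. sph_mean w x r) \<in> borel_measurable borel"
  unfolding sph_mean_def by measurable

lemma sph_mean_bounded:
  fixes w :: "'a::euclidean_space \<Rightarrow> real"
  assumes [measurable]: "w \<in> borel_measurable borel" and B: "\<And>x. \<bar>w x\<bar> \<le> B"
  shows "\<bar>sph_mean w x r\<bar> \<le> B"
proof -
  have "norm (\<integral>z. w (x + r *\<^sub>R sgn z) \<partial>unif_ball) \<le> (\<integral>z. B \<partial>(unif_ball::'a measure))"
    by (rule norm_integral_le) (use B in \<open>auto intro!: integrable_unif_ball_bounded[of _ B]\<close>)
  then show ?thesis by (simp add: sph_mean_def)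
qed

lemma conv_mollifier_submean:
  fixes w :: "'a::euclidean_space \<Rightarrow> real"
  assumes [measurable]: "w \<in> borel_measurable borel" and B: "\<And>x. \<bar>w x\<bar> \<le> B" and e: "0 < e"
    and M: "\<And>u. u \<in> ball x e \<Longrightarrow> w u \<le> sph_mean w u r"
  shows "conv w (mollifier e) x \<le> sph_mean (conv w (mollifier e)) x r"
proof -
  have moll: "integrable lborel (mollifier e :: 'a \<Rightarrow> real)" by (rule integrable_mollifier[OF e])
  have int: "integrable lborel (\<lambda>y. g (x - y) * mollifier e y)"
    if [measurable]: "g \<in> borel_measurable borel" and g: "\<And>x. \<bar>g x\<bar> \<le> B" for g
    by (rule Bochner_Integration.integrable_bound[OF integrable_mult_right[OF moll, of B]])
       (use g mollifier_nonneg[OF e] in \<open>auto intro!: AE_I2 mult_right_mono order_trans[OF _ abs_ge_self] simp: abs_mult\<close>)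
  have "conv w (mollifier e) x = (\<integral>y. w (x - y) * mollifier e y \<partial>lborel)"
    by (rule conv_commute) simp_all
  also have "\<dots> \<le> (\<integral>y. sph_mean w (x - y) r * mollifier e y \<partial>lborel)"
  proof (rule integral_mono)
    show "integrable lborel (\<lambda>y. w (x - y) * mollifier e y)" by (rule int) (use B in auto)
    show "integrable lborel (\<lambda>y. sph_mean w (x - y) r * mollifier e y)"
      by (rule int[OF _ sph_mean_bounded[OF _ B]]) simp_all
    show "w (x - y) * mollifier e y \<le> sph_mean w (x - y) r * mollifier e y" for y
    proof (cases "norm y < e")
      case True
      then show ?thesis using M[of "x - y"] mollifier_nonneg[OF e, of y]
        by (intro mult_right_mono) (auto simp: dist_norm)
    qed (simp add: mollifier_zero e)
  qed
  also have "\<dots> = sph_mean (conv w (mollifier e)) x r"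
    by (rule sph_mean_conv[OF _ B moll, symmetric]) simp
  finally show ?thesis .
qed

text \<open>Derivatives are unique, so local gradients and Hessians fit together.\<close>

lemma C2_on_local:
  fixes f :: "'a::euclidean_space \<Rightarrow> real"
  assumes "\<And>x. x \<in> U \<Longrightarrow> \<exists>N g h. open N \<and> x \<in> N \<and> C2_on N f g h"
  shows "\<exists>g h. C2_on U f g h"
proof -
  define g where "g x = (SOME y. (f has_derivative (\<lambda>v. y \<bullet> v)) (at x))" for x
  define h where "h x = frechet_derivative g (at x)" for x
  have *: "g x = g' x" if C: "C2_on N f g' h'" and x: "x \<in> N" for N g' h' x
  proof -
    have d: "(f has_derivative (\<lambda>v. g' x \<bullet> v)) (at x)" using C x by (auto simp: C2_on_def)
    then have "(f has_derivative (\<lambda>v. g x \<bullet> v)) (at x)" unfolding g_def by (rule someI)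
    then have "(\<lambda>v. g x \<bullet> v) = (\<lambda>v. g' x \<bullet> v)" by (rule has_derivative_unique) (rule d)
    then have "(g x - g' x) \<bullet> v = 0" for v by (metis inner_diff_left right_minus_eq)
    then have "(g x - g' x) \<bullet> (g x - g' x) = 0" by blast
    then show ?thesis by simp
  qed
  have **: "C2_on N f g h" if C: "C2_on N f g' h'" and N: "open N" for N g' h'
    unfolding C2_on_def
  proof (intro conjI ballI allI)
    have gh: "(g has_derivative h' x) (at x)" if x: "x \<in> N" for x
      by (rule has_derivative_transform_within_open[of g' _ _ _ N])
         (use C N x *[OF C] in \<open>auto simp: C2_on_def\<close>)
    then have hh: "h x = h' x" if "x \<in> N" for x
      unfolding h_def using frechet_derivative_at that by metis
    show "(f has_derivative (\<bullet>) (g x)) (at x)" if "x \<in> N" for x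
      using C *[OF C that] that by (simp add: C2_on_def)
    show "(g has_derivative h x) (at x)" if "x \<in> N" for x using gh hh that by simp
    show "continuous_on N (\<lambda>x. h x v)" for v
      by (rule continuous_on_cong[THEN iffD1, of N N "\<lambda>x. h' x v"]) (use C hh in \<open>auto simp: C2_on_def\<close>)
  qed
  have "C2_on U f g h"
    unfolding C2_on_def
  proof (intro conjI ballI allI)
    fix x assume "x \<in> U"
    from assms[OF this] obtain N g' h' where N: "open N" "x \<in> N" "C2_on N f g' h'" by blast
    from **[OF N(3,1)] N(2)
    show "(f has_derivative (\<bullet>) (g x)) (at x)" "(g has_derivative h x) (at x)"
      by (auto simp: C2_on_def)
  next
    fix v
    have "isCont (\<lambda>x. h x v) x" if xU: "x \<in> U" for x
    proof -
      obtain N g' h' where N: "open N" "x \<in> N" "C2_on N f g' h'" using assms[OF xU] by blast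
      have "continuous_on N (\<lambda>x. h x v)"
        using **[OF N(3,1)] by (simp add: C2_on_def)
      then show ?thesis using N(1,2) continuous_on_eq_continuous_at by blast
    qed
    then show "continuous_on U (\<lambda>x. h x v)" by (auto intro: continuous_at_imp_continuous_on)
  qed
  then show ?thesis by blast
qed

text \<open>Removes the case distinction on the dimension. In dimension one a \<open>C\<^sup>2\<close> function with vanishing Laplacian has constant
gradient on each ball and is therefore affine there.\<close>

lemma harmonic_on_iff_C2:
  fixes u :: "'a::euclidean_space \<Rightarrow> real"
  assumes U: "open U"
  shows "harmonic_on u U \<longleftrightarrow> (\<exists>g h. C2_on U u g h \<and> (\<forall>x\<in>U. laplace h x = 0))"
proof (cases "DIM('a) = 1")
  case False
  show ?thesis
  proof
    assume "harmonic_on u U"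
    then obtain g :: "'a \<Rightarrow> 'a" and H :: "'a \<Rightarrow> 'a \<Rightarrow>\<^sub>L 'a" where
      "\<forall>x\<in>U. (u has_derivative (\<lambda>v. g x \<bullet> v)) (at x)"
      "\<forall>x\<in>U. (g has_derivative blinfun_apply (H x)) (at x)" "continuous_on U H"
      "\<forall>x\<in>U. (\<Sum>b\<in>Basis. blinfun_apply (H x) b \<bullet> b) = 0"
      unfolding harmonic_on_def using False by auto
    then show "\<exists>g h. C2_on U u g h \<and> (\<forall>x\<in>U. laplace h x = 0)"
      by (intro exI[of _ g] exI[of _ "\<lambda>x. blinfun_apply (H x)"])
         (auto simp: C2_on_def laplace_def intro!: continuous_intros)
  next
    assume "\<exists>g h. C2_on U u g h \<and> (\<forall>x\<in>U. laplace h x = 0)"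
    then obtain g h where C: "C2_on U u g h" and L: "\<forall>x\<in>U. laplace h x = 0" by blast
    have H: "blinfun_apply (Blinfun (h x)) = h x" if "x \<in> U" for x
      by (rule bounded_linear_Blinfun_apply) (use C that in \<open>auto simp: C2_on_def dest: has_derivative_bounded_linear\<close>)
    have "continuous_on U (\<lambda>x. Blinfun (h x))"
    proof (rule continuous_on_blinfun_componentwise)
      fix i :: 'a
      have "continuous_on U (\<lambda>x. h x i)" using C by (simp add: C2_on_def)
      then show "continuous_on U (\<lambda>x. blinfun_apply (Blinfun (h x)) i)"
        by (rule continuous_on_cong[THEN iffD1, rotated 2]) (auto simp: H)
    qed
    then show "harmonic_on u U"
      unfolding harmonic_on_def using False C L H
      by (auto simp: C2_on_def laplace_def intro!: exI[of _ g] exI[of _ "\<lambda>x. Blinfun (h x)"])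
  qed
next
  case True
  then obtain b :: 'a where b: "Basis = {b}" by (auto simp: card_1_singleton_iff)
  then have bb: "b \<bullet> b = 1" by (metis inner_same_Basis singletonI)
  have rep: "v = (v \<bullet> b) *\<^sub>R b" for v :: 'a
    using euclidean_representation[of v] unfolding b by simp
  show ?thesis
  proof
    assume "harmonic_on u U"
    then have aff: "\<exists>e>0. ball x e \<subseteq> U \<and> (\<exists>a b. \<forall>y\<in>ball x e. u y = a \<bullet> y + b)" if "x \<in> U" for x
      using that True unfolding harmonic_on_def by simp
    have "\<exists>N g h. open N \<and> x \<in> N \<and> C2_on N u g h" if xU: "x \<in> U" for x
    proof -
      obtain e a c where e: "e > 0" "ball x e \<subseteq> U" "\<forall>y\<in>ball x e. u y = a \<bullet> y + c"
        using aff[OF xU] by blast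
      have "C2_on (ball x e) u (\<lambda>x. a) (\<lambda>x v. 0)"
        unfolding C2_on_def
      proof (intro conjI ballI allI)
        fix y assume y: "y \<in> ball x e"
        show "(u has_derivative (\<bullet>) a) (at y)"
          by (rule has_derivative_transform_within_open[of "\<lambda>y. a \<bullet> y + c" _ _ _ "ball x e"])
             (use e y in \<open>auto intro!: derivative_eq_intros\<close>)
      qed auto
      then show ?thesis using e by (intro exI[of _ "ball x e"]) auto
    qed
    then obtain g h where C: "C2_on U u g h" using C2_on_local by blast
    have "laplace h x = 0" if xU: "x \<in> U" for x
    proof -
      obtain e a c where e: "e > 0" "ball x e \<subseteq> U" "\<forall>y\<in>ball x e. u y = a \<bullet> y + c"
        using aff[OF xU] by blast
      have "C2_on (ball x e) (\<lambda>y. a \<bullet> y + c) (\<lambda>x. a) (\<lambda>x v. 0)"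
        unfolding C2_on_def by (auto intro!: derivative_eq_intros)
      moreover have "C2_on (ball x e) u g h" using C e by (blast intro: C2_on_subset)
      ultimately have "h x = (\<lambda>v. 0)"
        using C2_on_unique(2)[of "ball x e" u g h] e by auto
      then show ?thesis by (simp add: laplace_def)
    qed
    with C show "\<exists>g h. C2_on U u g h \<and> (\<forall>x\<in>U. laplace h x = 0)" by blast
  next
    assume "\<exists>g h. C2_on U u g h \<and> (\<forall>x\<in>U. laplace h x = 0)"
    then obtain g h where C: "C2_on U u g h" and L: "\<forall>x\<in>U. laplace h x = 0" by blast
    have h0: "h x v = 0" if x: "x \<in> U" for x v
    proof -
      have lin: "linear (h x)" using C x by (auto simp: C2_on_def dest: has_derivative_linear)
      have "h x b \<bullet> b = 0" using L[unfolded laplace_def b] x by simp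
      then have "h x b = 0" using rep[of "h x b"] by simp
      then show ?thesis using linear_cmul[OF lin, of "v \<bullet> b" b] rep[of v] by simp
    qed
    show "harmonic_on u U"
      unfolding harmonic_on_def if_P[OF True]
    proof (intro ballI)
      fix x assume "x \<in> U"
      then obtain e where e: "e > 0" "ball x e \<subseteq> U" using U open_contains_ball by blast
      have gc: "g y = g x" if "y \<in> ball x e" for y
      proof -
        have "\<exists>c. \<forall>y\<in>ball x e. g y = c"
        proof (rule has_derivative_zero_constant[OF convex_ball])
          fix z assume "z \<in> ball x e"
          then have z: "z \<in> U" using e by blast
          then have "(g has_derivative h z) (at z)" using C by (simp add: C2_on_def)
          moreover have "h z = (\<lambda>v. 0)" using h0[OF z] by blast
          ultimately show "(g has_derivative (\<lambda>v. 0)) (at z within ball x e)"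
            by (simp add: has_derivative_at_withinI)
        qed
        then show ?thesis using that e by (metis centre_in_ball)
      qed
      have "\<exists>c. \<forall>y\<in>ball x e. u y - g x \<bullet> y = c"
      proof (rule has_derivative_zero_constant[OF convex_ball])
        fix y assume y: "y \<in> ball x e"
        then have "(u has_derivative (\<lambda>v. g y \<bullet> v)) (at y)" using C e by (auto simp: C2_on_def)
        then have "((\<lambda>y. u y - g x \<bullet> y) has_derivative (\<lambda>v. g y \<bullet> v - g x \<bullet> v)) (at y)"
          by (intro derivative_intros)
        then show "((\<lambda>y. u y - g x \<bullet> y) has_derivative (\<lambda>v. 0)) (at y within ball x e)"
          using gc[OF y] by (auto intro: has_derivative_at_withinI)
      qed
      then obtain c where "\<forall>y\<in>ball x e. u y - g x \<bullet> y = c" by blast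
      then have "\<forall>y\<in>ball x e. u y = g x \<bullet> y + c" by force
      then show "\<exists>e>0. ball x e \<subseteq> U \<and> (\<exists>a c. \<forall>y\<in>ball x e. u y = a \<bullet> y + c)"
        using e by blast
    qed
  qed
qed

text \<open>Measurability and boundedness in place of continuity, since the functions to which this is applied are given as
Taylor coefficients. The factor \<open>2\<close> makes spheres of radius below \<open>e\<close> around points of the smaller ball stay inside the larger one.\<close>

definition locally_mean_value :: "('a::euclidean_space \<Rightarrow> real) \<Rightarrow> 'a set \<Rightarrow> bool" where
  "locally_mean_value u U \<longleftrightarrow> (\<forall>x\<in>U. \<exists>e>0. cball x (2 * e) \<subseteq> U \<and>
     (\<lambda>y. indicator (cball x (2 * e)) y * u y) \<in> borel_measurable borel \<and>
     (\<exists>B. \<forall>y\<in>cball x (2 * e). \<bar>u y\<bar> \<le> B) \<and>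
     (\<forall>y\<in>ball x e. \<forall>r. 0 < r \<longrightarrow> r < e \<longrightarrow> sph_mean u y r = u y))"

lemma locally_mean_valueE:
  fixes u :: "'a::euclidean_space \<Rightarrow> real"
  assumes lmv: "locally_mean_value u U" and x: "x \<in> U"
  obtains e B where "e > 0" "cball x (2 * e) \<subseteq> U"
      "(\<lambda>y. indicator (cball x (2 * e)) y * u y) \<in> borel_measurable borel"
      "\<And>y. y \<in> cball x (2 * e) \<Longrightarrow> \<bar>u y\<bar> \<le> B"
      "\<And>y r. y \<in> ball x e \<Longrightarrow> 0 < r \<Longrightarrow> r < e \<Longrightarrow> sph_mean u y r = u y"
proof -
  obtain e where e: "e > 0 \<and> cball x (2 * e) \<subseteq> U \<and>
     (\<lambda>y. indicator (cball x (2 * e)) y * u y) \<in> borel_measurable borel \<and>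
     (\<exists>B. \<forall>y\<in>cball x (2 * e). \<bar>u y\<bar> \<le> B) \<and>
     (\<forall>y\<in>ball x e. \<forall>r. 0 < r \<longrightarrow> r < e \<longrightarrow> sph_mean u y r = u y)"
    using bspec[OF lmv[unfolded locally_mean_value_def] x] by (elim exE) (rule that)
  then obtain B where "\<forall>y\<in>cball x (2 * e). \<bar>u y\<bar> \<le> B" by (elim conjE exE)
  with e show ?thesis by (intro that[of e B]) simp_all
qed

text \<open>A function with the mean value property equals its own radial mollification, so it is \<open>C\<^sup>2\<close>; its Laplacian is then
both nonnegative and nonpositive.\<close>

lemma locally_mean_value_imp_harmonic:
  fixes u :: "'a::euclidean_space \<Rightarrow> real"
  assumes U: "open U" and lmv: "locally_mean_value u U"
  shows "harmonic_on u U"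
proof -
  have "\<exists>N g h. open N \<and> x \<in> N \<and> C2_on N u g h" if xU: "x \<in> U" for x
  proof -
    obtain e B where e: "e > 0" "cball x (2 * e) \<subseteq> U"
      "(\<lambda>y. indicator (cball x (2 * e)) y * u y) \<in> borel_measurable borel"
      and B: "\<And>y. y \<in> cball x (2 * e) \<Longrightarrow> \<bar>u y\<bar> \<le> B"
      and mv: "\<And>y r. y \<in> ball x e \<Longrightarrow> 0 < r \<Longrightarrow> r < e \<Longrightarrow> sph_mean u y r = u y"
      by (rule locally_mean_valueE[OF lmv xU]) (rule that)
    define w where "w y = indicator (cball x (2 * e)) y * u y" for y
    have wm [measurable]: "w \<in> borel_measurable borel" using e(3) by (simp add: w_def[abs_def])
    have "0 \<le> B" using B[of x] e by force
    then have wB: "\<bar>w y\<bar> \<le> B" for y using B[of y] by (auto simp: w_def indicator_def)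
    have "integrable lborel w"
      by (rule Bochner_Integration.integrable_bound[OF integrable_mult_right[OF integrable_indicator_cball[of x "2 * e"], of B]])
         (use B in \<open>auto simp: w_def indicator_def intro!: AE_I2 order_trans[OF _ abs_ge_self]\<close>)
    from C2_on_conv_mollifier[OF this e(1)]
    obtain g h where C: "C2_on UNIV (conv w (mollifier e)) g h" by blast
    have eq: "conv w (mollifier e) y = u y" if y: "y \<in> ball x e" for y
    proof -
      have sm: "sph_mean w y r = u y" if "0 < r" "r < e" for r
      proof -
        have "cball y r \<subseteq> cball x (2 * e)"
          using y that by (intro cball_subset_cball_iff[THEN iffD2]) (auto simp: dist_commute)
        then have "sph_mean w y r = sph_mean u y r"
          using that by (intro sph_mean_cong) (auto simp: w_def)
        then show ?thesis using mv[OF y that] by simp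
      qed
      have "u y \<le> conv w (mollifier e) y"
        by (rule conv_mollifier_ge[OF wm wB e(1)]) (simp add: sm)
      moreover have "- u y \<le> conv (\<lambda>y. - w y) (mollifier e) y"
        by (rule conv_mollifier_ge[of _ B]) (use wB e(1) sm in \<open>auto simp: sph_mean_uminus\<close>)
      moreover have "conv (\<lambda>y. - w y) (mollifier e) y = - conv w (mollifier e) y"
        by (simp add: conv_def)
      ultimately show ?thesis by simp
    qed
    have "C2_on (ball x e) u g h"
      unfolding C2_on_def
    proof (intro conjI ballI allI)
      fix y assume y: "y \<in> ball x e"
      show "(u has_derivative (\<bullet>) (g y)) (at y)"
        by (rule has_derivative_transform_within_open[of "conv w (mollifier e)" _ _ _ "ball x e"])
           (use C y eq in \<open>auto simp: C2_on_def\<close>)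
    qed (use C in \<open>auto simp: C2_on_def intro: continuous_on_subset\<close>)
    then show ?thesis using e by (intro exI[of _ "ball x e"]) auto
  qed
  then obtain g h where C: "C2_on U u g h" using C2_on_local by blast
  have "laplace h x = 0" if x: "x \<in> U" for x
  proof -
    obtain e where e: "e > 0" 
      and mv: "\<And>y r. y \<in> ball x e \<Longrightarrow> 0 < r \<Longrightarrow> r < e \<Longrightarrow> sph_mean u y r = u y"
      by (rule locally_mean_valueE[OF lmv x]) (rule that)
    have "0 \<le> laplace h x"
      by (rule laplace_nonneg_of_sph_mean[OF C U x e]) (use mv e in auto)
    moreover have "0 \<le> laplace (\<lambda>x v. - 1 *\<^sub>R h x v) x"
    proof (rule laplace_nonneg_of_sph_mean[OF C2_on_cmult[OF C] U x e])
      show "- 1 * u x \<le> sph_mean (\<lambda>x. - 1 * u x) x r" if "0 < r" "r < e" for r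
        unfolding sph_mean_cmult using mv[of x r] that e by simp
    qed
    ultimately show ?thesis unfolding laplace_cmult by simp
  qed
  with C show ?thesis using harmonic_on_iff_C2[OF U] by blast
qed

section \<open>The regularised kernel and Green's representation formula\<close>

text \<open>The kernel with \<open>|x|\<close> replaced by \<open>sqrt (|x|\<^sup>2 + e)\<close>. It is smooth and subharmonic for \<open>e > 0\<close> and decreases to the kernel as
\<open>e\<close> tends to \<open>0\<close>; for \<open>e = 0\<close> it is the kernel away from its pole.\<close>

definition smooth_kernel :: "real \<Rightarrow> 'a::euclidean_space \<Rightarrow> real" where
  "smooth_kernel e x = radial_kernel TYPE('a) (sqrt ((norm x)\<^sup>2 + e))"

lemma C2_on_smooth_kernel:
  fixes e :: real
  defines "R \<equiv> \<lambda>x::'a::euclidean_space. sqrt ((norm x)\<^sup>2 + e)"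
  shows "C2_on {x::'a. 0 < (norm x)\<^sup>2 + e} (smooth_kernel e) (\<lambda>x. (kernel_slope TYPE('a) / R x ^ DIM('a)) *\<^sub>R x)
     (\<lambda>x v. (kernel_slope TYPE('a) / R x ^ DIM('a)) *\<^sub>R v + (- (kernel_slope TYPE('a) * DIM('a)) / R x ^ (DIM('a) + 2) * (x \<bullet> v)) *\<^sub>R x)"
  unfolding C2_on_def
proof (intro conjI ballI allI)
  fix x :: 'a assume "x \<in> {x. 0 < (norm x)\<^sup>2 + e}"
  then have pos: "0 < (norm x)\<^sup>2 + e" by simp
  then have R: "0 < R x" by (simp add: R_def)
  have "((\<lambda>x::'a. (norm x)\<^sup>2 + e) has_derivative (\<lambda>v. 2 * (x \<bullet> v))) (at x)"
    unfolding power2_norm_eq_inner by (auto intro!: derivative_eq_intros simp: inner_commute)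
  moreover have "(sqrt has_derivative (*) (inverse (sqrt ((norm x)\<^sup>2 + e)) / 2)) (at ((norm x)\<^sup>2 + e))"
    using DERIV_real_sqrt[OF pos] by (simp add: has_field_derivative_def)
  ultimately have dR: "(R has_derivative (\<lambda>v. (x \<bullet> v) / R x)) (at x)"
    unfolding R_def by (rule has_derivative_compose[THEN has_derivative_eq_rhs]) (simp add: field_simps)
  have "(radial_kernel TYPE('a) has_derivative (*) (kernel_slope TYPE('a) / R x ^ (DIM('a) - 1))) (at (R x))"
    using radial_kernel_deriv[OF R] by (simp add: has_field_derivative_def)
  from has_derivative_compose[OF dR this]
  have "(smooth_kernel e has_derivative (\<lambda>v. kernel_slope TYPE('a) / R x ^ (DIM('a) - 1) * ((x \<bullet> v) / R x))) (at x)"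
    unfolding smooth_kernel_def[abs_def] R_def .
  moreover have "(\<lambda>v. kernel_slope TYPE('a) / R x ^ (DIM('a) - 1) * ((x \<bullet> v) / R x)) = (\<bullet>) ((kernel_slope TYPE('a) / R x ^ DIM('a)) *\<^sub>R x)"
    using DIM_positive[where 'a='a] by (cases "DIM('a)") (auto simp: mult.commute fun_eq_iff)
  ultimately show "(smooth_kernel e has_derivative (\<bullet>) ((kernel_slope TYPE('a) / R x ^ DIM('a)) *\<^sub>R x)) (at x)"
    by (simp only:)
  have "((\<lambda>t. kernel_slope TYPE('a) / t ^ DIM('a)) has_real_derivative - (kernel_slope TYPE('a) * DIM('a)) / R x ^ (DIM('a) + 1)) (at (R x))"
  proof -
    have "R x ^ (DIM('a) - 1) * R x ^ (DIM('a) + 1) = R x ^ DIM('a) * R x ^ DIM('a)"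
      using DIM_positive[where 'a='a] by (simp only: power_add[symmetric]) simp
    then have E: "kernel_slope TYPE('a) * - (real DIM('a) * R x ^ (DIM('a) - Suc 0) * inverse ((R x ^ DIM('a)) ^ Suc (Suc 0)))
        = - (kernel_slope TYPE('a) * DIM('a)) / R x ^ (DIM('a) + 1)"
      using R by (simp add: field_simps)
    have "R x ^ DIM('a) \<noteq> 0" using R by simp
    from DERIV_cmult[OF DERIV_inverse_fun[OF DERIV_pow this], of "kernel_slope TYPE('a)"]
    show ?thesis unfolding divide_inverse by (rule DERIV_cong) (rule E[unfolded divide_inverse])
  qed
  then have "((\<lambda>t. kernel_slope TYPE('a) / t ^ DIM('a)) has_derivative (*) (- (kernel_slope TYPE('a) * DIM('a)) / R x ^ (DIM('a) + 1))) (at (R x))"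
    by (simp add: has_field_derivative_def)
  from has_derivative_compose[OF dR this]
  have "((\<lambda>x. kernel_slope TYPE('a) / R x ^ DIM('a)) has_derivative
      (\<lambda>v. - (kernel_slope TYPE('a) * DIM('a)) / R x ^ (DIM('a) + 1) * ((x \<bullet> v) / R x))) (at x)" .
  from has_derivative_scaleR[OF this has_derivative_ident]
  show "((\<lambda>x. (kernel_slope TYPE('a) / R x ^ DIM('a)) *\<^sub>R x) has_derivative
      (\<lambda>v. (kernel_slope TYPE('a) / R x ^ DIM('a)) *\<^sub>R v + (- (kernel_slope TYPE('a) * DIM('a)) / R x ^ (DIM('a) + 2) * (x \<bullet> v)) *\<^sub>R x)) (at x)"
    by (simp add: mult_ac)
next
  fix v :: 'a
  have "continuous_on {x::'a. 0 < (norm x)\<^sup>2 + e} R" unfolding R_def by (intro continuous_intros)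
  then show "continuous_on {x::'a. 0 < (norm x)\<^sup>2 + e} (\<lambda>x. (kernel_slope TYPE('a) / R x ^ DIM('a)) *\<^sub>R v + (- (kernel_slope TYPE('a) * DIM('a)) / R x ^ (DIM('a) + 2) * (x \<bullet> v)) *\<^sub>R x)"
    by (intro continuous_intros) (auto simp: R_def)
qed

text \<open>With \<open>R = sqrt (|x|\<^sup>2 + e)\<close> the Laplacian is \<open>kernel_slope * d e / R\<^bsup>d+2\<^esup>\<close>.\<close>

lemma smooth_kernel_harmonicity:
  assumes e: "0 \<le> e"
  obtains g h where "C2_on {x::'a::euclidean_space. 0 < (norm x)\<^sup>2 + e} (smooth_kernel e) g h"
    "\<And>x. 0 < (norm x)\<^sup>2 + e \<Longrightarrow> 0 \<le> laplace h x"
    "e = 0 \<Longrightarrow> (\<And>x. x \<noteq> 0 \<Longrightarrow> laplace h x = 0)"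
proof -
  define R where "R = (\<lambda>x::'a::euclidean_space. sqrt ((norm x)\<^sup>2 + e))"
  define h where "h = (\<lambda>x v. (kernel_slope TYPE('a) / R x ^ DIM('a)) *\<^sub>R v + (- (kernel_slope TYPE('a) * DIM('a)) / R x ^ (DIM('a) + 2) * (x \<bullet> v)) *\<^sub>R (x::'a))"
  have L: "laplace h x = kernel_slope TYPE('a) * DIM('a) * e / R x ^ (DIM('a) + 2)" if "0 < (norm x)\<^sup>2 + e" for x
  proof -
    have R: "0 < R x" "R x * R x = (norm x)\<^sup>2 + e" using that by (auto simp: R_def)
    have "laplace h x = (\<Sum>b\<in>Basis. kernel_slope TYPE('a) / R x ^ DIM('a) - kernel_slope TYPE('a) * DIM('a) / R x ^ (DIM('a) + 2) * ((x \<bullet> b) * (x \<bullet> b)))"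
      unfolding laplace_def h_def by (intro sum.cong refl) (simp add: inner_add_left inner_same_Basis algebra_simps)
    also have "\<dots> = DIM('a) * (kernel_slope TYPE('a) / R x ^ DIM('a)) - kernel_slope TYPE('a) * DIM('a) / R x ^ (DIM('a) + 2) * (x \<bullet> x)"
      by (subst euclidean_inner[of x x]) (simp add: sum_subtractf sum_distrib_left)
    also have "\<dots> = kernel_slope TYPE('a) * DIM('a) * (R x * R x - x \<bullet> x) / R x ^ (DIM('a) + 2)"
      using R(1) by (simp add: field_simps)
    also have "R x * R x - x \<bullet> x = e" using R(2) by (simp add: power2_norm_eq_inner)
    finally show ?thesis .
  qed
  have C: "C2_on {x::'a. 0 < (norm x)\<^sup>2 + e} (smooth_kernel e) (\<lambda>x. (kernel_slope TYPE('a) / R x ^ DIM('a)) *\<^sub>R x) h"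
    unfolding h_def R_def by (rule C2_on_smooth_kernel)
  show ?thesis
  proof (rule that[OF C])
    fix x :: 'a assume x: "0 < (norm x)\<^sup>2 + e"
    then have "0 < R x" by (simp add: R_def)
    then show "0 \<le> laplace h x"
      unfolding L[OF x] using e kernel_slope_pos[where 'a='a]
      by (intro divide_nonneg_nonneg mult_nonneg_nonneg) auto
  next
    fix x :: 'a assume "e = 0" "x \<noteq> 0"
    then show "laplace h x = 0" by (subst L) auto
  qed
qed

lemma open_smooth_kernel_domain: "open {x::'a::euclidean_space. 0 < (norm x)\<^sup>2 + e}"
  by (intro open_Collect_less continuous_intros)

lemma smooth_kernel_0: "smooth_kernel 0 x = radial_kernel TYPE('a) (norm (x::'a::euclidean_space))"
  by (simp add: smooth_kernel_def)

lemma sph_mean_kernel_off_pole: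
  fixes y :: "'a::euclidean_space"
  assumes "0 \<notin> cball y r" "0 < r"
  shows "sph_mean (\<lambda>x. radial_kernel TYPE('a) (norm x)) y r = radial_kernel TYPE('a) (norm y)"
proof -
  obtain g h where C: "C2_on {x::'a. 0 < (norm x)\<^sup>2 + 0} (smooth_kernel 0) g h" and L: "\<And>x. x \<noteq> 0 \<Longrightarrow> laplace h x = 0"
    using smooth_kernel_harmonicity[of 0, where 'a='a] by (metis order_refl)
  have "cball y r \<subseteq> {x::'a. 0 < (norm x)\<^sup>2 + 0}" using assms by auto
  from sph_mean_harmonic[OF C open_smooth_kernel_domain this assms(2)] L assms
  have "sph_mean (smooth_kernel 0) y r = smooth_kernel 0 y" by (metis ball_subset_cball subsetD)
  then show ?thesis by (simp add: smooth_kernel_0[abs_def])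
qed

lemma sph_mean_smooth_kernel:
  fixes y :: "'a::euclidean_space"
  assumes "0 < e" "0 < r"
  shows "smooth_kernel e y \<le> sph_mean (smooth_kernel e) y r"
proof -
  obtain g h where C: "C2_on {x::'a. 0 < (norm x)\<^sup>2 + e} (smooth_kernel e) g h" and L: "\<And>x. 0 < (norm x)\<^sup>2 + e \<Longrightarrow> 0 \<le> laplace h x"
    using smooth_kernel_harmonicity[of e, where 'a='a] assms by (metis less_imp_le)
  have "{x::'a. 0 < (norm x)\<^sup>2 + e} = UNIV" using assms(1) by (auto intro: add_nonneg_pos)
  with C L show ?thesis by (intro sph_mean_ge(1)[of UNIV _ g h]) (use assms in auto)
qed

text \<open>The weight \<open>r\<^bsup>d-1\<^esup>\<close> of polar coordinates beats the singularity at \<open>0\<close>: the product is \<open>r\<close>, or \<open>r |ln r|\<close> in dimension two.\<close>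

lemma radial_kernel_bound:
  assumes r: "0 < r"
  shows "r ^ (DIM('a) - 1) * \<bar>radial_kernel TYPE('a::euclidean_space) r\<bar> \<le> 1 + r\<^sup>2"
proof (cases "DIM('a) = 2")
  case True
  have "r * \<bar>ln r\<bar> \<le> 1 + r\<^sup>2"
  proof (cases "1 \<le> r")
    case True
    have "ln r \<le> r" using ln_le_minus_one[OF r] by simp
    then have "r * \<bar>ln r\<bar> \<le> r * r" using True by (intro mult_left_mono) auto
    then show ?thesis by (simp add: power2_eq_square)
  next
    case False
    have "ln (1 / r) \<le> 1 / r" using ln_le_minus_one[of "1 / r"] r by simp
    then have "r * \<bar>ln r\<bar> \<le> r * (1 / r)"
      using False r by (intro mult_left_mono) (auto simp: ln_div abs_if)
    then show ?thesis using r by (simp add: add_increasing2)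
  qed
  then show ?thesis using True by (simp add: radial_kernel_def kfun_def)
next
  case False
  then have s: "real DIM('a) - 2 \<noteq> 0" by linarith
  have "\<bar>radial_kernel TYPE('a) r\<bar> = r powr (- (real DIM('a) - 2))"
    using s r by (auto simp: radial_kernel_def kfun_def abs_mult sgn_if)
  moreover have "r ^ (DIM('a) - 1) = r powr (real DIM('a) - 1)"
    using r DIM_positive[where 'a='a] by (simp add: powr_realpow[symmetric] of_nat_diff)
  ultimately have "r ^ (DIM('a) - 1) * \<bar>radial_kernel TYPE('a) r\<bar> = r"
    using r by (simp add: powr_add[symmetric])
  also have "r \<le> 1 + r\<^sup>2"
    using sum_squares_ge_zero[of "r - 1" 0] r by (simp add: power2_eq_square algebra_simps)
  finally show ?thesis .
qed

lemma kernel_locally_integrable: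
  "integrable lborel (\<lambda>x::'a::euclidean_space. indicator (cball 0 R) x * radial_kernel TYPE('a) (norm x))"
proof -
  define c where "c = unit_ball_vol DIM('a) * DIM('a)"
  have c: "0 \<le> c" by (simp add: c_def)
  have dom: "integrable (unif_ball \<Otimes>\<^sub>M lborel) (\<lambda>p :: 'a \<times> real. c * (1 + R\<^sup>2) * indicator {0..R} (snd p))"
  proof (intro integrable_mult_right integrableI_bounded)
    have "(\<integral>\<^sup>+p. ennreal (norm (indicator {0..R} (snd p) :: real)) \<partial>(unif_ball \<Otimes>\<^sub>M lborel :: ('a \<times> real) measure))
        = (\<integral>\<^sup>+y. indicator {0..R} y \<partial>lborel)"
      by (subst lborel.nn_integral_fst[symmetric]) (simp_all add: emeasure_unif_ball_UNIV ennreal_indicator)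
    also have "\<dots> < \<infinity>" by (simp add: emeasure_lborel_Icc_eq)
    finally show "(\<integral>\<^sup>+p. ennreal (norm (indicator {0..R} (snd p) :: real)) \<partial>(unif_ball \<Otimes>\<^sub>M lborel :: ('a \<times> real) measure)) < \<infinity>" .
  qed simp
  have Fm: "(\<lambda>w::'a. indicator (cball 0 R) w * radial_kernel TYPE('a) (norm w)) \<in> borel_measurable borel"
    by (intro borel_measurable_times borel_measurable_indicator measurable_compose[OF _ borel_measurable_radial_kernel]) simp_all
  have "integrable (unif_ball \<Otimes>\<^sub>M lborel)
     (\<lambda>x. polar_density TYPE('a) (snd x) * (indicator (cball 0 R) (snd x *\<^sub>R sgn (fst x)) * radial_kernel TYPE('a) (norm (snd x *\<^sub>R sgn (fst x :: 'a)))))"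
  proof (rule Bochner_Integration.integrable_bound[OF dom])
    have "AE x in (unif_ball \<Otimes>\<^sub>M lborel :: ('a \<times> real) measure). fst x \<noteq> 0"
    proof -
      interpret pair_sigma_finite "unif_ball :: 'a measure" "lborel :: real measure" ..
      have "fst -` (- {0}) \<inter> space (unif_ball \<Otimes>\<^sub>M lborel) \<in> sets (unif_ball \<Otimes>\<^sub>M lborel :: ('a \<times> real) measure)"
        by (rule measurable_sets[OF measurable_fst]) simp
      moreover have "fst -` (- {0}) \<inter> space (unif_ball \<Otimes>\<^sub>M lborel) = {x \<in> space (unif_ball \<Otimes>\<^sub>M lborel :: ('a \<times> real) measure). fst x \<noteq> 0}"
        by auto
      moreover have "AE x in unif_ball. AE y in (lborel :: real measure). fst (x, y) \<noteq> (0::'a)"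
        using AE_unif_ball_nonzero[where 'a='a] by eventually_elim simp
      ultimately show ?thesis by (intro AE_pair_measure) simp_all
    qed
    then show "AE x in unif_ball \<Otimes>\<^sub>M lborel. norm (polar_density TYPE('a) (snd x) * (indicator (cball 0 R) (snd x *\<^sub>R sgn (fst x)) * radial_kernel TYPE('a) (norm (snd x *\<^sub>R sgn (fst x :: 'a)))))
       \<le> norm (c * (1 + R\<^sup>2) * indicator {0..R} (snd x))"
    proof eventually_elim
      case (elim x)
      define r where "r = snd x"
      have nr: "norm (r *\<^sub>R sgn (fst x)) = \<bar>r\<bar>" using elim by (simp add: norm_sgn)
      show ?case
      proof (cases "0 < r \<and> r \<le> R")
        case True
        have "r\<^sup>2 \<le> R\<^sup>2" using True by (intro power_mono) auto
        then have "r ^ (DIM('a) - 1) * \<bar>radial_kernel TYPE('a) r\<bar> \<le> 1 + R\<^sup>2"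
          using radial_kernel_bound[of r, where 'a='a] True by linarith
        then have "c * (r ^ (DIM('a) - 1) * \<bar>radial_kernel TYPE('a) r\<bar>) \<le> c * (1 + R\<^sup>2)"
          using c by (rule mult_left_mono)
        moreover have "0 \<le> c * (1 + R\<^sup>2)" using c by simp
        ultimately show ?thesis
          using True nr c unfolding r_def[symmetric]
          by (simp add: polar_density_def c_def[symmetric] abs_mult mult.assoc)
      next
        case False
        then have eq: "polar_density TYPE('a) r * (indicator (cball 0 R) (r *\<^sub>R sgn (fst x)) * radial_kernel TYPE('a) (norm (r *\<^sub>R sgn (fst x)))) = 0"
          using nr by (cases "0 < r") (auto simp: polar_density_def)
        show ?thesis unfolding r_def[symmetric] eq by simp
      qed
    qed
  next
    show "(\<lambda>x. polar_density TYPE('a) (snd x) * (indicator (cball 0 R) (snd x *\<^sub>R sgn (fst x)) * radial_kernel TYPE('a) (norm (snd x *\<^sub>R sgn (fst x :: 'a)))))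
       \<in> borel_measurable (unif_ball \<Otimes>\<^sub>M lborel)"
      by (rule borel_measurable_times[OF _ measurable_compose[OF _ Fm]]) measurable
  qed
  then show ?thesis using polar_integrable[OF Fm] by blast
qed

definition kernel_bound :: "'a::euclidean_space itself \<Rightarrow> real \<Rightarrow> real" where
  "kernel_bound _ R = (\<integral>x. norm (indicator (cball 0 R) x * radial_kernel TYPE('a) (norm x)) \<partial>(lborel :: 'a measure))"

text \<open>The bound is uniform in \<open>y\<close>, as Fubini's theorem for potentials requires.\<close>

lemma kernel_product_bound:
  fixes L :: "'a::euclidean_space \<Rightarrow> real"
  assumes [measurable]: "L \<in> borel_measurable borel" and B: "\<And>x. \<bar>L x\<bar> \<le> B" and supp: "\<And>x. R < norm x \<Longrightarrow> L x = 0"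
    and y: "norm y \<le> T"
  shows "integrable lborel (\<lambda>x. radial_kernel TYPE('a) (norm (x - y)) * L x)"
    and "(\<integral>x. norm (radial_kernel TYPE('a) (norm (x - y)) * L x) \<partial>lborel) \<le> B * kernel_bound TYPE('a) (R + T)"
proof -
  define w where "w x = indicator (cball 0 (R + T)) x * radial_kernel TYPE('a) (norm x)" for x :: 'a
  have w: "integrable lborel w" unfolding w_def by (rule kernel_locally_integrable)
  have [measurable]: "w \<in> borel_measurable borel" using w by simp
  have iw: "integrable lborel (\<lambda>x. w (x - y))"
    using integrable_lborel_plus[OF w, of "- y"] by simp
  have B0: "0 \<le> B" using B[of 0] by simp
  have le: "norm (radial_kernel TYPE('a) (norm (x - y)) * L x) \<le> B * norm (w (x - y))" for x
  proof (cases "R < norm x")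
    case True
    then show ?thesis using supp B0 by simp
  next
    case False
    then have "norm (x - y) \<le> R + T" using norm_triangle_ineq4[of x y] y by simp
    then have "w (x - y) = radial_kernel TYPE('a) (norm (x - y))" by (simp add: w_def)
    then show ?thesis using B[of x] by (simp add: abs_mult mult.commute[of B] mult_left_mono)
  qed
  show int: "integrable lborel (\<lambda>x. radial_kernel TYPE('a) (norm (x - y)) * L x)"
    by (rule Bochner_Integration.integrable_bound[of _ "\<lambda>x. B * norm (w (x - y))"])
       (use iw le B0 in auto)
  have "(\<integral>x. norm (radial_kernel TYPE('a) (norm (x - y)) * L x) \<partial>lborel) \<le> (\<integral>x. B * norm (w (x - y)) \<partial>lborel)"
    by (rule integral_mono) (use int iw le in auto)
  also have "\<dots> = B * (\<integral>x. norm (w (- y + x)) \<partial>lborel)" by simp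
  also have "(\<integral>x. norm (w (- y + x)) \<partial>lborel) = (\<integral>x. norm (w x) \<partial>lborel)"
    by (rule integral_lborel_plus) simp
  finally show "(\<integral>x. norm (radial_kernel TYPE('a) (norm (x - y)) * L x) \<partial>lborel) \<le> B * kernel_bound TYPE('a) (R + T)"
    by (simp add: w_def kernel_bound_def)
qed

text \<open>The limit \<open>e \<longlonglongrightarrow> 0\<close> in Newton's formula; local integrability of the kernel provides the domination.\<close>

theorem greens_representation:
  fixes f :: "'a::euclidean_space \<Rightarrow> real"
  assumes C: "C2_on UNIV f g h" and supp: "\<And>x. R < norm x \<Longrightarrow> f x = 0"
  shows "(\<integral>x. radial_kernel TYPE('a) (norm (x - y)) * laplace h x \<partial>lborel) = newton_const TYPE('a) * f y"
proof -
  note cont = C2_on_continuous[OF C]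
  have L0: "laplace h x = 0" if "R < norm x" for x
    using C2_on_zero_outside(2)[OF C, of "cball 0 R" x] supp that by (auto simp: laplace_def)
  have [measurable]: "laplace h \<in> borel_measurable borel" using cont(4) by (rule borel_measurable_continuous_onI)
  obtain B where B: "\<And>x. norm (laplace h x) \<le> B" using continuous_compact_support_bounded[OF cont(4) L0] by blast
  define s where "s n = 1 / (real n + 1)" for n :: nat
  have s: "0 < s n" "s n \<le> 1" for n by (auto simp: s_def)
  have s0: "s \<longlonglongrightarrow> 0" unfolding s_def by real_asymp
  define k where "k e x = radial_kernel TYPE('a) (max (norm (x - y)) e) * laplace h x" for e x
  define w where "w x = norm (radial_kernel TYPE('a) (norm (x - y)) * laplace h x) + norm (k 1 x)" for x
  have w: "integrable lborel w"
    unfolding w_def k_def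
  proof (intro Bochner_Integration.integrable_add integrable_norm)
    show "integrable lborel (\<lambda>x. radial_kernel TYPE('a) (norm (x - y)) * laplace h x)"
      by (rule kernel_product_bound(1)[OF _ _ L0 order_refl]) (use B in auto)
    show "integrable lborel (\<lambda>x. radial_kernel TYPE('a) (max (norm (x - y)) 1) * laplace h x)"
      by (rule greens_first_identity(1)[OF C supp]) simp_all
  qed
  have lim: "AE x in lborel. (\<lambda>n. k (s n) x) \<longlonglongrightarrow> radial_kernel TYPE('a) (norm (x - y)) * laplace h x"
    using AE_lborel_singleton[of y]
  proof eventually_elim
    case (elim x)
    then have "eventually (\<lambda>n. s n < norm (x - y)) sequentially"
      using order_tendstoD(2)[OF s0, of "norm (x - y)"] by simp
    then have "eventually (\<lambda>n. k (s n) x = radial_kernel TYPE('a) (norm (x - y)) * laplace h x) sequentially"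
      by eventually_elim (simp add: k_def max_def)
    then show ?case by (rule tendsto_eventually)
  qed
  have kw: "AE x in lborel. norm (k (s n) x) \<le> w x" for n
    using AE_lborel_singleton[of y]
  proof eventually_elim
    case (elim x)
    \<comment> \<open>Monotonicity squeezes the truncated kernel between the kernel itself and its truncation at radius \<open>1\<close>.\<close>
    have "radial_kernel TYPE('a) (norm (x - y)) \<le> radial_kernel TYPE('a) (max (norm (x - y)) (s n))"
      "radial_kernel TYPE('a) (max (norm (x - y)) (s n)) \<le> radial_kernel TYPE('a) (max (norm (x - y)) 1)"
      using elim s[of n] by (auto intro!: radial_kernel_mono)
    then have "\<bar>radial_kernel TYPE('a) (max (norm (x - y)) (s n))\<bar> \<le> \<bar>radial_kernel TYPE('a) (norm (x - y))\<bar> + \<bar>radial_kernel TYPE('a) (max (norm (x - y)) 1)\<bar>"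
      by linarith
    then have "\<bar>radial_kernel TYPE('a) (max (norm (x - y)) (s n))\<bar> * \<bar>laplace h x\<bar> \<le> (\<bar>radial_kernel TYPE('a) (norm (x - y))\<bar> + \<bar>radial_kernel TYPE('a) (max (norm (x - y)) 1)\<bar>) * \<bar>laplace h x\<bar>"
      by (rule mult_right_mono) simp
    then show ?case by (simp add: k_def w_def abs_mult distrib_right)
  qed
  have "(\<lambda>n. \<integral>x. k (s n) x \<partial>lborel) \<longlonglongrightarrow> (\<integral>x. radial_kernel TYPE('a) (norm (x - y)) * laplace h x \<partial>lborel)"
    by (rule integral_dominated_convergence[OF _ _ w lim kw]) (simp_all add: k_def)
  moreover have "(\<integral>x. k (s n) x \<partial>lborel) = newton_const TYPE('a) * sph_mean f y (s n)" for n
    unfolding k_def by (rule newton_sph_mean[OF C supp s(1)])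
  moreover have "(\<lambda>n. sph_mean f y (s n)) \<longlonglongrightarrow> f y"
  proof (rule LIMSEQ_I)
    fix r :: real assume "0 < r"
    then obtain d where d: "0 < d" "\<And>q. 0 \<le> q \<Longrightarrow> q < d \<Longrightarrow> \<bar>sph_mean f y q - f y\<bar> \<le> r / 2"
      using sph_mean_approx[OF cont(1) supp half_gt_zero[OF \<open>0 < r\<close>]] by blast
    then have "eventually (\<lambda>n. s n < d) sequentially" using order_tendstoD(2)[OF s0] by simp
    then have "eventually (\<lambda>n. norm (sph_mean f y (s n) - f y) < r) sequentially"
    proof eventually_elim
      case (elim n)
      then show ?case using d(2)[of "s n"] s(1)[of n] \<open>0 < r\<close> by simp
    qed
    then show "\<exists>no. \<forall>n\<ge>no. norm (sph_mean f y (s n) - f y) < r" by (simp add: eventually_sequentially)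
  qed
  ultimately have "(\<lambda>n. newton_const TYPE('a) * sph_mean f y (s n)) \<longlonglongrightarrow> (\<integral>x. radial_kernel TYPE('a) (norm (x - y)) * laplace h x \<partial>lborel)"
    "(\<lambda>n. newton_const TYPE('a) * sph_mean f y (s n)) \<longlonglongrightarrow> newton_const TYPE('a) * f y"
    by (simp_all add: tendsto_mult_left)
  then show ?thesis by (rule LIMSEQ_unique)
qed

section \<open>Potentials of compactly supported measures\<close>

text \<open>What the proof uses of a measure in \<open>Meas_cmp\<close>. The measure keeps its own space; its sets enter only through measurability of the
inclusion.\<close>

locale concentrated_measure = finite_measure M for M :: "'a::euclidean_space measure" +
  fixes K :: "'a set"
  assumes id_measurable: "(\<lambda>x. x) \<in> measurable M borel"
    and compact_K: "compact K"
    and AE_K: "AE x in M. x \<in> K"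
begin

lemma borel_measurable_M: "f \<in> borel_measurable borel \<Longrightarrow> f \<in> borel_measurable M"
  using measurable_compose[OF id_measurable] by blast

lemma integrable_bounded:
  fixes f :: "'a \<Rightarrow> real"
  assumes "f \<in> borel_measurable borel" "\<And>x. x \<in> K \<Longrightarrow> \<bar>f x\<bar> \<le> B"
  shows "integrable M f"
  by (rule integrable_const_bound[of _ B])
     (use AE_K assms borel_measurable_M in \<open>auto elim!: eventually_mono\<close>)

end

text \<open>The complement of the support is a union of open null sets, and countably many of them suffice by the Lindelof property.\<close>

lemma Meas_cmp_concentrated:
  fixes \<Omega> :: "'a::euclidean_space set"
  assumes M: "M \<in> Meas_cmp \<Omega>"
  shows "concentrated_measure M (measure_support M)" "measure_support M \<subseteq> \<Omega>"
proof -
  have sM: "sets M = sets (restrict_space borel \<Omega>)" and cM: "compact (measure_support M)"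
    and fin: "\<And>C. compact C \<Longrightarrow> C \<subseteq> \<Omega> \<Longrightarrow> emeasure M C < \<infinity>"
    using M by (auto simp: Meas_cmp_def)
  have sp: "space M = \<Omega>" using sets_eq_imp_space_eq[OF sM] by (simp add: space_restrict_space)
  have inM: "A \<inter> \<Omega> \<in> sets M" if "A \<in> sets borel" for A
    unfolding sM sets_restrict_space using that by (auto simp: Int_commute)
  define S where "S = measure_support M"
  have S: "S \<subseteq> \<Omega>" by (auto simp: S_def measure_support_def sp)
  then show "measure_support M \<subseteq> \<Omega>" by (simp add: S_def)
  define F where "F = {U. open U \<and> emeasure M (U \<inter> \<Omega>) = 0}"
  obtain F' where F': "F' \<subseteq> F" "countable F'" "\<Union>F' = \<Union>F"
    using Lindelof[of F] by (auto simp: F_def)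
  have cover: "\<Omega> - S = (\<Union>U\<in>F'. U \<inter> \<Omega>)"
  proof
    show "(\<Union>U\<in>F'. U \<inter> \<Omega>) \<subseteq> \<Omega> - S"
    proof
      fix x assume "x \<in> (\<Union>U\<in>F'. U \<inter> \<Omega>)"
      then obtain U where U: "U \<in> F'" "x \<in> U" "x \<in> \<Omega>" by blast
      then have "open U" "emeasure M (U \<inter> \<Omega>) = 0" using F'(1) by (auto simp: F_def)
      then have "x \<notin> S" using U unfolding S_def measure_support_def sp by (metis (mono_tags, lifting) less_irrefl mem_Collect_eq)
      then show "x \<in> \<Omega> - S" using U by blast
    qed
    show "\<Omega> - S \<subseteq> (\<Union>U\<in>F'. U \<inter> \<Omega>)"
    proof
      fix x assume x: "x \<in> \<Omega> - S"
      then obtain U where "open U" "x \<in> U" "emeasure M (U \<inter> \<Omega>) = 0"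
        by (auto simp: S_def measure_support_def sp zero_less_iff_neq_zero)
      then have "x \<in> \<Union>F'" unfolding F'(3) by (auto simp: F_def)
      then show "x \<in> (\<Union>U\<in>F'. U \<inter> \<Omega>)" using x by blast
    qed
  qed
  have null: "\<Omega> - S \<in> null_sets M"
    unfolding cover
  proof (rule null_sets_UN'[OF F'(2)])
    fix U assume "U \<in> F'"
    then have "open U" "emeasure M (U \<inter> \<Omega>) = 0" using F' by (auto simp: F_def)
    then show "U \<inter> \<Omega> \<in> null_sets M" using inM by auto
  qed
  have SM: "S \<in> sets M"
    using inM[of S] S cM by (simp add: S_def Int_absorb2 compact_imp_closed)
  have "emeasure M \<Omega> \<le> emeasure M S + emeasure M (\<Omega> - S)"
    using emeasure_subadditive[of S M "\<Omega> - S"] SM null S by (simp add: Un_absorb1 null_sets_def)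
  also have "\<dots> = emeasure M S" using null by (simp add: null_setsD1)
  also have "\<dots> < \<infinity>" using fin cM S by (simp add: S_def)
  finally have "emeasure M (space M) \<noteq> \<infinity>" by (simp add: sp)
  then have "finite_measure M" by (rule finite_measureI)
  moreover have "(\<lambda>x. x) \<in> measurable M borel"
    unfolding measurable_cong_sets[OF sM refl] by (rule measurable_restrict_space1) simp
  moreover have "AE x in M. x \<in> S"
    using AE_not_in[OF null] by (rule AE_mp) (auto intro!: AE_I2 simp: sp)
  ultimately show "concentrated_measure M (measure_support M)"
    using cM unfolding concentrated_measure_def concentrated_measure_axioms_def by (simp add: S_def)
qed

lemma concentrated_measure_superset:
  assumes "concentrated_measure M K" "K \<subseteq> L" "compact L"
  shows "concentrated_measure M L"
  using assms unfolding concentrated_measure_def concentrated_measure_axioms_def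
  by (auto elim!: eventually_mono)

lemma ereal_integral_cong_AE:
  assumes "AE x in M. f x = g x"
  shows "ereal_integral M f = ereal_integral M g"
  unfolding ereal_integral_def
  using assms by (intro arg_cong2[where f=minus] arg_cong[where f=enn2ereal] nn_integral_cong_AE) (auto elim!: eventually_mono)

lemma ereal_integral_mono:
  assumes "AE x in M. f x \<le> g x"
  shows "ereal_integral M f \<le> ereal_integral M g"
  unfolding ereal_integral_def
  using assms
  by (intro ereal_minus_mono; unfold less_eq_ennreal.rep_eq[symmetric])
     (auto intro!: nn_integral_mono_AE elim!: eventually_mono e2ennreal_mono simp: e2ennreal_mono)

lemma ereal_integral_real:
  fixes f :: "'a \<Rightarrow> real"
  assumes f: "integrable M f"
  shows "ereal_integral M (\<lambda>x. ereal (f x)) = ereal (\<integral>x. f x \<partial>M)"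
proof -
  have "(\<integral>\<^sup>+x. ennreal (f x) \<partial>M) < \<infinity>" "(\<integral>\<^sup>+x. ennreal (- f x) \<partial>M) < \<infinity>"
    using f by (auto simp: real_integrable_def less_top)
  moreover have "enn2ereal x = ereal (enn2real x)" if "x < \<infinity>" for x
    using that by (cases x) (auto simp: enn2ereal_ennreal)
  ultimately show ?thesis
    unfolding ereal_integral_def real_lebesgue_integral_def[OF f] by simp
qed

lemma kernel_eq_radial_kernel:
  "y \<noteq> x \<Longrightarrow> kernel y x = ereal (radial_kernel TYPE('a) (norm (x - (y::'a::euclidean_space))))"
  by (simp add: kernel_def radial_kernel_def norm_minus_commute)

context concentrated_measure
begin

text \<open>A finite measure charges at most a Lebesgue null set of points; this removes the infinite value of the kernel at its pole from
almost every potential.\<close>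

lemma AE_not_atom: "AE x in lborel. AE y in M. y \<noteq> x"
proof -
  interpret P: pair_sigma_finite "lborel :: 'a measure" M ..
  have [measurable]: "(\<lambda>p. snd p) \<in> borel_measurable (lborel \<Otimes>\<^sub>M M)"
    by (rule measurable_compose[OF measurable_snd id_measurable])
  have "(\<lambda>p. norm (snd p - fst p)) \<in> borel_measurable (lborel \<Otimes>\<^sub>M M)" by measurable
  then have "(\<lambda>p. norm (snd p - fst p)) -` (- {0}) \<inter> space (lborel \<Otimes>\<^sub>M M) \<in> sets (lborel \<Otimes>\<^sub>M M)"
    by (rule measurable_sets) simp
  moreover have "(\<lambda>p. norm (snd p - fst p)) -` (- {0}) \<inter> space (lborel \<Otimes>\<^sub>M M)
     = {p \<in> space (lborel \<Otimes>\<^sub>M M). snd p \<noteq> fst p}" by auto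
  ultimately have "{p \<in> space (lborel \<Otimes>\<^sub>M M). snd p \<noteq> fst p} \<in> sets (lborel \<Otimes>\<^sub>M M)" by simp
  from P.AE_commute[OF this]
  have "(AE x in lborel. AE y in M. y \<noteq> x) \<longleftrightarrow> (AE y in M. AE x in lborel. y \<noteq> x)" .
  moreover have "AE y in M. AE x in lborel. y \<noteq> x"
  proof (rule AE_I2)
    show "AE x in lborel. y \<noteq> x" for y :: 'a
      using AE_lborel_singleton[of y] by eventually_elim simp
  qed
  ultimately show ?thesis by blast
qed

lemma ereal_integral_kernel:
  assumes int: "integrable M (\<lambda>y. radial_kernel TYPE('a) (norm (x - y)))" and ae: "AE y in M. y \<noteq> x"
  shows "ereal_integral M (\<lambda>y. kernel y x) = ereal (\<integral>y. radial_kernel TYPE('a) (norm (x - y)) \<partial>M)"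
    and "ereal_integral M (\<lambda>y. - kernel y x) = ereal (- (\<integral>y. radial_kernel TYPE('a) (norm (x - y)) \<partial>M))"
proof -
  have "ereal_integral M (\<lambda>y. kernel y x) = ereal_integral M (\<lambda>y. ereal (radial_kernel TYPE('a) (norm (x - y))))"
    by (rule ereal_integral_cong_AE) (use ae in \<open>auto elim!: eventually_mono simp: kernel_eq_radial_kernel\<close>)
  then show "ereal_integral M (\<lambda>y. kernel y x) = ereal (\<integral>y. radial_kernel TYPE('a) (norm (x - y)) \<partial>M)"
    using ereal_integral_real[OF int] by simp
  have "ereal_integral M (\<lambda>y. - kernel y x) = ereal_integral M (\<lambda>y. ereal (- radial_kernel TYPE('a) (norm (x - y))))"
    by (rule ereal_integral_cong_AE) (use ae in \<open>auto elim!: eventually_mono simp: kernel_eq_radial_kernel\<close>)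
  then show "ereal_integral M (\<lambda>y. - kernel y x) = ereal (- (\<integral>y. radial_kernel TYPE('a) (norm (x - y)) \<partial>M))"
    using ereal_integral_real[OF integrable_minus[OF int]] by simp
qed

text \<open>Green's representation formula integrated against \<open>M\<close>. The potential is a convergent integral for almost every \<open>x\<close> with
\<open>L x \<noteq> 0\<close>.\<close>

lemma potential_representation:
  assumes C: "C2_on UNIV f g h" and supp: "\<And>x. R < norm x \<Longrightarrow> f x = 0"
  shows "AE x in lborel. laplace h x \<noteq> 0 \<longrightarrow> integrable M (\<lambda>y. radial_kernel TYPE('a) (norm (x - y)))"
    and "integrable lborel (\<lambda>x. (\<integral>y. radial_kernel TYPE('a) (norm (x - y)) \<partial>M) * laplace h x)"
    and "(\<integral>x. (\<integral>y. radial_kernel TYPE('a) (norm (x - y)) \<partial>M) * laplace h x \<partial>lborel) = newton_const TYPE('a) * (\<integral>y. f y \<partial>M)"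
proof -
  interpret P: pair_sigma_finite M "lborel :: 'a measure" ..
  obtain T where T: "\<And>y. y \<in> K \<Longrightarrow> norm y \<le> T"
    using compact_K compact_imp_bounded bounded_iff by metis
  note cont = C2_on_continuous[OF C]
  have L0: "laplace h x = 0" if "R < norm x" for x
    using C2_on_zero_outside(2)[OF C, of "cball 0 R" x] supp that by (auto simp: laplace_def)
  have Lm [measurable]: "laplace h \<in> borel_measurable borel" using cont(4) by (rule borel_measurable_continuous_onI)
  obtain B where B: "\<And>x. norm (laplace h x) \<le> B" using continuous_compact_support_bounded[OF cont(4) L0] by blast
  have B': "\<bar>laplace h x\<bar> \<le> B" for x using B[of x] by simp
  define k where "k y x = radial_kernel TYPE('a) (norm (x - y)) * laplace h x" for y x
  have km: "(\<lambda>p. k (fst p) (snd p)) \<in> borel_measurable (M \<Otimes>\<^sub>M lborel)"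
  proof -
    have [measurable]: "(\<lambda>p. fst p) \<in> borel_measurable (M \<Otimes>\<^sub>M lborel)"
      by (rule measurable_compose[OF measurable_fst id_measurable])
    show ?thesis unfolding k_def by measurable
  qed
  have kint: "integrable lborel (\<lambda>x. k y x)" if "y \<in> K" for y
    unfolding k_def by (rule kernel_product_bound(1)[OF Lm B' L0 T[OF that]])
  have kint2: "(\<integral>x. norm (k y x) \<partial>lborel) \<le> B * kernel_bound TYPE('a) (R + T)" if "y \<in> K" for y
    unfolding k_def by (rule kernel_product_bound(2)[OF Lm B' L0 T[OF that]])
  have kI: "integrable (M \<Otimes>\<^sub>M lborel) (case_prod k)"
  proof (rule P.Fubini_integrable)
    show "case_prod k \<in> borel_measurable (M \<Otimes>\<^sub>M lborel)" using km by (simp add: split_beta')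
    show "AE y in M. integrable lborel (\<lambda>x. case_prod k (y, x))"
      using AE_K by eventually_elim (simp add: kint)
    have "AE y in M. norm (\<integral>x. norm (k y x) \<partial>lborel) \<le> B * kernel_bound TYPE('a) (R + T)"
      using AE_K by eventually_elim (use kint2 in simp)
    moreover have "(\<lambda>y. \<integral>x. norm (k y x) \<partial>lborel) \<in> borel_measurable M"
      using km by (intro lborel.borel_measurable_lebesgue_integral) (simp add: split_beta')
    ultimately show "integrable M (\<lambda>y. \<integral>x. norm (case_prod k (y, x)) \<partial>lborel)"
      by (simp add: integrable_const_bound)
  qed
  show "AE x in lborel. laplace h x \<noteq> 0 \<longrightarrow> integrable M (\<lambda>y. radial_kernel TYPE('a) (norm (x - y)))"
    using P.AE_integrable_snd[OF kI] by eventually_elim (auto simp: k_def)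
  have eq: "(\<integral>y. k y x \<partial>M) = (\<integral>y. radial_kernel TYPE('a) (norm (x - y)) \<partial>M) * laplace h x" for x
    by (simp add: k_def)
  show "integrable lborel (\<lambda>x. (\<integral>y. radial_kernel TYPE('a) (norm (x - y)) \<partial>M) * laplace h x)"
    using P.integrable_snd[OF kI] by (simp add: eq)
  have "(\<integral>x. (\<integral>y. radial_kernel TYPE('a) (norm (x - y)) \<partial>M) * laplace h x \<partial>lborel) = (\<integral>y. (\<integral>x. k y x \<partial>lborel) \<partial>M)"
    using P.Fubini_integral[OF kI] by (simp add: eq)
  also have "(\<lambda>y. \<integral>x. k y x \<partial>lborel) = (\<lambda>y. newton_const TYPE('a) * f y)"
    unfolding k_def by (rule ext, rule greens_representation[OF C supp])
  finally show "(\<integral>x. (\<integral>y. radial_kernel TYPE('a) (norm (x - y)) \<partial>M) * laplace h x \<partial>lborel) = newton_const TYPE('a) * (\<integral>y. f y \<partial>M)"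
    by simp
qed

end

text \<open>By the representation it suffices to compare the potentials, multiplied by the Laplacian, at almost every point.
A positive Laplacian asks for the inequality of the potentials, a negative one for the reversed inequality.\<close>

lemma integral_le_of_potentials_le:
  fixes f :: "'a::euclidean_space \<Rightarrow> real"
  assumes \<delta>: "concentrated_measure \<delta> K" and \<omega>: "concentrated_measure \<omega> K"
    and C: "C2_on UNIV f g h" and supp: "\<And>x. R < norm x \<Longrightarrow> f x = 0"
    and pos: "\<And>x. 0 < laplace h x \<Longrightarrow> ereal_integral \<delta> (\<lambda>y. kernel y x) \<le> ereal_integral \<omega> (\<lambda>y. kernel y x)"
    and neg: "\<And>x. laplace h x < 0 \<Longrightarrow> ereal_integral \<delta> (\<lambda>y. - kernel y x) \<le> ereal_integral \<omega> (\<lambda>y. - kernel y x)"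
  shows "(\<integral>y. f y \<partial>\<delta>) \<le> (\<integral>y. f y \<partial>\<omega>)"
proof -
  interpret D: concentrated_measure \<delta> K by fact
  interpret W: concentrated_measure \<omega> K by fact
  have d: "AE x in lborel. laplace h x \<noteq> 0 \<longrightarrow> integrable \<delta> (\<lambda>y. radial_kernel TYPE('a) (norm (x - y)))"
    "integrable lborel (\<lambda>x. (\<integral>y. radial_kernel TYPE('a) (norm (x - y)) \<partial>\<delta>) * laplace h x)"
    "(\<integral>x. (\<integral>y. radial_kernel TYPE('a) (norm (x - y)) \<partial>\<delta>) * laplace h x \<partial>lborel) = newton_const TYPE('a) * (\<integral>y. f y \<partial>\<delta>)"
    by (rule D.potential_representation[OF C supp]; assumption)+
  have w: "AE x in lborel. laplace h x \<noteq> 0 \<longrightarrow> integrable \<omega> (\<lambda>y. radial_kernel TYPE('a) (norm (x - y)))"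
    "integrable lborel (\<lambda>x. (\<integral>y. radial_kernel TYPE('a) (norm (x - y)) \<partial>\<omega>) * laplace h x)"
    "(\<integral>x. (\<integral>y. radial_kernel TYPE('a) (norm (x - y)) \<partial>\<omega>) * laplace h x \<partial>lborel) = newton_const TYPE('a) * (\<integral>y. f y \<partial>\<omega>)"
    by (rule W.potential_representation[OF C supp]; assumption)+
  have "(\<integral>x. (\<integral>y. radial_kernel TYPE('a) (norm (x - y)) \<partial>\<delta>) * laplace h x \<partial>lborel)
      \<le> (\<integral>x. (\<integral>y. radial_kernel TYPE('a) (norm (x - y)) \<partial>\<omega>) * laplace h x \<partial>lborel)"
  proof (rule integral_mono_AE[OF d(2) w(2)])
    show "AE x in lborel. (\<integral>y. radial_kernel TYPE('a) (norm (x - y)) \<partial>\<delta>) * laplace h x \<le> (\<integral>y. radial_kernel TYPE('a) (norm (x - y)) \<partial>\<omega>) * laplace h x"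
      using d(1) w(1) D.AE_not_atom W.AE_not_atom
    proof eventually_elim
      case (elim x)
      consider "laplace h x = 0" | "0 < laplace h x" | "laplace h x < 0" by linarith
      then show ?case
      proof cases
        case 2
        then have "(\<integral>y. radial_kernel TYPE('a) (norm (x - y)) \<partial>\<delta>) \<le> (\<integral>y. radial_kernel TYPE('a) (norm (x - y)) \<partial>\<omega>)"
          using pos[OF 2] elim by (simp add: D.ereal_integral_kernel W.ereal_integral_kernel)
        then show ?thesis using 2 by (simp add: mult_right_mono)
      next
        case 3
        then have "(\<integral>y. radial_kernel TYPE('a) (norm (x - y)) \<partial>\<omega>) \<le> (\<integral>y. radial_kernel TYPE('a) (norm (x - y)) \<partial>\<delta>)"
          using neg[OF 3] elim by (simp add: D.ereal_integral_kernel W.ereal_integral_kernel)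
        then show ?thesis using 3 by (simp add: mult_right_mono_neg)
      qed simp
    qed
  qed
  then show ?thesis unfolding d(3) w(3) using newton_const_pos[where 'a='a] by simp
qed

lemma compact_support_radius:
  assumes "compact K"
  obtains R where "\<And>x::'a::euclidean_space. R < norm x \<Longrightarrow> x \<notin> K"
proof -
  obtain R where "\<forall>x\<in>K. norm x \<le> R"
    using compact_imp_bounded[OF assms] bounded_iff by blast
  then show ?thesis by (intro that[of R]) force
qed

lemma balayage_kernelD:
  assumes bal: "balayage (Kclass X \<union> neg_Kclass Y) \<delta> \<omega>"
  shows "x \<in> X \<Longrightarrow> ereal_integral \<delta> (\<lambda>y. kernel y x) \<le> ereal_integral \<omega> (\<lambda>y. kernel y x)"
    and "x \<in> Y \<Longrightarrow> ereal_integral \<delta> (\<lambda>y. - kernel y x) \<le> ereal_integral \<omega> (\<lambda>y. - kernel y x)"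
proof -
  have *: "ereal_integral \<delta> k \<le> ereal_integral \<omega> k" if "k \<in> Kclass X \<union> neg_Kclass Y" for k
    using bal that unfolding balayage_def by (rule bspec)
  show "ereal_integral \<delta> (\<lambda>y. kernel y x) \<le> ereal_integral \<omega> (\<lambda>y. kernel y x)" if "x \<in> X"
    by (rule *) (use that in \<open>auto simp: Kclass_def\<close>)
  show "ereal_integral \<delta> (\<lambda>y. - kernel y x) \<le> ereal_integral \<omega> (\<lambda>y. - kernel y x)" if "x \<in> Y"
    by (rule *) (use that in \<open>auto simp: neg_Kclass_def\<close>)
qed

text \<open>The cut-off is \<open>1\<close> near the supports and near \<open>S\<close>, so the Laplacian of the product vanishes there; it also vanishes
outside \<open>\<Omega>\<close>. What remains lies in \<open>\<Omega> - S\<close>.\<close>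

lemma harmonic_balayage_of_kernels:
  fixes \<Omega> :: "'a::euclidean_space set"
  assumes \<Omega>: "open \<Omega>" and \<delta>: "concentrated_measure \<delta> K" and \<omega>: "concentrated_measure \<omega> K" and K: "K \<subseteq> \<Omega>"
    and S: "compact S" "S \<subseteq> \<Omega>"
    and bal: "balayage (Kclass (\<Omega> - S) \<union> neg_Kclass (\<Omega> - S)) \<delta> \<omega>"
  shows "balayage (har \<Omega>) \<delta> \<omega>"
  unfolding balayage_def
proof
  interpret D: concentrated_measure \<delta> K by fact
  interpret W: concentrated_measure \<omega> K by fact
  fix v assume "v \<in> har \<Omega>"
  then obtain u where v: "v = (\<lambda>x. ereal (u x))" and "harmonic_on u \<Omega>" by (auto simp: har_def)
  then obtain g h where C: "C2_on \<Omega> u g h" and L: "\<And>x. x \<in> \<Omega> \<Longrightarrow> laplace h x = 0"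
    using harmonic_on_iff_C2[OF \<Omega>] by blast
  have KS: "compact (K \<union> S)" "K \<union> S \<subseteq> \<Omega>" using D.compact_K S K by auto
  obtain F G H N K' where F: "C2_on UNIV F G H" "open N" "K \<union> S \<subseteq> N" "N \<subseteq> K'" "compact K'" "K' \<subseteq> \<Omega>"
    "\<And>x. x \<in> N \<Longrightarrow> F x = u x" "\<And>x. x \<notin> K' \<Longrightarrow> F x = 0"
    "\<And>x. x \<in> N \<Longrightarrow> laplace H x = laplace h x" "\<And>x. x \<notin> K' \<Longrightarrow> laplace H x = 0"
    by (rule C2_cutoff_product[OF C KS(1) \<Omega> KS(2)]) (rule that)
  have L0: "x \<in> \<Omega> - S" if "laplace H x \<noteq> 0" for x
  proof -
    have "x \<in> K'" using F(10) that by blast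
    moreover have "x \<notin> N" using F(9)[of x] F(4,6) L[of x] that by auto
    ultimately show ?thesis using F by blast
  qed
  obtain R where R: "\<And>x::'a. R < norm x \<Longrightarrow> x \<notin> K'" using compact_support_radius[OF F(5)] by blast
  have "(\<integral>y. F y \<partial>\<delta>) \<le> (\<integral>y. F y \<partial>\<omega>)"
  proof (rule integral_le_of_potentials_le[OF \<delta> \<omega> F(1)])
    show "F x = 0" if "R < norm x" for x using R F(8) that by blast
    show "ereal_integral \<delta> (\<lambda>y. kernel y x) \<le> ereal_integral \<omega> (\<lambda>y. kernel y x)" if "0 < laplace H x" for x
      by (rule balayage_kernelD(1)[OF bal L0]) (use that in simp)
    show "ereal_integral \<delta> (\<lambda>y. - kernel y x) \<le> ereal_integral \<omega> (\<lambda>y. - kernel y x)" if "laplace H x < 0" for x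
      by (rule balayage_kernelD(2)[OF bal L0]) (use that in simp)
  qed
  moreover have "ereal_integral M v = ereal (\<integral>y. F y \<partial>M)" if "concentrated_measure M K" for M
  proof -
    interpret concentrated_measure M K by fact
    have "ereal_integral M v = ereal_integral M (\<lambda>x. ereal (F x))"
      by (rule ereal_integral_cong_AE) (use AE_K F(3,7) in \<open>auto simp: v elim!: eventually_mono\<close>)
    also have "\<dots> = ereal (\<integral>y. F y \<partial>M)"
    proof (rule ereal_integral_real)
      have c: "continuous_on UNIV F" by (rule C2_on_continuous(1)[OF F(1)])
      have FR: "F x = 0" if "R < norm x" for x using R F(8) that by blast
      obtain B where "\<And>x. norm (F x) \<le> B"
        using continuous_compact_support_bounded[OF c FR] by blast
      then show "integrable M F"
        by (intro integrable_bounded[of _ B] borel_measurable_continuous_onI c) auto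
    qed
    finally show ?thesis .
  qed
  ultimately show "ereal_integral \<delta> v \<le> ereal_integral \<omega> v" using \<delta> \<omega> by simp
qed

section \<open>Upper semicontinuous functions with the submean property\<close>

lemma conv_mollifier_abs_le:
  fixes w :: "'a::euclidean_space \<Rightarrow> real"
  assumes [measurable]: "w \<in> borel_measurable borel" and B: "\<And>x. \<bar>w x\<bar> \<le> B" and e: "0 < e"
  shows "\<bar>conv w (mollifier e) x\<bar> \<le> B"
proof -
  have "- B \<le> conv w (mollifier e) x"
  proof (rule conv_mollifier_ge[OF _ B e])
    show "- B \<le> sph_mean w x r" for r
      using sph_mean_bounded[of w B x r] B by (simp add: abs_le_iff)
  qed simp
  moreover have "- B \<le> conv (\<lambda>x. - w x) (mollifier e) x"
  proof (rule conv_mollifier_ge[of _ B])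
    show "- B \<le> sph_mean (\<lambda>x. - w x) x r" for r
      using sph_mean_bounded[of w B x r] B by (simp add: sph_mean_uminus abs_le_iff)
  qed (use B e in auto)
  moreover have "conv (\<lambda>x. - w x) (mollifier e) x = - conv w (mollifier e) x"
    by (simp add: conv_def)
  ultimately show ?thesis by (simp add: abs_le_iff)
qed

lemma conv_mollifier_le_local:
  fixes w :: "'a::euclidean_space \<Rightarrow> real"
  assumes [measurable]: "w \<in> borel_measurable borel" and B: "\<And>x. \<bar>w x\<bar> \<le> B" and e: "0 < e"
    and a: "\<And>y. dist y x < e \<Longrightarrow> w y \<le> a"
  shows "conv w (mollifier e) x \<le> a"
proof -
  have "- a \<le> conv (\<lambda>x. - w x) (mollifier e) x"
  proof (rule conv_mollifier_ge[of _ B])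
    fix r :: real assume r: "0 < r" "r < e"
    have int: "integrable unif_ball (\<lambda>z. w (x + r *\<^sub>R sgn z))"
      by (rule integrable_unif_ball_bounded[of _ B]) (use B in auto)
    have "sph_mean w x r \<le> (\<integral>z. a \<partial>(unif_ball :: 'a measure))"
      unfolding sph_mean_def
    proof (rule integral_mono[OF int])
      show "w (x + r *\<^sub>R sgn z) \<le> a" for z
        using r by (intro a) (simp add: dist_norm norm_sgn)
    qed auto
    then show "- a \<le> sph_mean (\<lambda>x. - w x) x r" by (simp add: sph_mean_uminus)
  qed (use B e in auto)
  moreover have "conv (\<lambda>x. - w x) (mollifier e) x = - conv w (mollifier e) x"
    by (simp add: conv_def)
  ultimately show ?thesis by simp
qed

text \<open>The properties of a truncated subharmonic function that the approximation argument uses, stated in a form common to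
all dimensions. The admissible radii are uniform on compact sets because the mollified function inherits the inequality
only from a whole neighbourhood.\<close>

definition usc_submean :: "('a::euclidean_space \<Rightarrow> real) \<Rightarrow> 'a set \<Rightarrow> bool" where
  "usc_submean v U \<longleftrightarrow>
     (\<forall>C. compact C \<longrightarrow> C \<subseteq> U \<longrightarrow>
        (\<lambda>x. indicator C x * v x) \<in> borel_measurable borel \<and>
        (\<exists>B. \<forall>x\<in>C. \<bar>v x\<bar> \<le> B) \<and>
        (\<exists>q>0. \<forall>x\<in>C. \<forall>r. 0 < r \<longrightarrow> r < q \<longrightarrow> v x \<le> sph_mean v x r)) \<and>
     (\<forall>x\<in>U. \<forall>a. v x < a \<longrightarrow> (\<exists>d>0. \<forall>y. dist y x < d \<longrightarrow> v y < a))"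

definition closed_nbhd :: "real \<Rightarrow> 'a::euclidean_space set \<Rightarrow> 'a set" where
  "closed_nbhd r K = {x. \<exists>y\<in>K. dist x y \<le> r}"

lemma compact_closed_nbhd: "compact K \<Longrightarrow> compact (closed_nbhd r K)"
proof -
  assume K: "compact K"
  have "closed_nbhd r K = (\<Union>x\<in>K. \<Union>y\<in>cball 0 r. {x + y})"
  proof -
    have "x \<in> closed_nbhd r K \<longleftrightarrow> (\<exists>y\<in>K. \<exists>z. norm z \<le> r \<and> x = y + z)" for x
    proof -
      have "x \<in> closed_nbhd r K \<longleftrightarrow> (\<exists>y\<in>K. norm (x - y) \<le> r)" by (simp add: closed_nbhd_def dist_norm)
      also have "\<dots> \<longleftrightarrow> (\<exists>y\<in>K. \<exists>z. norm z \<le> r \<and> x = y + z)"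
        by (rule bex_cong[OF refl]) (auto intro: exI[of _ "x - _"])
      finally show ?thesis .
    qed
    then show ?thesis by (simp add: set_eq_iff Bex_def)
  qed
  then show ?thesis using compact_sums'[OF K compact_cball] by simp
qed

lemma closed_nbhd_cball: "x \<in> closed_nbhd r K \<Longrightarrow> dist x y \<le> s \<Longrightarrow> r + s \<le> t \<Longrightarrow> y \<in> closed_nbhd t K"
proof -
  assume "x \<in> closed_nbhd r K" and st: "dist x y \<le> s" "r + s \<le> t"
  then obtain z where z: "z \<in> K" "dist x z \<le> r" unfolding closed_nbhd_def by blast
  have "dist y z \<le> dist x y + dist x z" by (rule dist_triangle3)
  then have "dist y z \<le> t" using z st by linarith
  then show "y \<in> closed_nbhd t K" unfolding closed_nbhd_def using z(1) by blast
qed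

text \<open>The mollified function has nonnegative Laplacian near \<open>L = K \<union> S\<close>, by the submean inequality, and the cut-off changes it only
in \<open>\<Omega> - S\<close>. As the mollifiers shrink, the submean inequality bounds the approximations from below by \<open>v\<close> and upper
semicontinuity bounds them from above in the limit.\<close>

lemma balayage_usc_submean:
  fixes \<Omega> :: "'a::euclidean_space set"
  assumes \<Omega>: "open \<Omega>" and \<delta>: "concentrated_measure \<delta> K" and \<omega>: "concentrated_measure \<omega> K" and K: "K \<subseteq> \<Omega>"
    and S: "compact S" "S \<subseteq> \<Omega>"
    and bal: "balayage (Kclass \<Omega> \<union> neg_Kclass (\<Omega> - S)) \<delta> \<omega>"
    and v: "usc_submean v \<Omega>"
  shows "(\<integral>x. indicator K x * v x \<partial>\<delta>) \<le> (\<integral>x. indicator K x * v x \<partial>\<omega>)"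
proof -
  interpret D: concentrated_measure \<delta> K by fact
  interpret W: concentrated_measure \<omega> K by fact
  define L where "L = K \<union> S"
  have L: "compact L" "L \<subseteq> \<Omega>" using D.compact_K S K by (auto simp: L_def)
  obtain e0 where e0: "e0 > 0" "(\<Union>x\<in>L. ball x e0) \<subseteq> \<Omega>"
    using compact_subset_open_imp_ball_epsilon_subset[OF L(1) \<Omega> L(2)] by blast
  \<comment> \<open>Four layers of width \<open>\<eta>\<close> around \<open>L\<close> fit into \<open>\<Omega>\<close>: the function is kept on the fourth, its submean inequality holds
on the third, that of the mollification on the second, which contains the cut-off.\<close>
  define \<eta> where "\<eta> = e0 / 5"
  have \<eta>: "\<eta> > 0" using e0 by (simp add: \<eta>_def)
  define C where "C = closed_nbhd (4 * \<eta>) L"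
  have Cc: "compact C" unfolding C_def by (rule compact_closed_nbhd[OF L(1)])
  have C\<Omega>: "C \<subseteq> \<Omega>"
  proof
    fix x assume "x \<in> C"
    then obtain y where "y \<in> L" "dist x y \<le> 4 * \<eta>" by (auto simp: C_def closed_nbhd_def)
    then have "x \<in> (\<Union>x\<in>L. ball x e0)" using \<eta> by (auto simp: \<eta>_def dist_commute intro!: bexI[of _ y])
    then show "x \<in> \<Omega>" using e0 by blast
  qed
  define w where "w x = indicator C x * v x" for x
  have vC: "(\<lambda>x. indicator C x * v x) \<in> borel_measurable borel \<and>
        (\<exists>B. \<forall>x\<in>C. \<bar>v x\<bar> \<le> B) \<and>
        (\<exists>q>0. \<forall>x\<in>C. \<forall>r. 0 < r \<longrightarrow> r < q \<longrightarrow> v x \<le> sph_mean v x r)"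
    using v Cc C\<Omega> unfolding usc_submean_def by blast
  then have wm [measurable]: "w \<in> borel_measurable borel" by (simp add: w_def[abs_def])
  obtain B0 where B0: "\<forall>x\<in>C. \<bar>v x\<bar> \<le> B0" using vC by blast
  obtain q where q: "q > 0" and vq: "\<And>x r. x \<in> C \<Longrightarrow> 0 < r \<Longrightarrow> r < q \<Longrightarrow> v x \<le> sph_mean v x r" using vC by blast
  define B where "B = \<bar>B0\<bar>"
  have wB: "\<bar>w x\<bar> \<le> B" for x using B0 by (auto simp: w_def B_def indicator_def)
  have wi: "integrable lborel w"
  proof -
    have "integrable lborel (\<lambda>x. B * indicator C x)"
      using emeasure_compact_finite[OF Cc] Cc by (intro integrable_mult_right integrable_real_indicator) (auto simp: compact_imp_closed)
    then show ?thesis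
      by (rule Bochner_Integration.integrable_bound)
         (use B0 in \<open>auto simp: w_def B_def indicator_def intro!: AE_I2\<close>)
  qed
  have sm: "w x \<le> sph_mean w x r" if x: "x \<in> closed_nbhd (3 * \<eta>) L" and r: "0 < r" "r < min \<eta> q" for x r
  proof -
    have inC: "y \<in> C" if "dist x y \<le> r" for y
      unfolding C_def by (rule closed_nbhd_cball[OF x that]) (use r in auto)
    have "w x = v x" using inC[of x] r by (simp add: w_def)
    also have "\<dots> \<le> sph_mean v x r" using vq[of x r] inC[of x] r by simp
    also have "\<dots> = sph_mean w x r"
      by (rule sph_mean_cong) (use r inC in \<open>auto simp: w_def\<close>)
    finally show ?thesis .
  qed
  have step: "(\<integral>x. conv w (mollifier e) x \<partial>\<delta>) \<le> (\<integral>x. conv w (mollifier e) x \<partial>\<omega>)" if e: "0 < e" "e < \<eta>" for e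
  proof -
    define V where "V = conv w (mollifier e)"
    obtain g h where V: "C2_on UNIV V g h"
      using C2_on_conv_mollifier[OF wi e(1)] unfolding V_def by blast
    have Lap: "0 \<le> laplace h x" if x: "x \<in> closed_nbhd (2 * \<eta>) L" for x
    proof (rule laplace_nonneg_of_sph_mean[OF V open_UNIV UNIV_I, of "min \<eta> q"])
      fix r assume r: "0 < r" "r < min \<eta> q"
      show "V x \<le> sph_mean V x r"
        unfolding V_def
      proof (rule conv_mollifier_submean[OF wm wB e(1)])
        fix u assume "u \<in> ball x e"
        then have "u \<in> closed_nbhd (3 * \<eta>) L" by (intro closed_nbhd_cball[OF x, of u \<eta>]) (use e in auto)
        then show "w u \<le> sph_mean w u r" by (rule sm) (use r in auto)
      qed
    qed (use \<eta> q in auto)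
    define U where "U = (\<Union>x\<in>L. ball x (2 * \<eta>))"
    have U: "open U" "L \<subseteq> U" using \<eta> by (auto simp: U_def)
    have Un: "U \<subseteq> closed_nbhd (2 * \<eta>) L"
    proof
      fix x assume "x \<in> U"
      then obtain y where "y \<in> L" "dist y x < 2 * \<eta>" by (auto simp: U_def)
      then have "y \<in> L" "dist x y \<le> 2 * \<eta>" by (simp_all add: dist_commute)
      then show "x \<in> closed_nbhd (2 * \<eta>) L" unfolding closed_nbhd_def by blast
    qed
    have U\<Omega>: "U \<subseteq> \<Omega>"
    proof -
      have "U \<subseteq> (\<Union>x\<in>L. ball x e0)" unfolding U_def using e0
        by (intro UN_mono subset_ball) (auto simp: \<eta>_def)
      then show ?thesis using e0 by blast
    qed
    have VU: "C2_on U V g h" using V by (rule C2_on_subset) simp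
    obtain F G H N K' where F: "C2_on UNIV F G H" "open N" "L \<subseteq> N" "N \<subseteq> K'" "compact K'" "K' \<subseteq> U"
      "\<And>x. x \<in> N \<Longrightarrow> F x = V x" "\<And>x. x \<notin> K' \<Longrightarrow> F x = 0"
      "\<And>x. x \<in> N \<Longrightarrow> laplace H x = laplace h x" "\<And>x. x \<notin> K' \<Longrightarrow> laplace H x = 0"
      by (rule C2_cutoff_product[OF VU L(1) U]) (rule that)
    obtain R where R: "\<And>x::'a. R < norm x \<Longrightarrow> x \<notin> K'" using compact_support_radius[OF F(5)] by blast
    have "(\<integral>y. F y \<partial>\<delta>) \<le> (\<integral>y. F y \<partial>\<omega>)"
    proof (rule integral_le_of_potentials_le[OF \<delta> \<omega> F(1)])
      show "F x = 0" if "R < norm x" for x using R F(8) that by blast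
    next
      fix x assume x: "0 < laplace H x"
      then have "x \<in> K'" using F(10) by force
      then have "x \<in> \<Omega>" using F(6) U\<Omega> by blast
      then show "ereal_integral \<delta> (\<lambda>y. kernel y x) \<le> ereal_integral \<omega> (\<lambda>y. kernel y x)"
        by (rule balayage_kernelD(1)[OF bal])
    next
      fix x assume x: "laplace H x < 0"
      then have xK: "x \<in> K'" using F(10) by force
      have "x \<notin> N"
      proof
        assume "x \<in> N"
        then have "laplace H x = laplace h x" "x \<in> closed_nbhd (2 * \<eta>) L" using F(4,6,9) Un by auto
        then show False using Lap x by force
      qed
      then have "x \<notin> S" using F(3) by (auto simp: L_def)
      then have "x \<in> \<Omega> - S" using xK F(6) U\<Omega> by blast
      then show "ereal_integral \<delta> (\<lambda>y. - kernel y x) \<le> ereal_integral \<omega> (\<lambda>y. - kernel y x)"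
        by (rule balayage_kernelD(2)[OF bal])
    qed
    moreover have "(\<integral>y. F y \<partial>M) = (\<integral>y. V y \<partial>M)" if M: "concentrated_measure M K" for M
    proof -
      interpret concentrated_measure M K by fact
      have "F \<in> borel_measurable borel" "V \<in> borel_measurable borel"
        using C2_on_continuous(1)[OF F(1)] C2_on_continuous(1)[OF V] by (auto intro: borel_measurable_continuous_onI)
      then show ?thesis
        by (intro integral_cong_AE borel_measurable_M)
           (use AE_K F(3,7) in \<open>auto simp: L_def elim!: eventually_mono\<close>)
    qed
    ultimately show ?thesis using \<delta> \<omega> by (simp add: V_def)
  qed
  define s where "s n = \<eta> / (real n + 2)" for n :: nat
  have s: "0 < s n" "s n < \<eta>" for n
    using \<eta> by (auto simp: s_def divide_simps intro!: add_pos_nonneg)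
  have usc: "\<exists>d>0. \<forall>y. dist y x < d \<longrightarrow> v y < a" if "x \<in> \<Omega>" "v x < a" for x a
    using v that unfolding usc_submean_def by blast
  have s0: "s \<longlonglongrightarrow> 0" unfolding s_def by real_asymp
  have lim: "(\<lambda>n. conv w (mollifier (s n)) x) \<longlonglongrightarrow> indicator K x * v x" if x: "x \<in> K" for x
  proof (rule LIMSEQ_I)
    fix t :: real assume t: "0 < t"
    have inC: "y \<in> C" if "dist y x \<le> 4 * \<eta>" for y
      unfolding C_def closed_nbhd_def L_def using x that by blast
    have "dist x x \<le> 3 * \<eta>" using \<eta> by simp
    then have xK: "x \<in> closed_nbhd (3 * \<eta>) L" unfolding closed_nbhd_def L_def using x by blast
    have wx: "w x = v x" using inC[of x] \<eta> by (simp add: w_def)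
    obtain d where d: "d > 0" "\<And>y. dist y x < d \<Longrightarrow> v y < v x + t / 2"
      using usc[of x "v x + t / 2"] x K t by auto
    have "eventually (\<lambda>n. s n < min d q) sequentially"
      using order_tendstoD(2)[OF s0, of "min d q"] d q by simp
    then have "eventually (\<lambda>n. norm (conv w (mollifier (s n)) x - indicator K x * v x) < t) sequentially"
    proof eventually_elim
      case (elim n)
      have "w x \<le> conv w (mollifier (s n)) x"
        by (rule conv_mollifier_ge[OF wm wB s(1)]) (use sm[OF xK] elim s[of n] in auto)
      moreover have "conv w (mollifier (s n)) x \<le> v x + t / 2"
      proof (rule conv_mollifier_le_local[OF wm wB s(1)])
        fix y assume y: "dist y x < s n"
        then have "y \<in> C" by (intro inC) (use s[of n] \<eta> in auto)
        then show "w y \<le> v x + t / 2" using d(2)[of y] y elim by (simp add: w_def)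
      qed
      ultimately show ?case using wx x t by simp
    qed
    then show "\<exists>no. \<forall>n\<ge>no. norm (conv w (mollifier (s n)) x - indicator K x * v x) < t"
      by (simp add: eventually_sequentially)
  qed
  have conv_lim: "(\<lambda>n. \<integral>x. conv w (mollifier (s n)) x \<partial>M) \<longlonglongrightarrow> (\<integral>x. indicator K x * v x \<partial>M)"
    if M: "concentrated_measure M K" for M
  proof -
    interpret concentrated_measure M K by fact
    have cm: "conv w (mollifier e) \<in> borel_measurable borel" if "0 < e" for e
      using C2_on_conv_mollifier[OF wi that] by (meson C2_on_continuous(1) borel_measurable_continuous_onI)
    show ?thesis
    proof (rule integral_dominated_convergence[where w="\<lambda>_. B"])
      show "(\<lambda>x. indicator K x * v x) \<in> borel_measurable M"
        using v compact_K K unfolding usc_submean_def by (intro borel_measurable_M) blast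
      show "(\<lambda>x. conv w (mollifier (s n)) x) \<in> borel_measurable M" for n
        by (intro borel_measurable_M cm s)
      show "AE x in M. (\<lambda>n. conv w (mollifier (s n)) x) \<longlonglongrightarrow> indicator K x * v x"
        using AE_K by eventually_elim (rule lim)
      show "AE x in M. norm (conv w (mollifier (s n)) x) \<le> B" for n
        using conv_mollifier_abs_le[OF wm wB s(1)] by (intro AE_I2) simp
    qed simp
  qed
  show ?thesis
    by (rule LIMSEQ_le[OF conv_lim[OF \<delta>] conv_lim[OF \<omega>]]) (use step s in auto)
qed

section \<open>Subharmonic functions as test functions\<close>

definition truncate_below :: "nat \<Rightarrow> ('a \<Rightarrow> ereal) \<Rightarrow> 'a \<Rightarrow> real" where
  "truncate_below n u x = real_of_ereal (max (u x) (ereal (- real n)))"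

lemma ereal_truncate_below: "u x < \<infinity> \<Longrightarrow> ereal (truncate_below n u x) = max (u x) (ereal (- real n))"
  unfolding truncate_below_def by (cases "u x") (auto simp: max_def)

lemma truncate_below_less_iff:
  "u x < \<infinity> \<Longrightarrow> truncate_below n u x < a \<longleftrightarrow> - real n < a \<and> u x < ereal a"
  using ereal_truncate_below[of u x n] by (metis ereal_less(2) less_ereal.simps(1) max_less_iff_conj)

lemma truncate_below_ge: "u x < \<infinity> \<Longrightarrow> - real n \<le> truncate_below n u x"
  using ereal_truncate_below[of u x n] by (metis ereal_less_eq(3) max.cobounded2)

lemma le_truncate_below: "u x < \<infinity> \<Longrightarrow> u x \<le> ereal (truncate_below n u x)"
  by (simp add: ereal_truncate_below)

lemma truncate_below_le: "u x < \<infinity> \<Longrightarrow> - real n \<le> a \<Longrightarrow> u x \<le> ereal a \<Longrightarrow> truncate_below n u x \<le> a"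
  using ereal_truncate_below[of u x n] by (metis ereal_less_eq(3) max.bounded_iff)

lemma borel_measurable_truncate_below:
  fixes u :: "'a::euclidean_space \<Rightarrow> ereal"
  assumes fin: "\<And>x. x \<in> C \<Longrightarrow> u x < \<infinity>" and C: "closed C" "C \<subseteq> U" and op: "\<And>a. open {x\<in>U. u x < a}"
  shows "(\<lambda>x. indicator C x * truncate_below n u x) \<in> borel_measurable borel"
proof (rule borel_measurableI_less)
  fix a :: real
  have "{x \<in> space borel. indicator C x * truncate_below n u x < a}
     = (if 0 < a then - C else {}) \<union> (if - real n < a then C \<inter> {x\<in>U. u x < ereal a} else {})"
    using fin C(2) by (auto simp: indicator_def truncate_below_less_iff split: if_splits)
  also have "\<dots> \<in> sets borel" using C(1) op by (auto intro!: sets.Un)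
  finally show "{x \<in> space borel. indicator C x * truncate_below n u x < a} \<in> sets borel" .
qed

text \<open>The sublevel sets of an upper semicontinuous function form an open cover.\<close>

lemma usc_bounded_above:
  fixes u :: "'a::euclidean_space \<Rightarrow> ereal"
  assumes fin: "\<And>x. x \<in> C \<Longrightarrow> u x < \<infinity>" and C: "compact C" "C \<subseteq> U" and op: "\<And>a. open {x\<in>U. u x < a}"
  obtains A :: real where "0 \<le> A" "\<And>x. x \<in> C \<Longrightarrow> u x \<le> ereal A"
proof -
  define G where "G = (\<lambda>k::nat. {x\<in>U. u x < ereal (real k)}) ` UNIV"
  have cov: "C \<subseteq> \<Union>G"
  proof
    fix x assume x: "x \<in> C"
    obtain k :: nat where "u x < ereal (real k)"
    proof (cases "u x")
      case (real r)
      obtain k :: nat where "r < real k" using reals_Archimedean2 by blast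
      then show ?thesis using real by (intro that[of k]) simp
    next
      case PInf then show ?thesis using fin[OF x] by simp
    next
      case MInf then show ?thesis by (intro that[of 0]) simp
    qed
    then show "x \<in> \<Union>G" using x C by (auto simp: G_def)
  qed
  obtain D where D: "D \<subseteq> G" "finite D" "C \<subseteq> \<Union>D"
    by (rule compactE[OF C(1) cov]) (auto simp: G_def op)
  obtain N where N: "finite N" "D = (\<lambda>k::nat. {x\<in>U. u x < ereal (real k)}) ` N"
    using D(1,2) unfolding G_def by (meson finite_subset_image)
  define A where "A = real (Max (insert 0 N))"
  show ?thesis
  proof (rule that[of A])
    show "0 \<le> A" by (simp add: A_def)
    fix x assume "x \<in> C"
    then obtain k where k: "k \<in> N" "u x < ereal (real k)" using D(3) N by auto
    have "k \<le> Max (insert 0 N)" using k N by (intro Max_ge) auto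
    then have "ereal (real k) \<le> ereal A" by (simp add: A_def)
    then show "u x \<le> ereal A" using k(2) by (meson less_imp_le order_trans)
  qed
qed

lemma sphere_measure_eq: "sphere_measure x r = distr unif_ball borel (\<lambda>z. x + r *\<^sub>R sgn z)"
  by (simp add: sphere_measure_def unif_ball_def)

lemma ereal_integral_sphere_measure:
  fixes w :: "'a::euclidean_space \<Rightarrow> real"
  assumes [measurable]: "w \<in> borel_measurable borel" and B: "\<And>x. \<bar>w x\<bar> \<le> B"
  shows "ereal_integral (sphere_measure x r) (\<lambda>y. ereal (w y)) = ereal (sph_mean w x r)"
proof -
  have "integrable (sphere_measure x r) w"
    unfolding sphere_measure_eq
    by (subst integrable_distr_eq) (use B in \<open>auto intro!: integrable_unif_ball_bounded[of _ B]\<close>)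
  then have "ereal_integral (sphere_measure x r) (\<lambda>y. ereal (w y)) = ereal (\<integral>y. w y \<partial>sphere_measure x r)"
    by (rule ereal_integral_real)
  also have "(\<integral>y. w y \<partial>sphere_measure x r) = sph_mean w x r"
    unfolding sphere_measure_eq sph_mean_def by (subst integral_distr) auto
  finally show ?thesis .
qed

lemma AE_sphere_measure: "0 \<le> r \<Longrightarrow> AE y in sphere_measure x r. y \<in> cball x r"
  unfolding sphere_measure_eq
  by (subst AE_distr_iff) (auto simp: dist_norm norm_sgn closed_Collect_le)

lemma distr_unif_ball_uminus: "distr unif_ball borel uminus = (unif_ball :: 'a::euclidean_space measure)"
proof (rule measure_eqI)
  fix A :: "'a set" assume "A \<in> sets (distr unif_ball borel uminus)"
  then have A: "A \<in> sets borel" by simp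
  have mA: "uminus -` A \<in> sets (borel :: 'a measure)"
    using measurable_sets[of uminus "borel :: 'a measure" borel A] A by simp
  have "emeasure lborel (ball 0 1 \<inter> A) = emeasure (distr lborel borel uminus) (ball 0 1 \<inter> A)"
    by (simp add: lborel_uminus)
  also have "\<dots> = emeasure lborel (uminus -` (ball 0 1 \<inter> A))"
    using A by (subst emeasure_distr) auto
  also have "uminus -` (ball 0 1 \<inter> A) = ball 0 1 \<inter> uminus -` A" by auto
  finally show "emeasure (distr unif_ball borel uminus) A = emeasure unif_ball A"
    using A mA by (subst emeasure_distr) (auto simp: unif_ball_def)
qed simp

text \<open>The uniform distribution on directions is symmetric, so a spherical mean averages midpoints of antipodal values.\<close>

lemma sph_mean_midpoint:
  fixes v :: "'a::euclidean_space \<Rightarrow> real"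
  assumes m: "(\<lambda>y. indicator (cball x r) y * v y) \<in> borel_measurable borel" and B: "\<And>y. y \<in> cball x r \<Longrightarrow> \<bar>v y\<bar> \<le> B"
    and r: "0 \<le> r" and mid: "\<And>p. norm p = r \<Longrightarrow> v x \<le> (v (x + p) + v (x - p)) / 2"
  shows "v x \<le> sph_mean v x r"
proof -
  define w where "w y = indicator (cball x r) y * v y" for y
  have [measurable]: "w \<in> borel_measurable borel" using m by (simp add: w_def[abs_def])
  have "0 \<le> B" using B[of x] r by force
  then have wB: "\<bar>w y\<bar> \<le> B" for y using B[of y] by (auto simp: w_def indicator_def)
  have wv: "w (x + p) = v (x + p)" "w (x - p) = v (x - p)" if "norm p = r" for p
    using that by (auto simp: w_def dist_norm)
  have i1: "integrable unif_ball (\<lambda>z. w (x + r *\<^sub>R sgn z))"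
    by (rule integrable_unif_ball_bounded[of _ B]) (use wB in auto)
  have i2: "integrable unif_ball (\<lambda>z. w (x - r *\<^sub>R sgn z))"
    by (rule integrable_unif_ball_bounded[of _ B]) (use wB in auto)
  have "(\<integral>z. w (x + r *\<^sub>R sgn z) \<partial>unif_ball) = (\<integral>z. w (x + r *\<^sub>R sgn z) \<partial>distr unif_ball borel uminus)"
    by (simp add: distr_unif_ball_uminus)
  also have "\<dots> = (\<integral>z. w (x - r *\<^sub>R sgn z) \<partial>unif_ball)"
    by (subst integral_distr) (auto simp: sgn_minus)
  finally have sym: "(\<integral>z. w (x - r *\<^sub>R sgn z) \<partial>unif_ball) = sph_mean w x r" by (simp add: sph_mean_def)
  have "v x = (\<integral>z. v x \<partial>(unif_ball :: 'a measure))" by simp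
  also have "\<dots> \<le> (\<integral>z. (w (x + r *\<^sub>R sgn z) + w (x - r *\<^sub>R sgn z)) / 2 \<partial>unif_ball)"
  proof (rule integral_mono_AE)
    show "AE z in unif_ball. v x \<le> (w (x + r *\<^sub>R sgn z) + w (x - r *\<^sub>R sgn z)) / 2"
      using AE_unif_ball_nonzero[where 'a='a]
    proof eventually_elim
      case (elim z)
      then have "norm (r *\<^sub>R sgn z) = r" using r by (simp add: norm_sgn)
      then show ?case using mid wv by metis
    qed
  qed (use i1 i2 in auto)
  also have "\<dots> = sph_mean w x r"
    using i1 i2 sym by (simp add: sph_mean_def add_divide_distrib)
  also have "\<dots> = sph_mean v x r"
    using r by (intro sph_mean_cong) (auto simp: w_def)
  finally show ?thesis .
qed

text \<open>Convexity for extended values, as it occurs in \<open>subharmonic_on\<close> in dimension one.\<close>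

definition ext_convex_on :: "'a::real_normed_vector set \<Rightarrow> ('a \<Rightarrow> ereal) \<Rightarrow> bool" where
  "ext_convex_on B u \<longleftrightarrow> (\<forall>y\<in>B. \<forall>z\<in>B. \<forall>t::real. 0 < t \<longrightarrow> t < 1 \<longrightarrow>
     u ((1 - t) *\<^sub>R y + t *\<^sub>R z) \<le> ereal (1 - t) * u y + ereal t * u z)"

text \<open>The point \<open>z\<close> lies strictly between \<open>y\<close> and a point \<open>p\<close> of the ball slightly beyond \<open>z\<close>, and \<open>u p < \<infinity>\<close>.\<close>

lemma ext_convex_minus_infinity:
  fixes x y z :: "'a::euclidean_space"
  assumes c: "ext_convex_on (ball x e) u" and fin: "\<And>y. y \<in> ball x e \<Longrightarrow> u y < \<infinity>"
    and y: "y \<in> ball x e" "u y = - \<infinity>" and z: "z \<in> ball x e"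
  shows "u z = - \<infinity>"
proof -
  define s where "s = (e - dist x z) / (norm (z - y) + 1)"
  have n1: "0 < norm (z - y) + 1" by (simp add: add_nonneg_pos)
  have s: "0 < s" using z n1 by (simp add: s_def)
  define p where "p = z + s *\<^sub>R (z - y)"
  have "dist x p \<le> dist x z + s * norm (z - y)"
    using dist_triangle[of x p z] s by (simp add: p_def dist_norm)
  also have "s * norm (z - y) < s * (norm (z - y) + 1)" using s by simp
  also have "s * (norm (z - y) + 1) = e - dist x z" using n1 by (simp add: s_def)
  finally have p: "p \<in> ball x e" by simp
  define t where "t = 1 / (1 + s)"
  have t: "0 < t" "t < 1" using s by (auto simp: t_def)
  have ts: "t * s = 1 - t" using s by (simp add: t_def field_simps)
  have "(1 - t) *\<^sub>R y + t *\<^sub>R p = (1 - t) *\<^sub>R y + t *\<^sub>R z + (t * s) *\<^sub>R (z - y)"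
    by (simp add: p_def algebra_simps)
  also have "\<dots> = z" unfolding ts by (simp add: algebra_simps)
  finally have "u z \<le> ereal (1 - t) * u y + ereal t * u p"
    using c y(1) p t unfolding ext_convex_on_def by metis
  also have "ereal (1 - t) * u y = - \<infinity>" using t y(2) by simp
  also have "- \<infinity> + ereal t * u p = - \<infinity>"
    using fin[OF p] t by (cases "u p") auto
  finally show ?thesis by simp
qed

text \<open>Such a function is constantly \<open>- \<infinity>\<close> on the ball or real-valued and convex, hence continuous.\<close>

lemma ext_convex_usc:
  fixes x :: "'a::euclidean_space"
  assumes c: "ext_convex_on (ball x e) u" and fin: "\<And>y. y \<in> ball x e \<Longrightarrow> u y < \<infinity>"
  shows "open {y \<in> ball x e. u y < a}"
proof (cases "\<exists>y\<in>ball x e. u y = - \<infinity>")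
  case True
  then have "u y = - \<infinity>" if "y \<in> ball x e" for y
    using ext_convex_minus_infinity[OF c fin] that by blast
  then have "{y \<in> ball x e. u y < a} = (if - \<infinity> < a then ball x e else {})" by auto
  then show ?thesis by simp
next
  case False
  define f where "f y = real_of_ereal (u y)" for y
  have uf: "u y = ereal (f y)" if "y \<in> ball x e" for y
    using False fin[OF that] that by (cases "u y") (auto simp: f_def)
  have "convex_on (ball x e) f"
  proof (rule convex_onI)
    fix t :: real and y z assume t: "0 < t" "t < 1" and yz: "y \<in> ball x e" "z \<in> ball x e"
    have m: "(1 - t) *\<^sub>R y + t *\<^sub>R z \<in> ball x e"
      using convexD[OF convex_ball yz, of "1 - t" t] t by simp
    have "u ((1 - t) *\<^sub>R y + t *\<^sub>R z) \<le> ereal (1 - t) * u y + ereal t * u z"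
      using c yz t unfolding ext_convex_on_def by blast
    then show "f ((1 - t) *\<^sub>R y + t *\<^sub>R z) \<le> (1 - t) * f y + t * f z"
      using yz m by (simp add: uf)
  qed simp
  then have "continuous_on (ball x e) f" by (intro convex_on_continuous) simp_all
  then have "continuous_on (ball x e) (\<lambda>y. ereal (f y))" by (intro continuous_intros)
  then have "open ((\<lambda>y. ereal (f y)) -` {..<a} \<inter> ball x e)"
    using continuous_on_open_vimage[of "ball x e" "\<lambda>y. ereal (f y)"] by simp
  moreover have "(\<lambda>y. ereal (f y)) -` {..<a} \<inter> ball x e = {y \<in> ball x e. u y < a}" using uf by auto
  ultimately show ?thesis by simp
qed

lemma subharmonic_on_finite: "subharmonic_on u \<Omega> \<Longrightarrow> x \<in> \<Omega> \<Longrightarrow> u x < \<infinity>"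
  unfolding subharmonic_on_def by blast

lemma subharmonic_on_dim1:
  fixes u :: "'a::euclidean_space \<Rightarrow> ereal"
  assumes "subharmonic_on u \<Omega>" "DIM('a) = 1" "x \<in> \<Omega>"
  shows "\<exists>e>0. ball x e \<subseteq> \<Omega> \<and> ext_convex_on (ball x e) u"
  using assms unfolding subharmonic_on_def ext_convex_on_def by simp

lemma subharmonic_on_usc:
  fixes u :: "'a::euclidean_space \<Rightarrow> ereal"
  assumes \<Omega>: "open \<Omega>" and u: "subharmonic_on u \<Omega>"
  shows "open {x\<in>\<Omega>. u x < a}"
proof (cases "DIM('a) = 1")
  case False
  then have "openin (top_of_set \<Omega>) {x\<in>\<Omega>. u x < a}" using u unfolding subharmonic_on_def by simp
  then show ?thesis using \<Omega> by (simp add: openin_open_eq)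
next
  case True
  show ?thesis
  proof (subst open_subopen, intro ballI)
    fix x assume x: "x \<in> {x\<in>\<Omega>. u x < a}"
    then obtain e where e: "e > 0" "ball x e \<subseteq> \<Omega>" "ext_convex_on (ball x e) u"
      using subharmonic_on_dim1[OF u True, of x] by blast
    have "open {y \<in> ball x e. u y < a}"
      by (rule ext_convex_usc[OF e(3)]) (use subharmonic_on_finite[OF u] e(2) in blast)
    then show "\<exists>T. open T \<and> x \<in> T \<and> T \<subseteq> {x\<in>\<Omega>. u x < a}"
      using x e by (intro exI[of _ "{y \<in> ball x e. u y < a}"]) auto
  qed
qed

lemma truncate_midpoint:
  assumes c: "ext_convex_on B u" and fin: "\<And>y. y \<in> B \<Longrightarrow> u y < \<infinity>" and p: "x \<in> B" "x + p \<in> B" "x - p \<in> B"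
  shows "truncate_below n u x \<le> (truncate_below n u (x + p) + truncate_below n u (x - p)) / 2"
proof (rule truncate_below_le)
  show "u x < \<infinity>" by (rule fin[OF p(1)])
  show "- real n \<le> (truncate_below n u (x + p) + truncate_below n u (x - p)) / 2"
    using truncate_below_ge[of u "x + p" n] truncate_below_ge[of u "x - p" n] fin p by simp
  have half: "(1 - 1 / 2) *\<^sub>R (x + p) + (1 / 2 :: real) *\<^sub>R (x - p) = x"
    by (simp add: algebra_simps flip: scaleR_add_left)
  have "u ((1 - 1 / 2) *\<^sub>R (x + p) + (1 / 2 :: real) *\<^sub>R (x - p)) \<le> ereal (1 - 1 / 2) * u (x + p) + ereal (1 / 2) * u (x - p)"
    using c p unfolding ext_convex_on_def by (metis half_gt_zero_iff zero_less_one field_sum_of_halves less_add_same_cancel1)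
  then have "u x \<le> ereal (1 / 2) * u (x + p) + ereal (1 / 2) * u (x - p)"
    unfolding half by simp
  also have "\<dots> \<le> ereal (1 / 2) * ereal (truncate_below n u (x + p)) + ereal (1 / 2) * ereal (truncate_below n u (x - p))"
    using fin p by (intro add_mono ereal_mult_left_mono le_truncate_below) auto
  finally show "u x \<le> ereal ((truncate_below n u (x + p) + truncate_below n u (x - p)) / 2)"
    by (simp add: add_divide_distrib)
qed

text \<open>In dimension one the submean inequality is midpoint convexity, and the Lebesgue number of the cover by balls of convexity gives a uniform
radius. In higher dimension it is part of the definition and survives truncation, since both \<open>u\<close> and the constant
\<open>- n\<close> lie below the truncated function.\<close>

lemma subharmonic_on_usc_submean:
  fixes u :: "'a::euclidean_space \<Rightarrow> ereal"
  assumes \<Omega>: "open \<Omega>" and u: "subharmonic_on u \<Omega>"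
  shows "usc_submean (truncate_below n u) \<Omega>"
proof -
  note op = subharmonic_on_usc[OF \<Omega> u] and fin = subharmonic_on_finite[OF u]
  have meas: "(\<lambda>x. indicator C x * truncate_below n u x) \<in> borel_measurable borel"
    if "compact C" "C \<subseteq> \<Omega>" for C
    by (rule borel_measurable_truncate_below[of C u \<Omega>]) (use that fin op in \<open>auto simp: compact_imp_closed\<close>)
  have bdd: "\<exists>B. \<forall>x\<in>C. \<bar>truncate_below n u x\<bar> \<le> B" if C: "compact C" "C \<subseteq> \<Omega>" for C
  proof -
    obtain A where A: "0 \<le> A" "\<And>x. x \<in> C \<Longrightarrow> u x \<le> ereal A"
      using usc_bounded_above[of C u \<Omega>] C fin op by blast
    have "\<bar>truncate_below n u x\<bar> \<le> A + real n" if x: "x \<in> C" for x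
    proof -
      have ux: "u x < \<infinity>" using fin C x by blast
      have "truncate_below n u x \<le> A" using truncate_below_le[of u x n A] ux A x by simp
      then show ?thesis using truncate_below_ge[of u x n] ux A(1) by auto
    qed
    then show ?thesis by blast
  qed
  have sub: "\<exists>q>0. \<forall>x\<in>C. \<forall>r. 0 < r \<longrightarrow> r < q \<longrightarrow> truncate_below n u x \<le> sph_mean (truncate_below n u) x r"
    if C: "compact C" "C \<subseteq> \<Omega>" for C
  proof (cases "DIM('a) = 1")
    case True
    define G where "G = {ball x e | x e. 0 < e \<and> ball x e \<subseteq> \<Omega> \<and> ext_convex_on (ball x e) u}"
    have cov: "C \<subseteq> \<Union>G"
    proof
      fix x assume "x \<in> C"
      then obtain e where "e > 0" "ball x e \<subseteq> \<Omega>" "ext_convex_on (ball x e) u"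
        using subharmonic_on_dim1[OF u True, of x] C by blast
      then have "ball x e \<in> G" "x \<in> ball x e" by (auto simp: G_def)
      then show "x \<in> \<Union>G" by blast
    qed
    obtain q where q: "0 < q" "\<And>x. x \<in> C \<Longrightarrow> \<exists>B\<in>G. ball x q \<subseteq> B"
    proof -
      have opG: "open B" if "B \<in> G" for B using that by (auto simp: G_def)
      show ?thesis by (rule Heine_Borel_lemma[OF C(1) cov opG]) (auto intro: that)
    qed
    have "truncate_below n u x \<le> sph_mean (truncate_below n u) x r" if x: "x \<in> C" and r: "0 < r" "r < q" for x r
    proof -
      obtain B where B: "B \<in> G" "ball x q \<subseteq> B" using q(2)[OF x] by blast
      then have B: "ball x q \<subseteq> B" "B \<subseteq> \<Omega>" "ext_convex_on B u" by (auto simp: G_def)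
      have "cball x r \<subseteq> ball x q" using r by auto
      then have cb: "cball x r \<subseteq> B" using B(1) by (rule order_trans)
      have cO: "cball x r \<subseteq> \<Omega>" using cb B(2) by (rule order_trans)
      obtain D where "\<forall>y\<in>cball x r. \<bar>truncate_below n u y\<bar> \<le> D" using bdd[OF compact_cball cO] by blast
      then show ?thesis
      proof (intro sph_mean_midpoint[OF meas[OF compact_cball cO], of D])
        show "truncate_below n u x \<le> (truncate_below n u (x + p) + truncate_below n u (x - p)) / 2" if "norm p = r" for p
        proof (rule truncate_midpoint[OF B(3)])
          have "x \<in> cball x r" "x + p \<in> cball x r" "x - p \<in> cball x r" using that r by (auto simp: dist_norm)
          then show "x \<in> B" "x + p \<in> B" "x - p \<in> B" using cb by auto
        qed (use fin B(2) in blast)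
      qed (use r in auto)
    qed
    then show ?thesis using q(1) by blast
  next
    case False
    obtain q where q: "q > 0" "(\<Union>x\<in>C. ball x q) \<subseteq> \<Omega>"
      using compact_subset_open_imp_ball_epsilon_subset[OF C(1) \<Omega> C(2)] by blast
    have "truncate_below n u x \<le> sph_mean (truncate_below n u) x r" if x: "x \<in> C" and r: "0 < r" "r < q" for x r
    proof -
      have cO: "cball x r \<subseteq> \<Omega>"
      proof -
        have "cball x r \<subseteq> ball x q" using r by auto
        then show ?thesis using q(2) x by blast
      qed
      have xO: "x \<in> \<Omega>" using x C by blast
      obtain D where D: "\<forall>y\<in>cball x r. \<bar>truncate_below n u y\<bar> \<le> D" using bdd[OF compact_cball cO] by blast
      define w where "w y = indicator (cball x r) y * truncate_below n u y" for y
      have wm: "w \<in> borel_measurable borel" unfolding w_def by (rule meas[OF compact_cball cO])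
      have "\<bar>truncate_below n u x\<bar> \<le> D" using D r by simp
      then have "0 \<le> D" by linarith
      then have wB: "\<bar>w y\<bar> \<le> D" for y using D by (auto simp: w_def indicator_def)
      have wy: "u y \<le> ereal (w y)" "- real n \<le> w y" if y: "y \<in> cball x r" for y
      proof -
        have "u y < \<infinity>" using cO y fin by blast
        moreover have "w y = truncate_below n u y" using y by (simp add: w_def)
        ultimately show "u y \<le> ereal (w y)" "- real n \<le> w y"
          using le_truncate_below[of u y n] truncate_below_ge[of u y n] by simp_all
      qed
      have ae: "AE y in sphere_measure x r. y \<in> cball x r" by (rule AE_sphere_measure) (use r in simp)
      have eq: "sph_mean w x r = sph_mean (truncate_below n u) x r"
        using r by (intro sph_mean_cong) (auto simp: w_def)
      have "u x \<le> ereal_integral (sphere_measure x r) u"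
        using u False r cO unfolding subharmonic_on_def by auto
      also have "\<dots> \<le> ereal_integral (sphere_measure x r) (\<lambda>y. ereal (w y))"
        by (rule ereal_integral_mono)
           (use ae wy(1) in \<open>auto elim!: eventually_mono\<close>)
      also have "\<dots> = ereal (sph_mean w x r)" by (rule ereal_integral_sphere_measure[OF wm wB])
      finally have 1: "u x \<le> ereal (sph_mean (truncate_below n u) x r)" unfolding eq .
      have "ereal (- real n) = ereal_integral (sphere_measure x r) (\<lambda>y. ereal (- real n))"
        using ereal_integral_sphere_measure[of "\<lambda>y. - real n" "real n" x r] by (simp add: sph_mean_def)
      also have "\<dots> \<le> ereal_integral (sphere_measure x r) (\<lambda>y. ereal (w y))"
        by (rule ereal_integral_mono)
           (use ae wy(2) in \<open>auto elim!: eventually_mono\<close>)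
      also have "\<dots> = ereal (sph_mean w x r)" by (rule ereal_integral_sphere_measure[OF wm wB])
      finally have 2: "- real n \<le> sph_mean (truncate_below n u) x r" unfolding eq by simp
      show ?thesis using truncate_below_le[of u x n, OF fin[OF xO]] 1 2 by blast
    qed
    then show ?thesis using q(1) by blast
  qed
  have usc: "\<exists>d>0. \<forall>y. dist y x < d \<longrightarrow> truncate_below n u y < a"
    if x: "x \<in> \<Omega>" and a: "truncate_below n u x < a" for x a
  proof -
    have "x \<in> {x\<in>\<Omega>. u x < ereal a}" "- real n < a" using a x fin by (auto simp: truncate_below_less_iff)
    moreover obtain d where "d > 0" "\<And>y. dist y x < d \<Longrightarrow> y \<in> {x\<in>\<Omega>. u x < ereal a}"
      using op[of "ereal a"] calculation(1) unfolding open_dist by blast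
    ultimately show ?thesis
      using fin by (intro exI[of _ d]) (auto simp: truncate_below_less_iff)
  qed
  show ?thesis
    unfolding usc_submean_def using meas bdd sub usc by simp
qed

text \<open>Truncation leaves the positive part unchanged, whose integral is finite since \<open>u\<close> is bounded above on \<open>K\<close>; the negative
parts increase to that of \<open>u\<close>.\<close>

lemma ereal_integral_truncate_tendsto:
  fixes u :: "'a::euclidean_space \<Rightarrow> ereal"
  assumes M: "concentrated_measure M K" and K: "K \<subseteq> \<Omega>" and \<Omega>: "open \<Omega>" and u: "subharmonic_on u \<Omega>"
  shows "(\<lambda>n. ereal (\<integral>x. indicator K x * truncate_below n u x \<partial>M)) \<longlonglongrightarrow> ereal_integral M u"
proof -
  interpret concentrated_measure M K by fact
  note op = subharmonic_on_usc[OF \<Omega> u] and fin = subharmonic_on_finite[OF u]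
  define u' where "u' x = (if x \<in> K then u x else 0)" for x
  have finu: "u' x < \<infinity>" for x using fin K by (auto simp: u'_def)
  have u'b: "u' \<in> borel_measurable borel"
  proof (rule borel_measurableI_less)
    fix a
    have "{x \<in> space borel. u' x < a} = (K \<inter> {x\<in>\<Omega>. u x < a}) \<union> (if 0 < a then - K else {})"
      using K by (auto simp: u'_def)
    also have "\<dots> \<in> sets borel"
      using op compact_K by (auto intro!: sets.Un sets.Int borel_closed simp: compact_imp_closed)
    finally show "{x \<in> space borel. u' x < a} \<in> sets borel" .
  qed
  have um [measurable]: "u' \<in> borel_measurable M" by (rule borel_measurable_M[OF u'b])
  have eq: "ereal_integral M u = ereal_integral M u'"
    by (rule ereal_integral_cong_AE) (use AE_K in \<open>auto simp: u'_def elim!: eventually_mono\<close>)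
  obtain A where A: "0 \<le> A" "\<And>x. x \<in> K \<Longrightarrow> u x \<le> ereal A"
    using usc_bounded_above[of K u \<Omega>] compact_K K fin op by blast
  define P where "P = (\<integral>\<^sup>+x. e2ennreal (u' x) \<partial>M)"
  have "P \<le> (\<integral>\<^sup>+x. ennreal A \<partial>M)"
    unfolding P_def
  proof (rule nn_integral_mono)
    fix x
    have "u' x \<le> ereal A" using A by (auto simp: u'_def)
    then show "e2ennreal (u' x) \<le> ennreal A" by (metis e2ennreal_mono e2ennreal_ereal)
  qed
  also have "\<dots> < \<infinity>" using A(1) by (simp add: emeasure_eq_measure flip: ennreal_mult)
  finally have P: "P < \<infinity>" .
  define N where "N n = (\<integral>\<^sup>+x. e2ennreal (- max (u' x) (ereal (- real n))) \<partial>M)" for n :: nat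
  have "N \<longlonglongrightarrow> (\<integral>\<^sup>+x. e2ennreal (- u' x) \<partial>M)"
    unfolding N_def
  proof (rule nn_integral_LIMSEQ)
    show "incseq (\<lambda>n x. e2ennreal (- max (u' x) (ereal (- real n))))"
    proof (intro monoI le_funI e2ennreal_mono)
      fix m n :: nat and x :: 'a assume "m \<le> n"
      then have "max (u' x) (ereal (- real n)) \<le> max (u' x) (ereal (- real m))" by (intro max.mono) auto
      then show "- max (u' x) (ereal (- real m)) \<le> - max (u' x) (ereal (- real n))" by simp
    qed
    show "(\<lambda>n. e2ennreal (- max (u' x) (ereal (- real n)))) \<longlonglongrightarrow> e2ennreal (- u' x)" for x
    proof (rule tendsto_e2ennrealI, rule tendsto_uminus_ereal)
      show "(\<lambda>n. max (u' x) (ereal (- real n))) \<longlonglongrightarrow> u' x"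
      proof (cases "u' x")
        case (real a)
        obtain m :: nat where "- a < real m" using reals_Archimedean2 by blast
        then have "eventually (\<lambda>n. max (u' x) (ereal (- real n)) = u' x) sequentially"
          by (intro eventually_sequentiallyI[of m]) (auto simp: real max_def)
        then show ?thesis by (rule tendsto_eventually)
      next
        case PInf then show ?thesis using finu[of x] by simp
      next
        case MInf
        have "(\<lambda>n. ereal (- real n)) \<longlonglongrightarrow> - \<infinity>"
          unfolding tendsto_MInfty
        proof
          fix a :: real
          obtain m :: nat where "- a < real m" using reals_Archimedean2 by blast
          then show "eventually (\<lambda>n. ereal (- real n) < ereal a) sequentially"
            by (intro eventually_sequentiallyI[of m]) simp
        qed
        then show ?thesis using MInf by (simp add: max_def)
      qed
    qed
  qed measurable
  then have lim: "(\<lambda>n. enn2ereal P - enn2ereal (N n)) \<longlonglongrightarrow> enn2ereal P - enn2ereal (\<integral>\<^sup>+x. e2ennreal (- u' x) \<partial>M)"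
    using P by (intro tendsto_diff_ereal_general tendsto_const tendsto_enn2erealI) (auto simp: enn2ereal_eq_top_iff)
  have "ereal (\<integral>x. indicator K x * truncate_below n u x \<partial>M) = enn2ereal P - enn2ereal (N n)" for n
  proof -
    have v: "usc_submean (truncate_below n u) \<Omega>" by (rule subharmonic_on_usc_submean[OF \<Omega> u])
    then have bm: "(\<lambda>x. indicator K x * truncate_below n u x) \<in> borel_measurable borel"
      and "\<exists>B. \<forall>x\<in>K. \<bar>truncate_below n u x\<bar> \<le> B"
      using compact_K K unfolding usc_submean_def by blast+
    then obtain B where "\<forall>x\<in>K. \<bar>truncate_below n u x\<bar> \<le> B" by blast
    then have "integrable M (\<lambda>x. indicator K x * truncate_below n u x)"
      by (intro integrable_bounded[OF bm, of B]) auto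
    from ereal_integral_real[OF this]
    have "ereal (\<integral>x. indicator K x * truncate_below n u x \<partial>M) = ereal_integral M (\<lambda>x. ereal (indicator K x * truncate_below n u x))"
      by simp
    also have "(\<lambda>x. ereal (indicator K x * truncate_below n u x)) = (\<lambda>x. max (u' x) (ereal (- real n)))"
    proof
      fix x show "ereal (indicator K x * truncate_below n u x) = max (u' x) (ereal (- real n))"
      proof (cases "x \<in> K")
        case True
        then show ?thesis using fin K by (simp add: u'_def ereal_truncate_below subset_iff)
      next
        case False
        then show ?thesis by (simp add: u'_def max_def zero_ereal_def)
      qed
    qed
    also have "ereal_integral M \<dots> = enn2ereal P - enn2ereal (N n)"
    proof -
      have "e2ennreal (max a (ereal (- real n))) = e2ennreal a" for a
      proof (cases "a \<le> ereal (- real n)")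
        case True
        have n0: "ereal (- real n) \<le> 0" by (simp add: zero_ereal_def)
        have "a \<le> 0" using True n0 by (rule order_trans)
        then show ?thesis
          using True e2ennreal_neg[OF n0] by (simp only: max_absorb2 e2ennreal_neg)
      next
        case False
        then show ?thesis by (simp add: max_def)
      qed
      then show ?thesis by (simp add: ereal_integral_def P_def N_def)
    qed
    finally show ?thesis .
  qed
  with lim show ?thesis unfolding eq unfolding ereal_integral_def P_def[symmetric] by simp
qed

lemma subharmonic_balayage_of_kernels:
  fixes \<Omega> :: "'a::euclidean_space set"
  assumes \<Omega>: "open \<Omega>" and \<delta>: "concentrated_measure \<delta> K" and \<omega>: "concentrated_measure \<omega> K" and K: "K \<subseteq> \<Omega>"
    and S: "compact S" "S \<subseteq> \<Omega>"
    and bal: "balayage (Kclass \<Omega> \<union> neg_Kclass (\<Omega> - S)) \<delta> \<omega>"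
  shows "balayage (sbh \<Omega>) \<delta> \<omega>"
  unfolding balayage_def
proof
  fix u assume "u \<in> sbh \<Omega>"
  then have u: "subharmonic_on u \<Omega>" by (simp add: sbh_def)
  show "ereal_integral \<delta> u \<le> ereal_integral \<omega> u"
  proof (rule LIMSEQ_le[OF ereal_integral_truncate_tendsto[OF \<delta> K \<Omega> u] ereal_integral_truncate_tendsto[OF \<omega> K \<Omega> u]], intro exI allI impI)
    show "ereal (\<integral>x. indicator K x * truncate_below n u x \<partial>\<delta>) \<le> ereal (\<integral>x. indicator K x * truncate_below n u x \<partial>\<omega>)" for n
      using balayage_usc_submean[OF \<Omega> \<delta> \<omega> K S bal subharmonic_on_usc_submean[OF \<Omega> u]] by simp
  qed
qed

section \<open>The kernel and harmonic functions are subharmonic\<close>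

lemma radial_kernel_unbounded_below:
  assumes "DIM('a::euclidean_space) \<ge> 2"
  shows "\<exists>t>0. radial_kernel TYPE('a) t < a"
proof (cases "DIM('a) = 2")
  case True
  then show ?thesis by (intro exI[of _ "exp (a - 1)"]) (simp add: radial_kernel_def kfun_def)
next
  case False
  define m where "m = real DIM('a) - 2"
  have m: "0 < m" using assms False by (simp add: m_def)
  define t where "t = (\<bar>a\<bar> + 1) powr (- 1 / m)"
  have "radial_kernel TYPE('a) t = - (t powr (- m))" using m by (simp add: radial_kernel_def kfun_def m_def)
  also have "t powr (- m) = \<bar>a\<bar> + 1" using m by (simp add: t_def powr_powr)
  finally show ?thesis by (intro exI[of _ t]) (auto simp: t_def)
qed

lemma radial_kernel_isCont: "0 < t \<Longrightarrow> isCont (radial_kernel TYPE('a::euclidean_space)) t"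
  using radial_kernel_deriv DERIV_isCont by blast

text \<open>The kernel is the infimum of the regularised kernels, also at its pole; this gives upper semicontinuity and
measurability there as well.\<close>

lemma kernel_less_iff:
  fixes x y :: "'a::euclidean_space"
  assumes d: "DIM('a) \<ge> 2"
  shows "kernel y x < ereal a \<longleftrightarrow> (\<exists>e>0. smooth_kernel e (y - x) < a)"
proof (cases "y = x")
  case True
  obtain t where t: "t > 0" "radial_kernel TYPE('a) t < a" using radial_kernel_unbounded_below[OF d] by blast
  then have "smooth_kernel (t\<^sup>2) (y - x) < a" using True by (simp add: smooth_kernel_def)
  then show ?thesis using True d t(1) by (auto simp: kernel_def intro!: exI[of _ "t\<^sup>2"])
next
  case False
  then have n: "0 < norm (y - x)" by simp
  have k: "kernel y x = ereal (radial_kernel TYPE('a) (norm (y - x)))"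
    using False by (simp add: kernel_eq_radial_kernel norm_minus_commute)
  show ?thesis
  proof
    assume "kernel y x < ereal a"
    then have less: "radial_kernel TYPE('a) (norm (y - x)) < a" using k by simp
    have "((\<lambda>e. sqrt ((norm (y - x))\<^sup>2 + e)) \<longlongrightarrow> sqrt ((norm (y - x))\<^sup>2 + 0)) (at_right 0)"
      by (intro tendsto_intros)
    then have "((\<lambda>e. sqrt ((norm (y - x))\<^sup>2 + e)) \<longlongrightarrow> norm (y - x)) (at_right 0)" by simp
    then have "((\<lambda>e. radial_kernel TYPE('a) (sqrt ((norm (y - x))\<^sup>2 + e))) \<longlongrightarrow> radial_kernel TYPE('a) (norm (y - x))) (at_right 0)"
      by (rule isCont_tendsto_compose[OF radial_kernel_isCont[OF n]])
    then have "eventually (\<lambda>e. smooth_kernel e (y - x) < a) (at_right 0)"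
      unfolding smooth_kernel_def using less by (rule order_tendstoD(2))
    then show "\<exists>e>0. smooth_kernel e (y - x) < a"
      unfolding eventually_at_right_field using zero_less_one dense by (metis dense)
  next
    assume "\<exists>e>0. smooth_kernel e (y - x) < a"
    then obtain e where e: "e > 0" "smooth_kernel e (y - x) < a" by blast
    have "radial_kernel TYPE('a) (norm (y - x)) \<le> smooth_kernel e (y - x)"
      unfolding smooth_kernel_def using e(1) by (intro radial_kernel_mono[OF n] real_le_rsqrt) simp
    then show "kernel y x < ereal a" using e(2) k by simp
  qed
qed

lemma continuous_on_smooth_kernel: "0 < e \<Longrightarrow> continuous_on UNIV (smooth_kernel e :: 'a::euclidean_space \<Rightarrow> real)"
proof -
  assume e: "0 < e"
  obtain g h where C: "C2_on {x::'a. 0 < (norm x)\<^sup>2 + e} (smooth_kernel e) g h"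
    using smooth_kernel_harmonicity[of e, where 'a='a] e by (metis less_imp_le)
  moreover have "{x::'a. 0 < (norm x)\<^sup>2 + e} = UNIV" using e by (auto intro: add_nonneg_pos)
  ultimately show ?thesis using C2_on_continuous(1)[OF C] by simp
qed

lemma open_kernel_less:
  fixes x :: "'a::euclidean_space"
  assumes d: "DIM('a) \<ge> 2"
  shows "open {y. kernel y x < a}"
proof (cases a)
  case (real r)
  have "{y. kernel y x < a} = (\<Union>e\<in>{0<..}. {y. smooth_kernel e (y - x) < r})"
    using real kernel_less_iff[OF d, of _ x r] by auto
  moreover have "open {y. smooth_kernel e (y - x) < r}" if "0 < e" for e
  proof -
    have "continuous_on UNIV (\<lambda>y. smooth_kernel e (y - x))"
      by (rule continuous_on_compose2[OF continuous_on_smooth_kernel[OF that]]) (auto intro!: continuous_intros)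
    then show ?thesis by (intro open_Collect_less) auto
  qed
  ultimately show ?thesis by auto
next
  case PInf
  have "{y. kernel y x < a} = UNIV" using PInf by (auto simp: kernel_def zero_ereal_def)
  then show ?thesis by simp
next
  case MInf
  then show ?thesis by simp
qed

lemma borel_measurable_kernel:
  fixes x :: "'a::euclidean_space"
  assumes d: "DIM('a) \<ge> 2"
  shows "(\<lambda>y. kernel y x) \<in> borel_measurable borel"
  by (rule borel_measurableI_less) (use open_kernel_less[OF d] in auto)

text \<open>A sphere meets a given point in at most one direction, and the points of the ball with this direction lie on a line, which is a null
set in dimension at least two.\<close>

lemma AE_unif_ball_direction:
  fixes p :: "'a::euclidean_space"
  assumes d: "DIM('a) \<ge> 2" and r: "0 < r"
  shows "AE z in unif_ball. p + r *\<^sub>R sgn z \<noteq> 0"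
proof -
  have "dim (span {p}) \<le> 1"
    using dim_le_card'[of "{p}"] by (simp add: dim_span)
  then have "negligible (span {p})" using d by (intro negligible_lowdim) simp
  then have "span {p} \<in> null_sets lborel"
    by (auto simp: null_sets_completion_iff negligible_iff_null_sets closed_span borel_closed)
  then have "AE z in lborel. z \<notin> span {p}" by (rule AE_not_in)
  then have "AE z in unif_ball. z \<notin> span {p}"
    unfolding unif_ball_def by (intro AE_uniform_measureI) auto
  then show ?thesis
  proof eventually_elim
    case (elim z)
    show ?case
    proof
      assume "p + r *\<^sub>R sgn z = 0"
      then have "r *\<^sub>R sgn z = - p" by (simp add: eq_neg_iff_add_eq_0 add.commute)
      then have "(1 / r) *\<^sub>R (r *\<^sub>R sgn z) = (1 / r) *\<^sub>R (- p)" by simp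
      then have "sgn z = (- 1 / r) *\<^sub>R p" using r by simp
      moreover have "z = norm z *\<^sub>R sgn z" by (cases "z = 0") (simp_all add: sgn_div_norm)
      ultimately have "z = (norm z * (- 1 / r)) *\<^sub>R p" by (metis scaleR_scaleR)
      then have "z \<in> span {p}" by (metis span_breakdown_eq span_mul span_base singletonI)
      then show False using elim by blast
    qed
  qed
qed

text \<open>The regularised kernels satisfy the submean inequality and decrease to the kernel, so monotone convergence yields
integrability over the sphere as well, even when the pole lies on it.\<close>

lemma kernel_sphere_integrable:
  fixes p :: "'a::euclidean_space"
  assumes d: "DIM('a) \<ge> 2" and r: "0 < r" and p: "p \<noteq> 0"
  shows "integrable unif_ball (\<lambda>z. radial_kernel TYPE('a) (norm (p + r *\<^sub>R sgn z)))"
    and "radial_kernel TYPE('a) (norm p) \<le> (\<integral>z. radial_kernel TYPE('a) (norm (p + r *\<^sub>R sgn z)) \<partial>unif_ball)"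
proof -
  define e where "e n = 1 / (real n + 1)" for n :: nat
  have e: "0 < e n" for n by (simp add: e_def)
  have e0: "e \<longlonglongrightarrow> 0" unfolding e_def by real_asymp
  define f where "f n z = - smooth_kernel (e n) (p + r *\<^sub>R sgn z)" for n and z :: 'a
  have cont: "continuous_on UNIV (smooth_kernel (e n) :: 'a \<Rightarrow> real)" for n by (rule continuous_on_smooth_kernel[OF e])
  have [measurable]: "smooth_kernel (e n) \<in> borel_measurable (borel :: 'a measure)" for n
    using cont by (rule borel_measurable_continuous_onI)
  have int: "integrable unif_ball (f n)" for n
  proof -
    have "compact (smooth_kernel (e n) ` cball p r)"
      by (rule compact_continuous_image[OF continuous_on_subset[OF cont] compact_cball]) simp
    then obtain B where B: "\<forall>x\<in>cball p r. \<bar>smooth_kernel (e n) x\<bar> \<le> B"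
      by (auto simp: bounded_iff dest!: compact_imp_bounded)
    show ?thesis unfolding f_def
    proof (rule unif_ball.integrable_const_bound[of _ B])
      have "p + r *\<^sub>R sgn z \<in> cball p r" for z using r by (simp add: dist_norm norm_sgn)
      then have "\<bar>smooth_kernel (e n) (p + r *\<^sub>R sgn z)\<bar> \<le> B" for z using B by blast
      then show "AE z in unif_ball. norm (- smooth_kernel (e n) (p + r *\<^sub>R sgn z)) \<le> B" by simp
    qed simp
  qed
  have intf: "(\<integral>z. f n z \<partial>unif_ball) = - sph_mean (smooth_kernel (e n)) p r" for n
    by (simp add: f_def sph_mean_def)
  have mono: "f m z \<le> f n z" if "m \<le> n" for m n z
  proof -
    have "e n \<le> e m" using that by (simp add: e_def field_simps)
    then have "smooth_kernel (e n) w \<le> smooth_kernel (e m) w" for w :: 'a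
      unfolding smooth_kernel_def using e[of n] by (intro radial_kernel_mono) (auto intro: add_nonneg_pos)
    then show ?thesis by (simp add: f_def)
  qed
  have bound: "(\<integral>z. f n z \<partial>unif_ball) \<le> - radial_kernel TYPE('a) (norm p)" for n
  proof -
    have "radial_kernel TYPE('a) (norm p) \<le> smooth_kernel (e n) p"
      unfolding smooth_kernel_def using e[of n] p by (intro radial_kernel_mono real_le_rsqrt) auto
    also have "\<dots> \<le> sph_mean (smooth_kernel (e n)) p r" by (rule sph_mean_smooth_kernel[OF e r])
    finally show ?thesis by (simp add: intf)
  qed
  have "incseq (\<lambda>n. \<integral>z. f n z \<partial>unif_ball)"
    using mono int by (intro monoI integral_mono) auto
  from incseq_convergent[OF this] bound
  obtain L where L: "(\<lambda>n. \<integral>z. f n z \<partial>unif_ball) \<longlonglongrightarrow> L" by metis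
  have "L \<le> - radial_kernel TYPE('a) (norm p)"
    by (rule LIMSEQ_le_const2[OF L]) (use bound in auto)
  have lim: "AE z in unif_ball. (\<lambda>n. f n z) \<longlonglongrightarrow> - radial_kernel TYPE('a) (norm (p + r *\<^sub>R sgn z))"
    using AE_unif_ball_direction[OF d r, of p]
  proof eventually_elim
    case (elim z)
    define w where "w = p + r *\<^sub>R sgn z"
    have w: "0 < norm w" using elim by (simp add: w_def)
    have "(\<lambda>n. sqrt ((norm w)\<^sup>2 + e n)) \<longlonglongrightarrow> sqrt ((norm w)\<^sup>2 + 0)"
      by (intro tendsto_intros e0)
    then have "(\<lambda>n. sqrt ((norm w)\<^sup>2 + e n)) \<longlonglongrightarrow> norm w" by simp
    then have "(\<lambda>n. radial_kernel TYPE('a) (sqrt ((norm w)\<^sup>2 + e n))) \<longlonglongrightarrow> radial_kernel TYPE('a) (norm w)"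
      by (rule isCont_tendsto_compose[OF radial_kernel_isCont[OF w]])
    then show ?case unfolding f_def w_def[symmetric] smooth_kernel_def by (rule tendsto_minus)
  qed
  have m: "(\<lambda>z. - radial_kernel TYPE('a) (norm (p + r *\<^sub>R sgn z))) \<in> borel_measurable unif_ball" by measurable
  have mae: "AE z in unif_ball. mono (\<lambda>n. f n z)" by (intro AE_I2 monoI mono)
  note mc = int mae lim L m
  have "integrable unif_ball (\<lambda>z. - radial_kernel TYPE('a) (norm (p + r *\<^sub>R sgn z)))"
    by (rule integrable_monotone_convergence[OF mc])
  then show 1: "integrable unif_ball (\<lambda>z. radial_kernel TYPE('a) (norm (p + r *\<^sub>R sgn z)))" by simp
  have "(\<integral>z. - radial_kernel TYPE('a) (norm (p + r *\<^sub>R sgn z)) \<partial>unif_ball) = L"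
    by (rule integral_monotone_convergence[OF mc])
  then show "radial_kernel TYPE('a) (norm p) \<le> (\<integral>z. radial_kernel TYPE('a) (norm (p + r *\<^sub>R sgn z)) \<partial>unif_ball)"
    using \<open>L \<le> _\<close> by simp
qed

lemma kernel_submean:
  fixes x y :: "'a::euclidean_space"
  assumes d: "DIM('a) \<ge> 2" and r: "0 < r"
  shows "kernel y x \<le> ereal_integral (sphere_measure y r) (\<lambda>y. kernel y x)"
proof (cases "y = x")
  case True
  then show ?thesis using d by (simp add: kernel_def)
next
  case False
  define p where "p = y - x"
  have p: "p \<noteq> 0" using False by (simp add: p_def)
  note [measurable] = borel_measurable_kernel[OF d, of x]
  have "ereal_integral (sphere_measure y r) (\<lambda>y. kernel y x) = ereal_integral unif_ball (\<lambda>z. kernel (y + r *\<^sub>R sgn z) x)"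
    unfolding ereal_integral_def sphere_measure_eq
    by (subst (1 2) nn_integral_distr) auto
  also have "\<dots> = ereal_integral unif_ball (\<lambda>z. ereal (radial_kernel TYPE('a) (norm (p + r *\<^sub>R sgn z))))"
  proof (rule ereal_integral_cong_AE)
    show "AE z in unif_ball. kernel (y + r *\<^sub>R sgn z) x = ereal (radial_kernel TYPE('a) (norm (p + r *\<^sub>R sgn z)))"
      using AE_unif_ball_direction[OF d r, of p]
    proof eventually_elim
      case (elim z)
      have eq: "y + r *\<^sub>R sgn z - x = p + r *\<^sub>R sgn z" by (simp add: p_def)
      then have "y + r *\<^sub>R sgn z \<noteq> x" using elim by (metis right_minus_eq)
      then show ?case
        using kernel_eq_radial_kernel[of "y + r *\<^sub>R sgn z" x] eq norm_minus_commute[of x "y + r *\<^sub>R sgn z"] by simp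
    qed
  qed
  also have "\<dots> = ereal (\<integral>z. radial_kernel TYPE('a) (norm (p + r *\<^sub>R sgn z)) \<partial>unif_ball)"
    by (rule ereal_integral_real[OF kernel_sphere_integrable(1)[OF d r p]])
  finally have I: "ereal_integral (sphere_measure y r) (\<lambda>y. kernel y x) = ereal (\<integral>z. radial_kernel TYPE('a) (norm (p + r *\<^sub>R sgn z)) \<partial>unif_ball)" .
  have "kernel y x = ereal (radial_kernel TYPE('a) (norm p))"
    using False by (simp add: kernel_eq_radial_kernel p_def norm_minus_commute)
  then show ?thesis unfolding I using kernel_sphere_integrable(2)[OF d r p] by simp
qed

lemma kernel_dim1:
  fixes x y :: "'a::euclidean_space"
  assumes d: "DIM('a) = 1"
  shows "kernel y x = ereal (norm (y - x))"
  using d by (simp add: kernel_def kfun_def)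

lemma kernel_subharmonic:
  fixes x :: "'a::euclidean_space"
  assumes \<Omega>: "open \<Omega>"
  shows "subharmonic_on (\<lambda>y. kernel y x) \<Omega>"
proof (cases "DIM('a) = 1")
  case True
  have "\<exists>e>0. ball y e \<subseteq> \<Omega>" if "y \<in> \<Omega>" for y using \<Omega> that open_contains_ball by blast
  moreover have "norm ((1 - t) *\<^sub>R y + t *\<^sub>R z - x) \<le> (1 - t) * norm (y - x) + t * norm (z - x)"
    if "0 < t" "t < 1" for t y z
  proof -
    have "(1 - t) *\<^sub>R y + t *\<^sub>R z - x = (1 - t) *\<^sub>R (y - x) + t *\<^sub>R (z - x)" by (simp add: algebra_simps)
    also have "norm \<dots> \<le> norm ((1 - t) *\<^sub>R (y - x)) + norm (t *\<^sub>R (z - x))" by (rule norm_triangle_ineq)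
    finally show ?thesis using that by simp
  qed
  ultimately show ?thesis
    unfolding subharmonic_on_def if_P[OF True] kernel_dim1[OF True] by (auto; metis)
next
  case False
  then have d: "DIM('a) \<ge> 2" using DIM_positive[where 'a='a] by linarith
  have "openin (top_of_set \<Omega>) {y\<in>\<Omega>. kernel y x < a}" for a
    using openin_open_Int[OF open_kernel_less[OF d, of x a], of \<Omega>] by (simp add: Int_def)
  then show ?thesis
    unfolding subharmonic_on_def using False kernel_submean[OF d, of _ _ x] 
    by (auto simp: kernel_def zero_ereal_def)
qed

lemma harmonic_subharmonic:
  fixes u :: "'a::euclidean_space \<Rightarrow> real"
  assumes \<Omega>: "open \<Omega>" and u: "harmonic_on u \<Omega>"
  shows "subharmonic_on (\<lambda>x. ereal (u x)) \<Omega>"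
proof (cases "DIM('a) = 1")
  case True
  have "\<exists>e>0. ball x e \<subseteq> \<Omega> \<and> (\<forall>y\<in>ball x e. \<forall>z\<in>ball x e. \<forall>t::real. 0 < t \<longrightarrow> t < 1 \<longrightarrow>
      ereal (u ((1 - t) *\<^sub>R y + t *\<^sub>R z)) \<le> ereal (1 - t) * ereal (u y) + ereal t * ereal (u z))" if x: "x \<in> \<Omega>" for x
  proof -
    obtain e a b where e: "e > 0" "ball x e \<subseteq> \<Omega>" "\<forall>y\<in>ball x e. u y = a \<bullet> y + b"
    proof -
      have "\<exists>e>0. ball x e \<subseteq> \<Omega> \<and> (\<exists>a b. \<forall>y\<in>ball x e. u y = a \<bullet> y + b)"
        using u x True unfolding harmonic_on_def by simp
      then show ?thesis using that by blast
    qed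
    have "u ((1 - t) *\<^sub>R y + t *\<^sub>R z) = (1 - t) * u y + t * u z"
      if "y \<in> ball x e" "z \<in> ball x e" "0 < t" "t < 1" for y z and t :: real
    proof -
      have "(1 - t) *\<^sub>R y + t *\<^sub>R z \<in> ball x e"
        using convexD[OF convex_ball that(1,2), of "1 - t" t] that by simp
      then show ?thesis using e(3) that by (simp add: inner_add_right algebra_simps)
    qed
    then show ?thesis using e by (intro exI[of _ e]) simp
  qed
  then show ?thesis unfolding subharmonic_on_def using True by simp
next
  case False
  obtain g h where C: "C2_on \<Omega> u g h" and L: "\<And>x. x \<in> \<Omega> \<Longrightarrow> laplace h x = 0"
    using u harmonic_on_iff_C2[OF \<Omega>] by blast
  have cu: "continuous_on \<Omega> u" by (rule C2_on_continuous(1)[OF C])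
  have "openin (top_of_set \<Omega>) {x\<in>\<Omega>. ereal (u x) < a}" for a
  proof -
    have "continuous_on \<Omega> (\<lambda>x. ereal (u x))" using cu by (intro continuous_intros)
    from continuous_openin_preimage_gen[OF this, of "{..<a}"]
    show ?thesis by (simp add: vimage_def Int_def)
  qed
  moreover have "ereal (u x) \<le> ereal_integral (sphere_measure x r) (\<lambda>x. ereal (u x))"
    if r: "0 < r" and c: "cball x r \<subseteq> \<Omega>" for x r
  proof -
    define w where "w y = indicator (cball x r) y * u y" for y
    have cc: "continuous_on (cball x r) u" using cu c by (rule continuous_on_subset)
    have wm: "w \<in> borel_measurable borel"
      using borel_measurable_continuous_on_indicator[OF _ cc] by (simp add: w_def[abs_def])
    have "compact (u ` cball x r)" by (rule compact_continuous_image[OF cc compact_cball])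
    then obtain B where B: "\<forall>y\<in>cball x r. \<bar>u y\<bar> \<le> B"
      by (auto simp: bounded_iff dest!: compact_imp_bounded)
    have "\<bar>u x\<bar> \<le> B" using B r by simp
    then have "0 \<le> B" by linarith
    then have wB: "\<bar>w y\<bar> \<le> B" for y using B by (auto simp: w_def indicator_def)
    have "ereal_integral (sphere_measure x r) (\<lambda>x. ereal (u x)) = ereal_integral (sphere_measure x r) (\<lambda>x. ereal (w x))"
      by (rule ereal_integral_cong_AE)
         (use AE_sphere_measure[of r x] r in \<open>auto simp: w_def elim!: eventually_mono\<close>)
    also have "\<dots> = ereal (sph_mean w x r)" by (rule ereal_integral_sphere_measure[OF wm wB])
    also have "sph_mean w x r = sph_mean u x r"
      using r by (intro sph_mean_cong) (auto simp: w_def)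
    also have "sph_mean u x r = u x"
      by (rule sph_mean_harmonic[OF C \<Omega> c r]) (use L c ball_subset_cball in blast)
    finally show ?thesis by simp
  qed
  ultimately show ?thesis unfolding subharmonic_on_def using False by simp
qed

section \<open>Taylor coefficients of the kernel along a line\<close>

text \<open>The kernel as a function of the squared distance, continued holomorphically to the right half plane.\<close>

definition complex_kernel :: "'a::euclidean_space itself \<Rightarrow> complex \<Rightarrow> complex" where
  "complex_kernel _ q = (if DIM('a) = 2 then Ln q / 2
     else of_real (- sgn (real DIM('a) - 2)) * exp (of_real (- (real DIM('a) - 2) / 2) * Ln q))"

lemma complex_kernel_real:
  assumes s: "0 < s"
  shows "complex_kernel TYPE('a::euclidean_space) (of_real s) = of_real (radial_kernel TYPE('a) (sqrt s))"
proof (cases "DIM('a) = 2")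
  case True
  then show ?thesis using s by (simp add: complex_kernel_def radial_kernel_def kfun_def Ln_of_real ln_sqrt)
next
  case False
  define m where "m = real DIM('a) - 2"
  have m: "m \<noteq> 0" using False unfolding m_def by linarith
  have "sqrt s powr (- m) = s powr (- m / 2)"
    using s by (simp add: powr_half_sqrt[symmetric] powr_powr)
  also have "\<dots> = exp (- m / 2 * ln s)" using s by (simp add: powr_def)
  finally have "radial_kernel TYPE('a) (sqrt s) = - sgn m * exp (- m / 2 * ln s)"
    using m by (simp add: radial_kernel_def kfun_def m_def[symmetric])
  moreover have "complex_kernel TYPE('a) (of_real s) = of_real (- sgn m * exp (- m / 2 * ln s))"
    using s False unfolding complex_kernel_def m_def[symmetric] by (simp add: Ln_of_real exp_of_real[symmetric])
  ultimately show ?thesis by simp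
qed

text \<open>A bound for \<open>complex_kernel\<close> on the part of the right half plane with modulus between \<open>q0\<close> and \<open>q1\<close>, common to both branches
of its definition.\<close>

definition complex_kernel_bound :: "'a::euclidean_space itself \<Rightarrow> real \<Rightarrow> real \<Rightarrow> real" where
  "complex_kernel_bound _ q0 q1 = exp (\<bar>real DIM('a) - 2\<bar> / 2 * (\<bar>ln q0\<bar> + \<bar>ln q1\<bar>)) + (\<bar>ln q0\<bar> + \<bar>ln q1\<bar> + pi) / 2"

lemma norm_complex_kernel_le:
  assumes q0: "0 < q0" and q: "q0 \<le> norm q" "norm q \<le> q1"
  shows "norm (complex_kernel TYPE('a::euclidean_space) q) \<le> complex_kernel_bound TYPE('a) q0 q1"
proof -
  define L where "L = \<bar>ln q0\<bar> + \<bar>ln q1\<bar>"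
  have q0': "q \<noteq> 0" using q0 q by auto
  have nq: "0 < norm q" "0 < q1" using q0 q by auto
  have "ln q0 \<le> ln (norm q)" "ln (norm q) \<le> ln q1" using q0 q nq by simp_all
  then have L: "\<bar>ln (norm q)\<bar> \<le> L" unfolding L_def by linarith
  have pos: "0 \<le> L + pi" using L pi_ge_zero by linarith
  show ?thesis
  proof (cases "DIM('a) = 2")
    case True
    have "norm (Ln q) \<le> \<bar>Re (Ln q)\<bar> + \<bar>Im (Ln q)\<bar>" by (rule cmod_le)
    also have "\<dots> \<le> L + pi"
      using L Re_Ln[OF q0'] mpi_less_Im_Ln[OF q0'] Im_Ln_le_pi[OF q0'] by simp
    finally have "norm (Ln q) / 2 \<le> (L + pi) / 2" by simp
    also have "\<dots> \<le> complex_kernel_bound TYPE('a) q0 q1" by (simp add: complex_kernel_bound_def L_def)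
    finally show ?thesis using True by (simp add: complex_kernel_def norm_divide)
  next
    case False
    define m where "m = real DIM('a) - 2"
    have "norm (complex_kernel TYPE('a) q) \<le> exp (- m / 2 * ln (norm q))"
      using False q0' unfolding complex_kernel_def m_def[symmetric]
      by (simp add: norm_mult Re_Ln sgn_if)
    also have "- m / 2 * ln (norm q) \<le> \<bar>m\<bar> / 2 * L"
    proof -
      have "- m / 2 * ln (norm q) \<le> \<bar>m / 2\<bar> * \<bar>ln (norm q)\<bar>" by (metis abs_ge_minus_self abs_mult minus_mult_left minus_divide_left)
      also have "\<dots> \<le> \<bar>m / 2\<bar> * L" by (rule mult_left_mono[OF L]) simp
      finally show ?thesis by simp
    qed
    then have "exp (- m / 2 * ln (norm q)) \<le> exp (\<bar>m\<bar> / 2 * L)" by simp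
    also have "\<dots> \<le> complex_kernel_bound TYPE('a) q0 q1"
      using pos by (simp add: complex_kernel_bound_def L_def m_def)
    finally show ?thesis by simp
  qed
qed

text \<open>The kernel along the line \<open>t \<mapsto> a + t b\<close> with complex parameter: the polynomial is the squared norm of \<open>a + t b\<close> for real \<open>t\<close>.\<close>

definition kernel_line :: "'a::euclidean_space \<Rightarrow> 'a \<Rightarrow> complex \<Rightarrow> complex" where
  "kernel_line a b t = complex_kernel TYPE('a) (of_real (a \<bullet> a) + 2 * of_real (a \<bullet> b) * t + of_real (b \<bullet> b) * t\<^sup>2)"

definition kernel_coeff :: "'a::euclidean_space \<Rightarrow> 'a \<Rightarrow> nat \<Rightarrow> real" where
  "kernel_coeff a b n = Re ((deriv ^^ n) (kernel_line a b) 0 / fact n)"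

text \<open>If \<open>5 \<rho> |b| \<le> |a|\<close>, then for \<open>|t| \<le> 2 \<rho>\<close> the non-constant terms add up to at most \<open>4/5 + 4/25 = 24/25\<close> of \<open>|a|\<^sup>2\<close>,
so the polynomial stays in the right half plane.\<close>

lemma kernel_line_polynomial_bounds:
  fixes a b :: "'a::euclidean_space" and t :: complex
  assumes a: "a \<noteq> 0" and \<rho>: "0 < \<rho>" "5 * \<rho> * norm b \<le> norm a" and t: "norm t \<le> 2 * \<rho>"
  defines "q \<equiv> of_real (a \<bullet> a) + 2 * of_real (a \<bullet> b) * t + of_real (b \<bullet> b) * t\<^sup>2"
  shows "(norm a)\<^sup>2 / 25 \<le> Re q" "norm q \<le> 2 * (norm a)\<^sup>2"
proof -
  define N where "N = norm a"
  define w where "w = 2 * of_real (a \<bullet> b) * t + of_real (b \<bullet> b) * t\<^sup>2"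
  have N: "N > 0" using a by (simp add: N_def)
  have bt: "norm b * norm t \<le> 2 / 5 * N"
  proof -
    have "norm b * norm t \<le> norm b * (2 * \<rho>)" using t by (intro mult_left_mono) auto
    also have "\<dots> \<le> 2 / 5 * N" using \<rho>(2) by (simp add: N_def)
    finally show ?thesis .
  qed
  have "norm w \<le> norm (2 * of_real (a \<bullet> b) * t) + norm (of_real (b \<bullet> b) * t\<^sup>2)"
    unfolding w_def by (rule norm_triangle_ineq)
  also have "\<dots> = 2 * \<bar>a \<bullet> b\<bar> * norm t + (norm b * norm t)\<^sup>2"
    by (simp add: norm_mult norm_power power_mult_distrib power2_norm_eq_inner)
  also have "\<dots> \<le> 2 * N * (norm b * norm t) + (norm b * norm t)\<^sup>2"
    using mult_right_mono[OF Cauchy_Schwarz_ineq2[of a b], of "norm t"] by (simp add: N_def algebra_simps)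
  also have "\<dots> \<le> 2 * N * (2 / 5 * N) + (2 / 5 * N)\<^sup>2"
    using bt N by (intro add_mono mult_left_mono power_mono) auto
  also have "\<dots> = 24 / 25 * N\<^sup>2" by (simp add: power2_eq_square field_simps)
  finally have w: "norm w \<le> 24 / 25 * N\<^sup>2" .
  have q: "q = of_real (N\<^sup>2) + w" by (simp add: q_def w_def N_def power2_norm_eq_inner)
  have "- norm w \<le> Re w" using abs_Re_le_cmod[of w] by linarith
  then show "(norm a)\<^sup>2 / 25 \<le> Re q" using w by (simp add: q N_def[symmetric])
  have "norm (of_real (N\<^sup>2) :: complex) = N\<^sup>2" by (simp only: norm_of_real) simp
  then have "norm q \<le> N\<^sup>2 + norm w" unfolding q using norm_triangle_ineq[of "of_real (N\<^sup>2) :: complex" w] by linarith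
  also have "\<dots> \<le> 2 * N\<^sup>2" using w zero_le_power2[of N] by linarith
  finally show "norm q \<le> 2 * (norm a)\<^sup>2" by (simp add: N_def)
qed

lemma kernel_line_holomorphic:
  fixes a b :: "'a::euclidean_space"
  assumes a: "a \<noteq> 0" and \<rho>: "0 < \<rho>" "5 * \<rho> * norm b \<le> norm a"
  shows "kernel_line a b holomorphic_on cball 0 (2 * \<rho>)"
proof -
  define p where "p t = of_real (a \<bullet> a) + 2 * of_real (a \<bullet> b) * t + of_real (b \<bullet> b) * t\<^sup>2" for t :: complex
  have p: "p holomorphic_on cball 0 (2 * \<rho>)" unfolding p_def by (intro holomorphic_intros)
  have p0: "p t \<notin> \<real>\<^sub>\<le>\<^sub>0" if "t \<in> cball 0 (2 * \<rho>)" for t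
  proof -
    have "0 < (norm a)\<^sup>2 / 25" using a by simp
    also have "\<dots> \<le> Re (p t)" using kernel_line_polynomial_bounds(1)[OF a \<rho>, of t] that by (simp add: p_def)
    finally show ?thesis by (auto simp: complex_nonpos_Reals_iff)
  qed
  have "(\<lambda>t. Ln (p t)) holomorphic_on cball 0 (2 * \<rho>)" by (rule holomorphic_on_Ln'[OF p0 p])
  then show ?thesis
    unfolding kernel_line_def[abs_def] p_def[symmetric] complex_kernel_def
    by (cases "DIM('a) = 2") (auto intro!: holomorphic_intros)
qed

text \<open>The Taylor series of a holomorphic function converges on every disc inside its domain; real parts are taken for real \<open>t\<close>.\<close>

lemma kernel_coeff_sums:
  fixes a b :: "'a::euclidean_space"
  assumes a: "a \<noteq> 0" and \<rho>: "0 < \<rho>" "5 * \<rho> * norm b \<le> norm a" and t: "\<bar>t\<bar> < 2 * \<rho>"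
  shows "(\<lambda>n. kernel_coeff a b n * t ^ n) sums radial_kernel TYPE('a) (norm (a + t *\<^sub>R b))"
proof -
  have hol: "kernel_line a b holomorphic_on ball 0 (2 * \<rho>)"
    using kernel_line_holomorphic[OF a \<rho>] by (rule holomorphic_on_subset) auto
  have "(\<lambda>n. (deriv ^^ n) (kernel_line a b) 0 / fact n * (of_real t - 0) ^ n) sums kernel_line a b (of_real t)"
    by (rule holomorphic_power_series[OF hol]) (use t in simp)
  from sums_Re[OF this]
  have "(\<lambda>n. kernel_coeff a b n * t ^ n) sums Re (kernel_line a b (of_real t))"
    by (simp only: kernel_coeff_def diff_zero of_real_power[symmetric] times_complex.sel
          Re_complex_of_real Im_complex_of_real mult_zero_right)
  moreover have "kernel_line a b (of_real t) = of_real (radial_kernel TYPE('a) (norm (a + t *\<^sub>R b)))"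
  proof -
    have eq: "of_real (a \<bullet> a) + 2 * of_real (a \<bullet> b) * of_real t + of_real (b \<bullet> b) * (of_real t)\<^sup>2
        = (of_real ((norm (a + t *\<^sub>R b))\<^sup>2) :: complex)"
    proof -
      have "(norm (a + t *\<^sub>R b))\<^sup>2 = a \<bullet> a + 2 * (a \<bullet> b) * t + (b \<bullet> b) * t\<^sup>2"
        unfolding power2_norm_eq_inner
        by (simp add: inner_add_left inner_add_right inner_commute power2_eq_square algebra_simps)
      then show ?thesis by simp
    qed
    have "(norm a)\<^sup>2 / 25 \<le> (norm (a + t *\<^sub>R b))\<^sup>2"
      using kernel_line_polynomial_bounds(1)[OF a \<rho>, of "of_real t"] t unfolding eq by simp
    moreover have "0 < (norm a)\<^sup>2 / 25" using a by simp
    ultimately have "0 < (norm (a + t *\<^sub>R b))\<^sup>2" by linarith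
    from complex_kernel_real[OF this, where 'a='a] show ?thesis unfolding kernel_line_def eq by simp
  qed
  ultimately show ?thesis by simp
qed

text \<open>Cauchy's inequality on the circle of radius \<open>2 \<rho>\<close>. The bound depends on \<open>a\<close> through \<open>|a|\<close>, so it is uniform over compact sets of base points.\<close>

lemma kernel_coeff_bound:
  fixes a b :: "'a::euclidean_space"
  assumes m: "0 < m0" "m0 \<le> norm a" "norm a \<le> m1" and \<rho>: "0 < \<rho>" "5 * \<rho> * norm b \<le> norm a"
  shows "\<bar>kernel_coeff a b n\<bar> \<le> complex_kernel_bound TYPE('a) (m0\<^sup>2 / 25) (2 * m1\<^sup>2) / (2 * \<rho>) ^ n"
proof -
  have a: "a \<noteq> 0" using m by auto
  define B where "B = complex_kernel_bound TYPE('a) (m0\<^sup>2 / 25) (2 * m1\<^sup>2)"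
  have hol: "kernel_line a b holomorphic_on cball 0 (2 * \<rho>)" by (rule kernel_line_holomorphic[OF a \<rho>])
  have "norm ((deriv ^^ n) (kernel_line a b) 0) \<le> fact n * B / (2 * \<rho>) ^ n"
  proof (rule Cauchy_inequality)
    show "kernel_line a b holomorphic_on ball 0 (2 * \<rho>)" using hol by (rule holomorphic_on_subset) auto
    show "continuous_on (cball 0 (2 * \<rho>)) (kernel_line a b)" using hol by (rule holomorphic_on_imp_continuous_on)
    fix t :: complex assume "norm (0 - t) = 2 * \<rho>"
    then have t: "norm t \<le> 2 * \<rho>" by simp
    note q = kernel_line_polynomial_bounds[OF a \<rho> t]
    have m2: "m0\<^sup>2 \<le> (norm a)\<^sup>2" "(norm a)\<^sup>2 \<le> m1\<^sup>2" using m by (auto intro: power_mono)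
    show "norm (kernel_line a b t) \<le> B"
      unfolding kernel_line_def B_def
    proof (rule norm_complex_kernel_le)
      show "0 < m0\<^sup>2 / 25" using m by simp
      show "m0\<^sup>2 / 25 \<le> norm (of_real (a \<bullet> a) + 2 * of_real (a \<bullet> b) * t + of_real (b \<bullet> b) * t\<^sup>2)"
        using q(1) m2(1) complex_Re_le_cmod order_trans by (smt (verit) divide_right_mono)
      show "norm (of_real (a \<bullet> a) + 2 * of_real (a \<bullet> b) * t + of_real (b \<bullet> b) * t\<^sup>2) \<le> 2 * m1\<^sup>2"
        using q(2) m2(2) by linarith
    qed
  qed (use \<rho> in auto)
  then have "norm ((deriv ^^ n) (kernel_line a b) 0 / fact n) \<le> B / (2 * \<rho>) ^ n"
    by (simp add: norm_divide field_simps)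
  then show ?thesis unfolding kernel_coeff_def B_def using abs_Re_le_cmod order_trans by blast
qed

text \<open>Recovers a coefficient from the sum and the earlier coefficients; used both for measurability of the coefficients in a
parameter and for their uniqueness.\<close>

lemma powser_coeff_limit:
  fixes a :: "nat \<Rightarrow> real"
  assumes s: "0 < s" and F: "\<And>t. \<bar>t\<bar> < s \<Longrightarrow> (\<lambda>n. a n * t ^ n) sums F t"
  shows "((\<lambda>t. (F t - (\<Sum>k<n. a k * t ^ k)) / t ^ n) \<longlongrightarrow> a n) (at 0)"
proof -
  define f where "f t = (if t = 0 then a n else (F t - (\<Sum>k<n. a k * t ^ k)) / t ^ n)" for t
  have "(f \<longlongrightarrow> a (0 + n)) (at 0)"
  proof (rule powser_limit_0[OF s])
    fix t :: real assume t: "norm t < s"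
    show "(\<lambda>m. a (m + n) * t ^ m) sums f t"
    proof (cases "t = 0")
      case True
      then show ?thesis using powser_sums_zero[of "\<lambda>m. a (m + n)"] by (simp add: f_def)
    next
      case False
      have "(\<lambda>m. a (m + n) * t ^ (m + n)) sums (F t - (\<Sum>k<n. a k * t ^ k))"
        by (rule sums_split_initial_segment[OF F]) (use t in simp)
      from sums_divide[OF this, of "t ^ n"] show ?thesis
        using False by (simp add: f_def power_add)
    qed
  qed
  moreover have "eventually (\<lambda>t. f t = (F t - (\<Sum>k<n. a k * t ^ k)) / t ^ n) (at 0)"
    by (auto simp: eventually_at f_def intro!: exI[of _ 1])
  ultimately show ?thesis by (simp add: filterlim_cong)
qed

lemma powser_zero_imp_coeff_zero:
  fixes a :: "nat \<Rightarrow> real"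
  assumes s: "0 < s" and F: "\<And>t. \<bar>t\<bar> < s \<Longrightarrow> (\<lambda>n. a n * t ^ n) sums 0"
  shows "a n = 0"
proof (induction n rule: less_induct)
  case (less n)
  have "((\<lambda>t. (0 - (\<Sum>k<n. a k * t ^ k)) / t ^ n) \<longlongrightarrow> a n) (at 0)"
    by (rule powser_coeff_limit[OF s F])
  then have "((\<lambda>t::real. 0::real) \<longlongrightarrow> a n) (at 0)" using less by simp
  then show ?case by (simp add: tendsto_const_iff)
qed

text \<open>The functions \<open>y \<mapsto> k(|\<alpha> y + t \<beta> y|)\<close> have the mean value property for all small \<open>t\<close>; comparing powers of \<open>t\<close> transfers it
to the coefficients. Measurability follows inductively, each coefficient being a limit of measurable functions.\<close>

lemma kernel_coeff_harmonic:
  fixes \<alpha> \<beta> :: "'a::euclidean_space \<Rightarrow> 'a"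
  assumes U: "open U" and c: "continuous_on UNIV \<alpha>" "continuous_on UNIV \<beta>"
    and H: "\<And>y0. y0 \<in> U \<Longrightarrow> \<exists>e m0 m1 \<rho> \<tau>. 0 < e \<and> 0 < m0 \<and> 0 < \<rho> \<and> 0 < \<tau> \<and> cball y0 (2 * e) \<subseteq> U \<and>
       (\<forall>y\<in>cball y0 (2 * e). m0 \<le> norm (\<alpha> y) \<and> norm (\<alpha> y) \<le> m1 \<and> 5 * \<rho> * norm (\<beta> y) \<le> norm (\<alpha> y)) \<and>
       (\<forall>y\<in>ball y0 e. \<forall>r t. 0 < r \<longrightarrow> r < e \<longrightarrow> \<bar>t\<bar> < \<tau> \<longrightarrow>
          sph_mean (\<lambda>y. radial_kernel TYPE('a) (norm (\<alpha> y + t *\<^sub>R \<beta> y))) y r = radial_kernel TYPE('a) (norm (\<alpha> y + t *\<^sub>R \<beta> y)))"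
  shows "harmonic_on (\<lambda>y. kernel_coeff (\<alpha> y) (\<beta> y) n) U"
proof (rule locally_mean_value_imp_harmonic[OF U])
  show "locally_mean_value (\<lambda>y. kernel_coeff (\<alpha> y) (\<beta> y) n) U"
    unfolding locally_mean_value_def
  proof
    fix y0 assume "y0 \<in> U"
    from H[OF this] obtain e m0 m1 \<rho> \<tau> where e: "0 < e" and m0: "0 < m0" and \<rho>: "0 < \<rho>" and \<tau>: "0 < \<tau>"
      and cU: "cball y0 (2 * e) \<subseteq> U"
      and ab: "\<forall>y\<in>cball y0 (2 * e). m0 \<le> norm (\<alpha> y) \<and> norm (\<alpha> y) \<le> m1 \<and> 5 * \<rho> * norm (\<beta> y) \<le> norm (\<alpha> y)"
      and mv: "\<forall>y\<in>ball y0 e. \<forall>r t. 0 < r \<longrightarrow> r < e \<longrightarrow> \<bar>t\<bar> < \<tau> \<longrightarrow>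
          sph_mean (\<lambda>y. radial_kernel TYPE('a) (norm (\<alpha> y + t *\<^sub>R \<beta> y))) y r = radial_kernel TYPE('a) (norm (\<alpha> y + t *\<^sub>R \<beta> y))"
      by blast
    define C where "C = cball y0 (2 * e)"
    define a where "a n y = kernel_coeff (\<alpha> y) (\<beta> y) n" for n y
    define F where "F t y = radial_kernel TYPE('a) (norm (\<alpha> y + t *\<^sub>R \<beta> y))" for t y
    define B where "B = complex_kernel_bound TYPE('a) (m0\<^sup>2 / 25) (2 * m1\<^sup>2)"
    have [measurable]: "\<alpha> \<in> borel_measurable borel" "\<beta> \<in> borel_measurable borel"
      using c by (auto intro: borel_measurable_continuous_onI)
    have Fm [measurable]: "F t \<in> borel_measurable borel" for t unfolding F_def by measurable
    have sums: "(\<lambda>n. a n y * t ^ n) sums F t y" if "y \<in> C" "\<bar>t\<bar> < 2 * \<rho>" for y t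
      unfolding a_def F_def by (rule kernel_coeff_sums[of _ \<rho>]) (use that ab m0 \<rho> in \<open>force simp: C_def\<close>)+
    have bound: "\<bar>a n y\<bar> \<le> B / (2 * \<rho>) ^ n" if "y \<in> C" for y n
      unfolding a_def B_def by (rule kernel_coeff_bound[OF m0]) (use that ab \<rho> in \<open>auto simp: C_def\<close>)
    have meas: "(\<lambda>y. indicator C y * a n y) \<in> borel_measurable borel" for n
    proof (induction n rule: less_induct)
      case (less n)
      define T where "T j = \<rho> / (real j + 2)" for j :: nat
      have T: "0 < T j" "\<bar>T j\<bar> < 2 * \<rho>" for j using \<rho> by (auto simp: T_def divide_simps intro: add_nonneg_pos)
      have T0: "T \<longlonglongrightarrow> 0" unfolding T_def by real_asymp
      have "filterlim T (at 0) sequentially"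
        using T0 T(1) by (auto simp: filterlim_at intro!: always_eventually) (metis less_irrefl)
      define G where "G j y = indicator C y * ((F (T j) y - (\<Sum>k<n. (indicator C y * a k y) * T j ^ k)) / T j ^ n)" for j y
      have Gm: "G j \<in> borel_measurable borel" for j
      proof -
        have "(\<lambda>y. \<Sum>k<n. (indicator C y * a k y) * T j ^ k) \<in> borel_measurable borel"
          by (intro borel_measurable_sum borel_measurable_times[OF less borel_measurable_const]) simp
        then show ?thesis unfolding G_def
          by (intro borel_measurable_times borel_measurable_divide borel_measurable_diff borel_measurable_indicator Fm)
             (auto simp: C_def)
      qed
      show ?case
      proof (rule borel_measurable_LIMSEQ_real[OF _ Gm])
        fix y :: 'a
        show "(\<lambda>j. G j y) \<longlonglongrightarrow> indicator C y * a n y"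
        proof (cases "y \<in> C")
          case True
          have "0 < 2 * \<rho>" using \<rho> by simp
          from powser_coeff_limit[OF this sums[OF True], of n]
          have "(\<lambda>j. (F (T j) y - (\<Sum>k<n. a k y * T j ^ k)) / T j ^ n) \<longlonglongrightarrow> a n y"
            using \<open>filterlim T (at 0) sequentially\<close> by (rule filterlim_compose)
          then show ?thesis using True by (simp add: G_def)
        qed (simp add: G_def)
      qed
    qed
    have mean: "sph_mean (a n) y r = a n y" if y: "y \<in> ball y0 e" and r: "0 < r" "r < e" for y r n
    proof -
      have inC: "y + r *\<^sub>R sgn z \<in> C" for z
      proof -
        have "dist y0 (y + r *\<^sub>R sgn z) \<le> dist y0 y + dist y (y + r *\<^sub>R sgn z)" by (rule dist_triangle)
        also have "dist y (y + r *\<^sub>R sgn z) \<le> r" using r by (simp add: dist_norm norm_sgn)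
        finally show ?thesis using y r by (simp add: C_def)
      qed
      have yC: "y \<in> C" using y e by (simp add: C_def)
      have am: "(\<lambda>z. a n (y + r *\<^sub>R sgn z)) \<in> borel_measurable unif_ball" for n
      proof -
        have "(\<lambda>z. indicator C (y + r *\<^sub>R sgn z) * a n (y + r *\<^sub>R sgn z)) \<in> borel_measurable unif_ball"
          by (rule measurable_compose[OF _ meas[of n]]) measurable
        then show ?thesis using inC by simp
      qed
      define s where "s = min \<tau> (2 * \<rho>)"
      have s: "0 < s" using \<tau> \<rho> by (simp add: s_def)
      have "sph_mean (a n) y r - a n y = 0"
      proof (rule powser_zero_imp_coeff_zero[OF s, of "\<lambda>n. sph_mean (a n) y r - a n y"])
        fix t :: real assume t: "\<bar>t\<bar> < s"
        then have t2: "\<bar>t\<bar> < 2 * \<rho>" "\<bar>t\<bar> < \<tau>" by (auto simp: s_def)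
        define q where "q = \<bar>t\<bar> / (2 * \<rho>)"
        have q: "0 \<le> q" "q < 1" using t2 \<rho> by (auto simp: q_def)
        have ab: "norm (a n x * t ^ n) \<le> B * q ^ n" if "x \<in> C" for x n
        proof -
          have "\<bar>a n x\<bar> * \<bar>t\<bar> ^ n \<le> B / (2 * \<rho>) ^ n * \<bar>t\<bar> ^ n"
            by (rule mult_right_mono[OF bound[OF that]]) simp
          then show ?thesis by (simp add: abs_mult power_abs q_def power_divide)
        qed
        have summ: "summable (\<lambda>n. B * q ^ n)" using q by (intro summable_mult summable_geometric) simp
        have int: "integrable unif_ball (\<lambda>z. a n (y + r *\<^sub>R sgn z) * t ^ n)" for n
          by (rule unif_ball.integrable_const_bound[of _ "B * q ^ n"]) (use ab inC am in \<open>auto intro!: AE_I2\<close>)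
        have "(\<lambda>n. \<integral>z. a n (y + r *\<^sub>R sgn z) * t ^ n \<partial>unif_ball) sums
            (\<integral>z. (\<Sum>n. a n (y + r *\<^sub>R sgn z) * t ^ n) \<partial>unif_ball)"
        proof (rule sums_integral[OF int])
          show "AE z in unif_ball. summable (\<lambda>n. norm (a n (y + r *\<^sub>R sgn z) * t ^ n))"
            by (intro AE_I2 summable_comparison_test'[OF summ, of 0]) (use ab inC in auto)
          show "summable (\<lambda>n. \<integral>z. norm (a n (y + r *\<^sub>R sgn z) * t ^ n) \<partial>unif_ball)"
          proof (rule summable_comparison_test'[OF summ, of 0])
            fix n
            have "(\<integral>z. norm (a n (y + r *\<^sub>R sgn z) * t ^ n) \<partial>unif_ball) \<le> (\<integral>z. B * q ^ n \<partial>(unif_ball :: 'a measure))"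
              by (rule integral_mono) (use ab inC int in auto)
            then show "norm (\<integral>z. norm (a n (y + r *\<^sub>R sgn z) * t ^ n) \<partial>unif_ball) \<le> B * q ^ n" by simp
          qed
        qed
        moreover have "(\<Sum>n. a n (y + r *\<^sub>R sgn z) * t ^ n) = F t (y + r *\<^sub>R sgn z)" for z
          using sums_unique[OF sums[OF inC t2(1)]] by simp
        moreover have "(\<integral>z. F t (y + r *\<^sub>R sgn z) \<partial>unif_ball) = F t y"
          using mv y r t2(2) unfolding sph_mean_def F_def by blast
        ultimately have "(\<lambda>n. sph_mean (a n) y r * t ^ n) sums F t y"
          by (simp add: sph_mean_def)
        from sums_diff[OF this sums[OF yC t2(1)]]
        show "(\<lambda>n. (sph_mean (a n) y r - a n y) * t ^ n) sums 0" by (simp add: left_diff_distrib)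
      qed
      then show ?thesis by simp
    qed
    show "\<exists>e>0. cball y0 (2 * e) \<subseteq> U \<and>
        (\<lambda>y. indicator (cball y0 (2 * e)) y * kernel_coeff (\<alpha> y) (\<beta> y) n) \<in> borel_measurable borel \<and>
        (\<exists>B. \<forall>y\<in>cball y0 (2 * e). \<bar>kernel_coeff (\<alpha> y) (\<beta> y) n\<bar> \<le> B) \<and>
        (\<forall>y\<in>ball y0 e. \<forall>r. 0 < r \<longrightarrow> r < e \<longrightarrow> sph_mean (\<lambda>y. kernel_coeff (\<alpha> y) (\<beta> y) n) y r = kernel_coeff (\<alpha> y) (\<beta> y) n)"
      using e cU meas[of n] bound[of _ n] mean[of _ _ n] unfolding C_def a_def
      by (intro exI[of _ e] conjI exI[of _ "B / (2 * \<rho>) ^ n"]) auto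
  qed
qed

section \<open>Moving the pole out of the open set\<close>

lemma sph_mean_neg_radius:
  fixes f :: "'a::euclidean_space \<Rightarrow> real"
  assumes [measurable]: "f \<in> borel_measurable borel"
  shows "sph_mean f x (- r) = sph_mean f x r"
proof -
  have "sph_mean f x r = (\<integral>z. f (x + r *\<^sub>R sgn z) \<partial>distr unif_ball borel uminus)"
    by (simp add: sph_mean_def distr_unif_ball_uminus)
  also have "\<dots> = sph_mean f x (- r)"
    by (subst integral_distr) (auto simp: sph_mean_def sgn_minus)
  finally show ?thesis ..
qed

lemma sph_mean_const: "sph_mean (\<lambda>y::'a::euclidean_space. c) x r = c"
  by (simp add: sph_mean_def)

lemma borel_measurable_radial_kernel_norm: "(\<lambda>x::'a::euclidean_space. radial_kernel TYPE('a) (norm x)) \<in> borel_measurable borel"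
  by measurable

text \<open>A sphere is mapped to a sphere under \<open>y \<mapsto> p + s y\<close>, and the pole stays outside it.\<close>

lemma sph_mean_kernel_affine:
  fixes p y :: "'a::euclidean_space"
  assumes r: "0 < r" and off: "\<bar>s\<bar> * r < norm (p + s *\<^sub>R y)"
  shows "sph_mean (\<lambda>y. radial_kernel TYPE('a) (norm (p + s *\<^sub>R y))) y r = radial_kernel TYPE('a) (norm (p + s *\<^sub>R y))"
proof (cases "s = 0")
  case True
  then show ?thesis by (simp add: sph_mean_const)
next
  case False
  have "sph_mean (\<lambda>y. radial_kernel TYPE('a) (norm (p + s *\<^sub>R y))) y r
      = sph_mean (\<lambda>x. radial_kernel TYPE('a) (norm x)) (p + s *\<^sub>R y) (s * r)"
    by (simp add: sph_mean_def algebra_simps)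
  also have "\<dots> = sph_mean (\<lambda>x. radial_kernel TYPE('a) (norm x)) (p + s *\<^sub>R y) (\<bar>s\<bar> * r)"
    using sph_mean_neg_radius[OF borel_measurable_radial_kernel_norm, of "p + s *\<^sub>R y" "s * r"]
    by (cases "s \<ge> 0") auto
  also have "\<dots> = radial_kernel TYPE('a) (norm (p + s *\<^sub>R y))"
    by (rule sph_mean_kernel_off_pole) (use off r False in \<open>auto simp: dist_norm\<close>)
  finally show ?thesis .
qed

text \<open>The base point \<open>y - z\<close> vanishes only at \<open>z\<close>, so the coefficients are harmonic away from this single point, even though \<open>y - z + t v\<close> has
its zero elsewhere.\<close>

lemma kernel_coeff_harmonic_pole:
  fixes z v :: "'a::euclidean_space"
  assumes U: "open U" and z: "z \<notin> U"
  shows "harmonic_on (\<lambda>y. kernel_coeff (y - z) v n) U"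
proof (rule kernel_coeff_harmonic[OF U])
  show "continuous_on UNIV (\<lambda>y. y - z)" "continuous_on UNIV (\<lambda>y::'a. v)" by (intro continuous_intros)+
  fix y0 assume y0: "y0 \<in> U"
  define R where "R = norm (y0 - z)"
  have R: "0 < R" using y0 z by (auto simp: R_def)
  obtain d where d: "0 < d" "cball y0 d \<subseteq> U" using U y0 open_contains_cball by blast
  define e where "e = min d (R / 4) / 2"
  have e: "0 < e" "2 * e \<le> d" "2 * e \<le> R / 4" using d R by (auto simp: e_def)
  define l where "l = norm v + 1"
  define \<rho> where "\<rho> = R / (20 * l)"
  have v1: "0 < l" by (simp add: l_def add_nonneg_pos)
  have \<rho>: "0 < \<rho>" using R v1 by (simp add: \<rho>_def)
  have \<rho>v: "\<rho> * norm v \<le> R / 20"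
  proof -
    have "\<rho> * norm v \<le> \<rho> * l" using \<rho> by (intro mult_left_mono) (auto simp: l_def)
    also have "\<dots> = R / 20" using v1 by (simp add: \<rho>_def)
    finally show ?thesis .
  qed
  have near: "R - s \<le> norm (y - z)" "norm (y - z) \<le> R + s" if "dist y0 y \<le> s" for y s
    using that norm_triangle_ineq[of "y0 - y" "y - z"] norm_triangle_ineq[of "y - y0" "y0 - z"]
    by (auto simp: R_def dist_norm norm_minus_commute)
  show "\<exists>e m0 m1 \<rho> \<tau>. 0 < e \<and> 0 < m0 \<and> 0 < \<rho> \<and> 0 < \<tau> \<and> cball y0 (2 * e) \<subseteq> U \<and>
       (\<forall>y\<in>cball y0 (2 * e). m0 \<le> norm (y - z) \<and> norm (y - z) \<le> m1 \<and> 5 * \<rho> * norm v \<le> norm (y - z)) \<and>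
       (\<forall>y\<in>ball y0 e. \<forall>r t. 0 < r \<longrightarrow> r < e \<longrightarrow> \<bar>t\<bar> < \<tau> \<longrightarrow>
          sph_mean (\<lambda>y. radial_kernel TYPE('a) (norm (y - z + t *\<^sub>R v))) y r = radial_kernel TYPE('a) (norm (y - z + t *\<^sub>R v)))"
  proof (rule exI[of _ e], rule exI[of _ "R / 2"], rule exI[of _ "2 * R"], rule exI[of _ \<rho>], rule exI[of _ \<rho>],
      intro conjI ballI allI impI)
    show "0 < e" "0 < R / 2" "0 < \<rho>" "0 < \<rho>" using e R \<rho> by auto
    show "cball y0 (2 * e) \<subseteq> U" using d(2) e(2) by (meson order_trans subset_cball)
  next
    fix y assume "y \<in> cball y0 (2 * e)"
    then have "dist y0 y \<le> R / 4" using e by simp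
    from near[OF this] show "R / 2 \<le> norm (y - z)" "norm (y - z) \<le> 2 * R" "5 * \<rho> * norm v \<le> norm (y - z)"
      using R \<rho>v by auto
  next
    fix y r t assume y: "y \<in> ball y0 e" and r: "0 < r" "r < e" and t: "\<bar>t\<bar> < \<rho>"
    have "dist y0 y \<le> R / 8" using y e by simp
    from near(1)[OF this] have "R / 2 \<le> norm (y - z)" using R by simp
    moreover have "\<bar>t\<bar> * norm v \<le> R / 20" using \<rho>v mult_right_mono[of "\<bar>t\<bar>" \<rho> "norm v"] t by simp
    moreover have "norm (y - z) \<le> norm (y - z + t *\<^sub>R v) + \<bar>t\<bar> * norm v"
      using norm_triangle_ineq4[of "y - z + t *\<^sub>R v" "t *\<^sub>R v"] by simp
    ultimately have "r < norm (y - z + t *\<^sub>R v)" using r e R by linarith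
    then have "\<bar>1\<bar> * r < norm ((t *\<^sub>R v - z) + 1 *\<^sub>R y)" by (simp add: algebra_simps)
    from sph_mean_kernel_affine[OF r(1) this]
    show "sph_mean (\<lambda>y. radial_kernel TYPE('a) (norm (y - z + t *\<^sub>R v))) y r = radial_kernel TYPE('a) (norm (y - z + t *\<^sub>R v))"
      by (simp add: algebra_simps)
  qed
qed

text \<open>The base point \<open>- x\<close> does not depend on \<open>y\<close>, so there is no singularity at all: these are the homogeneous harmonic
polynomials in the expansion of the kernel at the origin.\<close>

lemma kernel_coeff_harmonic_entire:
  fixes x :: "'a::euclidean_space"
  assumes x: "x \<noteq> 0"
  shows "harmonic_on (\<lambda>y. kernel_coeff (- x) y n) UNIV"
proof (rule kernel_coeff_harmonic[OF open_UNIV])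
  show "continuous_on UNIV (\<lambda>y::'a. - x)" "continuous_on UNIV (\<lambda>y::'a. y)" by (intro continuous_intros)+
  fix y0 :: 'a
  define D where "D = norm y0 + 3"
  have D: "0 < D" by (simp add: D_def add_nonneg_pos)
  define \<rho> where "\<rho> = norm x / (5 * D)"
  have \<rho>: "0 < \<rho>" using D x by (simp add: \<rho>_def)
  have \<rho>D: "5 * (\<rho> * D) = norm x" using D by (simp add: \<rho>_def)
  have near: "norm y \<le> D - 1" if "dist y0 y \<le> 2" for y
    using that norm_triangle_ineq[of y0 "y - y0"] by (simp add: D_def dist_norm norm_minus_commute)
  show "\<exists>e m0 m1 \<rho> \<tau>. 0 < e \<and> 0 < m0 \<and> 0 < \<rho> \<and> 0 < \<tau> \<and> cball y0 (2 * e) \<subseteq> UNIV \<and>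
       (\<forall>y\<in>cball y0 (2 * e). m0 \<le> norm (- x) \<and> norm (- x) \<le> m1 \<and> 5 * \<rho> * norm y \<le> norm (- x)) \<and>
       (\<forall>y\<in>ball y0 e. \<forall>r t. 0 < r \<longrightarrow> r < e \<longrightarrow> \<bar>t\<bar> < \<tau> \<longrightarrow>
          sph_mean (\<lambda>y. radial_kernel TYPE('a) (norm (- x + t *\<^sub>R y))) y r = radial_kernel TYPE('a) (norm (- x + t *\<^sub>R y)))"
  proof (rule exI[of _ 1], rule exI[of _ "norm x"], rule exI[of _ "norm x"], rule exI[of _ \<rho>], rule exI[of _ \<rho>],
      intro conjI ballI allI impI)
    show "0 < norm x" "0 < \<rho>" "0 < \<rho>" using x \<rho> by auto
    fix y assume "y \<in> cball y0 (2 * 1)"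
    then have "norm y \<le> D - 1" using near by simp
    then have "\<rho> * norm y \<le> \<rho> * D" using \<rho> by (intro mult_left_mono) auto
    then show "5 * \<rho> * norm y \<le> norm (- x)" using \<rho>D by simp
  next
    fix y r t assume y: "y \<in> ball y0 1" and r: "0 < r" "r < (1::real)" and t: "\<bar>t\<bar> < \<rho>"
    have "norm y \<le> D - 1" using near[of y] y by simp
    then have "\<bar>t\<bar> * (norm y + r) \<le> \<rho> * D" using t r D by (intro mult_mono) auto
    moreover have "0 < norm x" using x by simp
    ultimately have "\<bar>t\<bar> * norm y + \<bar>t\<bar> * r < norm x" using \<rho>D unfolding distrib_left by linarith
    moreover have "norm x \<le> norm (- x + t *\<^sub>R y) + \<bar>t\<bar> * norm y"
      using norm_triangle_ineq4[of "- x + t *\<^sub>R y" "t *\<^sub>R y"] by simp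
    ultimately have "\<bar>t\<bar> * r < norm (- x + t *\<^sub>R y)" by linarith
    then show "sph_mean (\<lambda>y. radial_kernel TYPE('a) (norm (- x + t *\<^sub>R y))) y r = radial_kernel TYPE('a) (norm (- x + t *\<^sub>R y))"
      by (rule sph_mean_kernel_affine[OF r(1)])
  qed auto
qed

lemma harmonic_on_uminus: "open U \<Longrightarrow> harmonic_on u U \<Longrightarrow> harmonic_on (\<lambda>x. - u x) U"
proof -
  assume U: "open U" and "harmonic_on u U"
  then obtain g h where C: "C2_on U u g h" and L: "\<forall>x\<in>U. laplace h x = 0" using harmonic_on_iff_C2 by blast
  have "C2_on U (\<lambda>x. - u x) (\<lambda>x. - 1 *\<^sub>R g x) (\<lambda>x v. - 1 *\<^sub>R h x v)"
    using C2_on_cmult[OF C, of "- 1"] by simp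
  moreover have "\<forall>x\<in>U. laplace (\<lambda>x v. - 1 *\<^sub>R h x v) x = 0"
    unfolding laplace_cmult using L by simp
  ultimately show ?thesis unfolding harmonic_on_iff_C2[OF U] by blast
qed

lemma harmonic_restrict:
  assumes "open U" "V \<subseteq> U" "open V" "harmonic_on u U"
  shows "harmonic_on u V"
proof -
  obtain g h where "C2_on U u g h" "\<forall>x\<in>U. laplace h x = 0"
    using assms(4) harmonic_on_iff_C2[OF assms(1)] by blast
  then have "C2_on V u g h" "\<forall>x\<in>V. laplace h x = 0" using assms(2) C2_on_subset by blast+
  then show ?thesis using harmonic_on_iff_C2[OF assms(3)] by blast
qed

lemma harmonic_integrable_on_compact:
  fixes u :: "'a::euclidean_space \<Rightarrow> real"
  assumes M: "concentrated_measure M K" and K: "K \<subseteq> \<Omega>" and \<Omega>: "open \<Omega>" and u: "harmonic_on u \<Omega>"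
  shows "integrable M (\<lambda>x. indicator K x * u x)"
    and "ereal_integral M (\<lambda>x. ereal (u x)) = ereal (\<integral>x. indicator K x * u x \<partial>M)"
proof -
  interpret concentrated_measure M K by fact
  obtain g h where C: "C2_on \<Omega> u g h" using u harmonic_on_iff_C2[OF \<Omega>] by blast
  have cu: "continuous_on K u" using C2_on_continuous(1)[OF C] K by (rule continuous_on_subset)
  have m: "(\<lambda>x. indicator K x * u x) \<in> borel_measurable borel"
    using borel_measurable_continuous_on_indicator[OF _ cu] compact_K by (simp add: compact_imp_closed)
  have "compact (u ` K)" by (rule compact_continuous_image[OF cu compact_K])
  then obtain B where B: "\<forall>y\<in>K. \<bar>u y\<bar> \<le> B" by (auto simp: bounded_iff dest!: compact_imp_bounded)
  show i: "integrable M (\<lambda>x. indicator K x * u x)"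
    by (rule integrable_bounded[OF m, of B]) (use B in auto)
  have "ereal_integral M (\<lambda>x. ereal (u x)) = ereal_integral M (\<lambda>x. ereal (indicator K x * u x))"
    by (rule ereal_integral_cong_AE) (use AE_K in \<open>auto elim!: eventually_mono\<close>)
  then show "ereal_integral M (\<lambda>x. ereal (u x)) = ereal (\<integral>x. indicator K x * u x \<partial>M)"
    using ereal_integral_real[OF i] by simp
qed

lemma harmonic_balayage_integral_eq:
  fixes u :: "'a::euclidean_space \<Rightarrow> real"
  assumes \<delta>: "concentrated_measure \<delta> K" and \<omega>: "concentrated_measure \<omega> K" and K: "K \<subseteq> \<Omega>" and \<Omega>: "open \<Omega>"
    and bal: "balayage (har \<Omega>) \<delta> \<omega>" and u: "harmonic_on u \<Omega>"
  shows "(\<integral>x. indicator K x * u x \<partial>\<delta>) = (\<integral>x. indicator K x * u x \<partial>\<omega>)"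
proof -
  have le: "(\<integral>x. indicator K x * w x \<partial>\<delta>) \<le> (\<integral>x. indicator K x * w x \<partial>\<omega>)" if w: "harmonic_on w \<Omega>" for w
  proof -
    have "(\<lambda>x. ereal (w x)) \<in> har \<Omega>" using w by (auto simp: har_def)
    with bal have "ereal_integral \<delta> (\<lambda>x. ereal (w x)) \<le> ereal_integral \<omega> (\<lambda>x. ereal (w x))"
      unfolding balayage_def by (rule bspec)
    then show ?thesis
      by (simp add: harmonic_integrable_on_compact(2)[OF \<delta> K \<Omega> w] harmonic_integrable_on_compact(2)[OF \<omega> K \<Omega> w])
  qed
  show ?thesis using le[OF u] le[OF harmonic_on_uminus[OF \<Omega> u]] by simp
qed

text \<open>The geometric bound allows integration term by term, and the terms have equal integrals against both measures.\<close>

lemma kernel_integral_eq_of_harmonic_expansion: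
  fixes c :: "nat \<Rightarrow> 'a::euclidean_space \<Rightarrow> real"
  assumes \<delta>: "concentrated_measure \<delta> K" and \<omega>: "concentrated_measure \<omega> K" and K: "K \<subseteq> \<Omega>" and \<Omega>: "open \<Omega>"
    and bal: "balayage (har \<Omega>) \<delta> \<omega>" and x: "x \<notin> K"
    and h: "\<And>n. harmonic_on (c n) \<Omega>"
    and s: "\<And>y. y \<in> K \<Longrightarrow> (\<lambda>n. c n y) sums radial_kernel TYPE('a) (norm (y - x))"
    and b: "\<And>n y. y \<in> K \<Longrightarrow> \<bar>c n y\<bar> \<le> B / 2 ^ n"
  shows "ereal_integral \<delta> (\<lambda>y. kernel y x) = ereal_integral \<omega> (\<lambda>y. kernel y x)"
    and "ereal_integral \<delta> (\<lambda>y. - kernel y x) = ereal_integral \<omega> (\<lambda>y. - kernel y x)"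
proof -
  define k where "k y = indicator K y * radial_kernel TYPE('a) (norm (y - x))" for y
  have series: "(\<lambda>n. \<integral>y. indicator K y * c n y \<partial>M) sums (\<integral>y. k y \<partial>M) \<and> integrable M k
      \<and> (AE y in M. kernel y x = ereal (k y))"
    if M: "concentrated_measure M K" for M
  proof -
    interpret concentrated_measure M K by fact
    have i: "integrable M (\<lambda>y. indicator K y * c n y)" for n
      by (rule harmonic_integrable_on_compact(1)[OF M K \<Omega> h])
    have B0: "\<bar>indicator K y * c n y\<bar> \<le> \<bar>B\<bar> / 2 ^ n" for y n
    proof (cases "y \<in> K")
      case True
      have "B / 2 ^ n \<le> \<bar>B\<bar> / 2 ^ n" by (intro divide_right_mono) auto
      then show ?thesis using b[OF True, of n] True by simp
    qed simp
    have geo: "summable (\<lambda>n. \<bar>B\<bar> / 2 ^ n)"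
    proof -
      have "summable (\<lambda>n. \<bar>B\<bar> * (1 / 2) ^ n)" by (intro summable_mult summable_geometric) simp
      then show ?thesis by (simp add: power_divide)
    qed
    have geoM: "summable (\<lambda>n. \<bar>B\<bar> / 2 ^ n * measure M (space M))" using geo by (rule summable_mult2)
    have a: "AE y in M. summable (\<lambda>n. norm (indicator K y * c n y))"
      by (intro AE_I2 summable_comparison_test'[OF geo, of 0]) (use B0 in auto)
    have bs: "summable (\<lambda>n. \<integral>y. norm (indicator K y * c n y) \<partial>M)"
    proof (rule summable_comparison_test'[OF geoM, of 0])
      fix n
      have "(\<integral>y. norm (indicator K y * c n y) \<partial>M) \<le> (\<integral>y. \<bar>B\<bar> / 2 ^ n \<partial>M)"
        by (rule integral_mono) (use B0 i in auto)
      then show "norm (\<integral>y. norm (indicator K y * c n y) \<partial>M) \<le> \<bar>B\<bar> / 2 ^ n * measure M (space M)"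
        by (simp add: mult.commute)
    qed
    have eq: "(\<lambda>y. \<Sum>n. indicator K y * c n y) = k"
    proof
      fix y show "(\<Sum>n. indicator K y * c n y) = k y"
        using sums_unique[OF s, of y] by (cases "y \<in> K") (auto simp: k_def)
    qed
    have "AE y in M. kernel y x = ereal (k y)"
      using AE_K
    proof eventually_elim
      case (elim y)
      then have "y \<noteq> x" using x by blast
      then show ?case using elim by (simp add: kernel_eq_radial_kernel k_def norm_minus_commute)
    qed
    then show ?thesis
      using sums_integral[OF i a bs] integrable_suminf[OF i a bs] unfolding eq by blast
  qed
  have "(\<lambda>n. \<integral>y. indicator K y * c n y \<partial>\<delta>) = (\<lambda>n. \<integral>y. indicator K y * c n y \<partial>\<omega>)"
    using harmonic_balayage_integral_eq[OF \<delta> \<omega> K \<Omega> bal h] by blast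
  then have "(\<integral>y. k y \<partial>\<delta>) = (\<integral>y. k y \<partial>\<omega>)"
    using series[OF \<delta>] series[OF \<omega>] by (metis sums_unique2)
  moreover have "ereal_integral M (\<lambda>y. kernel y x) = ereal (\<integral>y. k y \<partial>M)"
    "ereal_integral M (\<lambda>y. - kernel y x) = ereal (- (\<integral>y. k y \<partial>M))" if M: "concentrated_measure M K" for M
  proof -
    have ik: "integrable M k" and ae: "AE y in M. kernel y x = ereal (k y)" using series[OF M] by auto
    have "ereal_integral M (\<lambda>y. kernel y x) = ereal_integral M (\<lambda>y. ereal (k y))"
      by (rule ereal_integral_cong_AE[OF ae])
    then show "ereal_integral M (\<lambda>y. kernel y x) = ereal (\<integral>y. k y \<partial>M)" using ereal_integral_real[OF ik] by simp
    have "ereal_integral M (\<lambda>y. - kernel y x) = ereal_integral M (\<lambda>y. ereal (- k y))"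
      by (rule ereal_integral_cong_AE) (use ae in \<open>auto elim!: eventually_mono\<close>)
    then show "ereal_integral M (\<lambda>y. - kernel y x) = ereal (- (\<integral>y. k y \<partial>M))"
      using ereal_integral_real[OF integrable_minus[OF ik]] by simp
  qed
  ultimately show "ereal_integral \<delta> (\<lambda>y. kernel y x) = ereal_integral \<omega> (\<lambda>y. kernel y x)"
    "ereal_integral \<delta> (\<lambda>y. - kernel y x) = ereal_integral \<omega> (\<lambda>y. - kernel y x)"
    using \<delta> \<omega> by simp_all
qed

text \<open>The set \<open>S\<close> collects the points of a large ball that are at distance at least \<open>\<eta>\<close> from the complement of \<open>\<Omega>\<close>.
A point of \<open>\<Omega>\<close> outside \<open>S\<close> is either close to the complement, and the kernel is expanded around a pole \<open>z\<close> there, or far away, and the kernel is expanded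
around the origin.\<close>

lemma kernel_balayage_of_harmonic:
  fixes \<Omega> :: "'a::euclidean_space set"
  assumes \<Omega>: "open \<Omega>" and \<delta>: "concentrated_measure \<delta> K" and \<omega>: "concentrated_measure \<omega> K" and K: "K \<subseteq> \<Omega>"
    and bal: "balayage (har \<Omega>) \<delta> \<omega>"
  obtains S where "compact S" "S \<subseteq> \<Omega>" "balayage (Kclass (\<Omega> - S) \<union> neg_Kclass (\<Omega> - S)) \<delta> \<omega>"
proof -
  interpret D: concentrated_measure \<delta> K by fact
  obtain e0 where e0: "e0 > 0" "(\<Union>x\<in>K. ball x e0) \<subseteq> \<Omega>"
    using compact_subset_open_imp_ball_epsilon_subset[OF D.compact_K \<Omega> K] by blast
  obtain T where T: "\<forall>y\<in>K. norm y \<le> T" using compact_imp_bounded[OF D.compact_K] bounded_iff by blast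
  \<comment> \<open>The factor \<open>5\<close> here and in \<open>R\<close> is the one that the expansion requires for convergence up to \<open>t = 2\<close>, with \<open>\<rho> = 1\<close>.\<close>
  define \<eta> where "\<eta> = e0 / 5"
  define R where "R = 5 * \<bar>T\<bar>"
  define S where "S = (cball 0 R - (\<Union>z\<in>- \<Omega>. ball z \<eta>)) \<union> K"
  have "compact (cball 0 R - (\<Union>z\<in>- \<Omega>. ball z \<eta>))" by (rule compact_diff) auto
  then have Sc: "compact S" using D.compact_K by (simp add: S_def compact_Un)
  have S\<Omega>: "S \<subseteq> \<Omega>" using K e0(1) by (auto simp: S_def \<eta>_def)
  have eq: "ereal_integral \<delta> (\<lambda>y. kernel y x) = ereal_integral \<omega> (\<lambda>y. kernel y x) \<and>
      ereal_integral \<delta> (\<lambda>y. - kernel y x) = ereal_integral \<omega> (\<lambda>y. - kernel y x)" if x: "x \<in> \<Omega> - S" for x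
  proof -
    have xK: "x \<notin> K" using x by (simp add: S_def)
    consider z where "z \<notin> \<Omega>" "dist z x < \<eta>" | "R < norm x" using x by (auto simp: S_def)
    then show ?thesis
    proof cases
      case 1
      have far: "e0 \<le> norm (y - z)" if "y \<in> K" for y
      proof (rule ccontr)
        assume "\<not> e0 \<le> norm (y - z)"
        then have "z \<in> ball y e0" by (simp add: dist_norm)
        then have "z \<in> (\<Union>x\<in>K. ball x e0)" using that by blast
        then show False using e0(2) 1(1) by blast
      qed
      have v: "5 * 1 * norm (z - x) \<le> norm (y - z)" if "y \<in> K" for y
        using far[OF that] 1(2) by (simp add: \<eta>_def dist_norm)
      show ?thesis
      proof (intro conjI kernel_integral_eq_of_harmonic_expansion[OF \<delta> \<omega> K \<Omega> bal xK, where c="\<lambda>n y. kernel_coeff (y - z) (z - x) n"])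
        show "harmonic_on (\<lambda>y. kernel_coeff (y - z) (z - x) n) \<Omega>" "harmonic_on (\<lambda>y. kernel_coeff (y - z) (z - x) n) \<Omega>" for n
          by (rule kernel_coeff_harmonic_pole[OF \<Omega> 1(1)])+
        show sm: "(\<lambda>n. kernel_coeff (y - z) (z - x) n) sums radial_kernel TYPE('a) (norm (y - x))" if "y \<in> K" for y
        proof -
          have "y - z \<noteq> 0" using far[OF that] e0(1) by auto
          from kernel_coeff_sums[OF this _ v[OF that], of 1] show ?thesis by simp
        qed
        then show "(\<lambda>n. kernel_coeff (y - z) (z - x) n) sums radial_kernel TYPE('a) (norm (y - x))" if "y \<in> K" for y using that .
        show bd: "\<bar>kernel_coeff (y - z) (z - x) n\<bar> \<le> complex_kernel_bound TYPE('a) (e0\<^sup>2 / 25) (2 * (T + norm z)\<^sup>2) / 2 ^ n" if "y \<in> K" for n y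
        proof -
          have "norm (y - z) \<le> T + norm z" using norm_triangle_ineq4[of y z] T that by force
          from kernel_coeff_bound[OF e0(1) far[OF that] this _ v[OF that], of n] show ?thesis by simp
        qed
        then show "\<bar>kernel_coeff (y - z) (z - x) n\<bar> \<le> complex_kernel_bound TYPE('a) (e0\<^sup>2 / 25) (2 * (T + norm z)\<^sup>2) / 2 ^ n" if "y \<in> K" for n y using that .
      qed
    next
      case 2
      have x0: "x \<noteq> 0" using 2 by (auto simp: R_def)
      have v: "5 * 1 * norm y \<le> norm (- x)" if "y \<in> K" for y
        using T that 2 by (force simp: R_def)
      show ?thesis
      proof (intro conjI kernel_integral_eq_of_harmonic_expansion[OF \<delta> \<omega> K \<Omega> bal xK, where c="\<lambda>n y. kernel_coeff (- x) y n"])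
        show "harmonic_on (\<lambda>y. kernel_coeff (- x) y n) \<Omega>" "harmonic_on (\<lambda>y. kernel_coeff (- x) y n) \<Omega>" for n
          by (rule harmonic_restrict[OF open_UNIV subset_UNIV \<Omega> kernel_coeff_harmonic_entire[OF x0]])+
        show sm: "(\<lambda>n. kernel_coeff (- x) y n) sums radial_kernel TYPE('a) (norm (y - x))" if "y \<in> K" for y
          using kernel_coeff_sums[of "- x" 1 y 1] x0 v[OF that] by simp
        then show "(\<lambda>n. kernel_coeff (- x) y n) sums radial_kernel TYPE('a) (norm (y - x))" if "y \<in> K" for y using that .
        show bd: "\<bar>kernel_coeff (- x) y n\<bar> \<le> complex_kernel_bound TYPE('a) ((norm x)\<^sup>2 / 25) (2 * (norm x)\<^sup>2) / 2 ^ n" if "y \<in> K" for n y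
          using kernel_coeff_bound[of "norm x" "- x" "norm x" 1 y n] x0 v[OF that] by simp
        then show "\<bar>kernel_coeff (- x) y n\<bar> \<le> complex_kernel_bound TYPE('a) ((norm x)\<^sup>2 / 25) (2 * (norm x)\<^sup>2) / 2 ^ n" if "y \<in> K" for n y using that .
      qed
    qed
  qed
  have "balayage (Kclass (\<Omega> - S) \<union> neg_Kclass (\<Omega> - S)) \<delta> \<omega>"
    unfolding balayage_def Kclass_def neg_Kclass_def using eq by auto
  then show ?thesis by (rule that[OF Sc S\<Omega>])
qed

lemma balayage_mono: "balayage H \<delta> \<omega> \<Longrightarrow> H' \<subseteq> H \<Longrightarrow> balayage H' \<delta> \<omega>"
  unfolding balayage_def by blast

theorem theorem1:
  fixes \<Omega> :: "'a::euclidean_space set" and \<delta> \<omega> :: "'a measure"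
  assumes "open \<Omega>" and "\<Omega> \<noteq> {}"
    and "\<delta> \<in> Meas_cmp \<Omega>" and "\<omega> \<in> Meas_cmp \<Omega>"
  shows "(balayage (har \<Omega>) \<delta> \<omega> \<longleftrightarrow>
           (\<exists>S. compact S \<and> S \<subseteq> \<Omega> \<and>
                balayage (Kclass (\<Omega> - S) \<union> neg_Kclass (\<Omega> - S)) \<delta> \<omega>)) \<and>
         (balayage (sbh \<Omega>) \<delta> \<omega> \<longleftrightarrow>
           (\<exists>S. compact S \<and> S \<subseteq> \<Omega> \<and>
                balayage (Kclass \<Omega> \<union> neg_Kclass (\<Omega> - S)) \<delta> \<omega>))"
proof -
  define K where "K = measure_support \<delta> \<union> measure_support \<omega>"
  note d = Meas_cmp_concentrated[OF assms(3)] and w = Meas_cmp_concentrated[OF assms(4)]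
  have K: "compact K" "K \<subseteq> \<Omega>"
    using d w unfolding K_def concentrated_measure_def concentrated_measure_axioms_def by auto
  have \<delta>: "concentrated_measure \<delta> K" by (rule concentrated_measure_superset[OF d(1) _ K(1)]) (simp add: K_def)
  have \<omega>: "concentrated_measure \<omega> K" by (rule concentrated_measure_superset[OF w(1) _ K(1)]) (simp add: K_def)
  note har_imp = kernel_balayage_of_harmonic[OF assms(1) \<delta> \<omega> K(2)]
  show ?thesis
  proof (intro conjI iffI)
    assume "balayage (har \<Omega>) \<delta> \<omega>"
    then show "\<exists>S. compact S \<and> S \<subseteq> \<Omega> \<and> balayage (Kclass (\<Omega> - S) \<union> neg_Kclass (\<Omega> - S)) \<delta> \<omega>"
      using har_imp by metis
  next
    assume "\<exists>S. compact S \<and> S \<subseteq> \<Omega> \<and> balayage (Kclass (\<Omega> - S) \<union> neg_Kclass (\<Omega> - S)) \<delta> \<omega>"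
    then show "balayage (har \<Omega>) \<delta> \<omega>"
      using harmonic_balayage_of_kernels[OF assms(1) \<delta> \<omega> K(2)] by metis
  next
    assume sb: "balayage (sbh \<Omega>) \<delta> \<omega>"
    have "har \<Omega> \<subseteq> sbh \<Omega>" by (auto simp: har_def sbh_def intro: harmonic_subharmonic[OF assms(1)])
    then have "balayage (har \<Omega>) \<delta> \<omega>" by (rule balayage_mono[OF sb])
    then obtain S where S: "compact S" "S \<subseteq> \<Omega>" "balayage (Kclass (\<Omega> - S) \<union> neg_Kclass (\<Omega> - S)) \<delta> \<omega>"
      using har_imp by metis
    have "Kclass \<Omega> \<subseteq> sbh \<Omega>" by (auto simp: Kclass_def sbh_def intro: kernel_subharmonic[OF assms(1)])
    then have "balayage (Kclass \<Omega>) \<delta> \<omega>" by (rule balayage_mono[OF sb])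
    moreover have "balayage (neg_Kclass (\<Omega> - S)) \<delta> \<omega>" by (rule balayage_mono[OF S(3)]) simp
    ultimately have "balayage (Kclass \<Omega> \<union> neg_Kclass (\<Omega> - S)) \<delta> \<omega>"
      unfolding balayage_def by blast
    with S show "\<exists>S. compact S \<and> S \<subseteq> \<Omega> \<and> balayage (Kclass \<Omega> \<union> neg_Kclass (\<Omega> - S)) \<delta> \<omega>" by blast
  next
    assume "\<exists>S. compact S \<and> S \<subseteq> \<Omega> \<and> balayage (Kclass \<Omega> \<union> neg_Kclass (\<Omega> - S)) \<delta> \<omega>"
    then show "balayage (sbh \<Omega>) \<delta> \<omega>"
      using subharmonic_balayage_of_kernels[OF assms(1) \<delta> \<omega> K(2)] by metis
  qed
qed

end
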